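(* Let $(u,u_y)\in \mathsf{Pot}$ be given, let $M(\lambda)=\begin{pmatrix} a(\lambda) & b(\lambda)\\ c(\lambda) & d(\lambda)\end{pmatrix}$ be the monodromy associated to $(u,u_y)$, and put $\tau := e^{-u(0)/2}$. Then: (1) $a-a_0 \in \mathrm{As}(\mathbb{C}^*,\ell^2_{0,0},1)$; (2) $b-\tau^{-1}b_0\in \mathrm{As}_\infty(\mathbb{C}^*,\ell^2_1,1)$ and $b-\tau\, b_0\in \mathrm{As}_0(\mathbb{C}^*,\ell^2_{-1},1)$; (3) $c-\tau\, c_0\in \mathrm{As}_\infty(\mathbb{C}^*,\ell^2_{-1},1)$ and $c-\tau^{-1}c_0\in \mathrm{As}_0(\mathbb{C}^*,\ell^2_{1},1)$; (4) $d-d_0 \in \mathrm{As}(\mathbb{C}^*,\ell^2_{0,0},1)$.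
   Context: Potentials: $\mathsf{Pot}:=\{(u,u_y)\in W^{1,2}([0,1])\times L^2([0,1]) \mid u(0)=u(1)\}$, complex-valued functions; $u_y$ is an independent function, not a derivative of $u$. Monodromy: for $\lambda\in\mathbb{C}^*$ put $$\alpha_\lambda=\frac14\begin{pmatrix} i\,u_y & -e^{u/2}-\lambda^{-1}e^{-u/2}\\ e^{u/2}+\lambda e^{-u/2} & -i\,u_y\end{pmatrix}dx ,$$ let $F_\lambda$ be the solution on $[0,1]$ of $dF_\lambda=\alpha_\lambda F_\lambda$ with $F_\lambda(0)=\mathbf 1$, and $M(\lambda):=F_\lambda(1)\in \mathrm{SL}(2,\mathbb{C})$. The entries $a,b,c,d$ are holomorphic functions of $\lambda\in\mathbb{C}^*$. Vacuum ($u=u_y=0$): with $\zeta(\lambda):=\frac14(\lambda^{1/2}+\lambda^{-1/2})$ (determined up to sign), $a_0=d_0=\cos\zeta(\lambda)$, $b_0=-\lambda^{-1/2}\sin\zeta(\lambda)$, $c_0=\lambda^{1/2}\sin\zeta(\lambda)$; these are well-defined holomorphic functions on $\mathbb{C}^*$. Annuli: for $k>0$, $S_k=\{\lambda\in\mathbb{C}^* : (k-\frac12)\pi\le|\zeta(\lambda)|\le(k+\frac12)\pi,\ |\lambda|>1\}$; $S_0=\{\lambda\in\mathbb{C}^*: |\zeta(\lambda)|\le\frac{\pi}{2}\}$; for $k<0$, $S_k=\{\lambda\in\mathbb{C}^*: (-k-\frac12)\pi\le|\zeta(\lambda)|\le(-k+\frac12)\pi,\ |\lambda|<1\}$. Sequence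 spaces: for $n,m\in\mathbb{Z}$, $\ell^2_{n,m}$ is the space of complex sequences $(a_k)_{k\in\mathbb{Z}}$ with $\sum_{k<0}|k^m a_k|^2+|a_0|^2+\sum_{k>0}|k^n a_k|^2<\infty$. Asymptotic spaces: for $s\ge0$, $\mathrm{As}(\mathbb{C}^*,\ell^2_{n,m},s)$ is the space of holomorphic $f:\mathbb{C}^*\to\mathbb{C}$ for which there is a sequence $(a_k)_{k\in\mathbb{Z}}\in\ell^2_{n,m}$ of non-negative numbers with $$|f(\lambda)|\le a_k\, e^{s|\mathrm{Im}\,\zeta(\lambda)|}\qquad\text{for all }k\in\mathbb{Z},\ \lambda\in S_k .$$ $\mathrm{As}_\infty(\mathbb{C}^*,\ell^2_n,s)$ is defined likewise, requiring the estimate only for $k\ge0$, with $(a_k)_{k\ge0}$ satisfying $\sum_{k>0}|k^na_k|^2<\infty$; $\mathrm{As}_0(\mathbb{C}^*,\ell^2_m,s)$ is defined likewise, requiring the estimate only for $k\le0$, with $\sum_{k<0}|k^ma_k|^2<\infty$. *)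

theory Defs
  imports "HOL-Complex_Analysis.Complex_Analysis"
begin

text \<open>
  Elements of \<open>L\<^sup>2([0,1])\<close> and \<open>W\<^sup>1\<^sup>,\<^sup>2([0,1])\<close> are represented by functions
  on the whole real line whose values outside \<open>[0,1]\<close> are irrelevant.  An element of
  \<open>W\<^sup>1\<^sup>,\<^sup>2([0,1])\<close> is represented by its continuous representative, so that point
  evaluation makes sense.
\<close>

definition L2_01 :: "(real \<Rightarrow> complex) set" where
  "L2_01 = {f. f \<in> borel_measurable (lebesgue_on {0..1}) \<and>
               integrable (lebesgue_on {0..1}) (\<lambda>x. (cmod (f x))\<^sup>2)}"

text \<open>
  Weak derivatives are tested against \<open>C\<^sup>1\<close> functions with compact support in \<open>(0,1)\<close>; this
  gives the same notion as smooth test functions.  Real-valued ones suffice by linearity.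
\<close>
definition test_fun_01 :: "(real \<Rightarrow> real) \<Rightarrow> (real \<Rightarrow> real) \<Rightarrow> bool" where
  "test_fun_01 \<phi> \<phi>' \<longleftrightarrow>
     (\<forall>x. (\<phi> has_real_derivative \<phi>' x) (at x)) \<and> continuous_on UNIV \<phi>' \<and>
     (\<exists>K. compact K \<and> K \<subseteq> {0<..<1} \<and> (\<forall>x. x \<notin> K \<longrightarrow> \<phi> x = 0))"

definition has_weak_derivative_01 ::
    "(real \<Rightarrow> 'a::euclidean_space) \<Rightarrow> (real \<Rightarrow> 'a) \<Rightarrow> bool" where
  "has_weak_derivative_01 f g \<longleftrightarrow>
     integrable (lebesgue_on {0..1}) f \<and> integrable (lebesgue_on {0..1}) g \<and>
     (\<forall>\<phi> \<phi>'. test_fun_01 \<phi> \<phi>' \<longrightarrow>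
        (LINT x|lebesgue_on {0..1}. \<phi>' x *\<^sub>R f x) =
          - (LINT x|lebesgue_on {0..1}. \<phi> x *\<^sub>R g x))"

definition W12_01 :: "(real \<Rightarrow> complex) set" where
  "W12_01 = {f. continuous_on {0..1} f \<and> f \<in> L2_01 \<and>
                (\<exists>g\<in>L2_01. has_weak_derivative_01 f g)}"

definition Pot :: "((real \<Rightarrow> complex) \<times> (real \<Rightarrow> complex)) set" where
  "Pot = {(u, uy). u \<in> W12_01 \<and> uy \<in> L2_01 \<and> u 0 = u 1}"

definition alpha ::
    "(real \<Rightarrow> complex) \<Rightarrow> (real \<Rightarrow> complex) \<Rightarrow> complex \<Rightarrow> real \<Rightarrow> complex^2^2" where
  "alpha u uy lam x = (1/4) *\<^sub>R vector
     [vector [\<i> * uy x, - exp (u x / 2) - inverse lam * exp (- u x / 2)],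
      vector [exp (u x / 2) + lam * exp (- u x / 2), - \<i> * uy x]]"

text \<open>
  Since \<open>uy\<close> is only square-integrable, the equation \<open>dF = \<alpha>\<^sub>\<lambda> F\<close> is understood in the sense of
  weak derivatives, for continuous \<open>F\<close>.
\<close>
definition is_frame ::
    "(real \<Rightarrow> complex) \<Rightarrow> (real \<Rightarrow> complex) \<Rightarrow> complex \<Rightarrow> (real \<Rightarrow> complex^2^2) \<Rightarrow> bool" where
  "is_frame u uy lam F \<longleftrightarrow>
     continuous_on {0..1} F \<and> F 0 = mat 1 \<and>
     has_weak_derivative_01 F (\<lambda>x. alpha u uy lam x ** F x)"

definition monodromy ::
    "(real \<Rightarrow> complex) \<Rightarrow> (real \<Rightarrow> complex) \<Rightarrow> complex \<Rightarrow> complex^2^2" where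
  "monodromy u uy lam = (THE M. \<exists>F. is_frame u uy lam F \<and> M = F 1)"

text \<open>
  The principal square root is used for \<open>\<lambda>\<^sup>1\<^sup>/\<^sup>2\<close> throughout.  Replacing it by its negative changes
  the sign of \<open>zeta\<close> and leaves \<open>a0\<close>, \<open>b0\<close>, \<open>c0\<close>, \<open>d0\<close>, \<open>|zeta|\<close> and \<open>|Im zeta|\<close> unchanged.
\<close>
definition zeta :: "complex \<Rightarrow> complex" where
  "zeta lam = (csqrt lam + inverse (csqrt lam)) / 4"

definition a0 :: "complex \<Rightarrow> complex" where "a0 lam = cos (zeta lam)"
definition b0 :: "complex \<Rightarrow> complex" where "b0 lam = - inverse (csqrt lam) * sin (zeta lam)"
definition c0 :: "complex \<Rightarrow> complex" where "c0 lam = csqrt lam * sin (zeta lam)"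
definition d0 :: "complex \<Rightarrow> complex" where "d0 lam = cos (zeta lam)"

definition annulus :: "int \<Rightarrow> complex set" where
  "annulus k =
     (if k > 0 then
        {lam. lam \<noteq> 0 \<and> (of_int k - 1/2) * pi \<le> cmod (zeta lam) \<and>
             cmod (zeta lam) \<le> (of_int k + 1/2) * pi \<and> cmod lam > 1}
      else if k = 0 then
        {lam. lam \<noteq> 0 \<and> cmod (zeta lam) \<le> pi / 2}
      else
        {lam. lam \<noteq> 0 \<and> (- of_int k - 1/2) * pi \<le> cmod (zeta lam) \<and>
             cmod (zeta lam) \<le> (- of_int k + 1/2) * pi \<and> cmod lam < 1})"

definition l2_pos :: "int \<Rightarrow> (int \<Rightarrow> complex) set" where
  "l2_pos n = {a. (\<lambda>k. (cmod (of_int k powi n * a k))\<^sup>2) summable_on {k. k > 0}}"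

definition l2_neg :: "int \<Rightarrow> (int \<Rightarrow> complex) set" where
  "l2_neg m = {a. (\<lambda>k. (cmod (of_int k powi m * a k))\<^sup>2) summable_on {k. k < 0}}"

definition l2 :: "int \<Rightarrow> int \<Rightarrow> (int \<Rightarrow> complex) set" where
  "l2 n m = l2_pos n \<inter> l2_neg m"

definition As :: "int \<Rightarrow> int \<Rightarrow> real \<Rightarrow> (complex \<Rightarrow> complex) set" where
  "As n m s = {f. f holomorphic_on (- {0}) \<and>
     (\<exists>a::int \<Rightarrow> real. (\<forall>k. 0 \<le> a k) \<and> (\<lambda>k. complex_of_real (a k)) \<in> l2 n m \<and>
        (\<forall>k. \<forall>lam\<in>annulus k. cmod (f lam) \<le> a k * exp (s * \<bar>Im (zeta lam)\<bar>)))}"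

text \<open>
  In the one-sided spaces the values \<open>a k\<close> for \<open>k < 0\<close>, respectively \<open>k > 0\<close>, are not
  constrained.
\<close>
definition As_infty :: "int \<Rightarrow> real \<Rightarrow> (complex \<Rightarrow> complex) set" where
  "As_infty n s = {f. f holomorphic_on (- {0}) \<and>
     (\<exists>a::int \<Rightarrow> real. (\<forall>k\<ge>0. 0 \<le> a k) \<and> (\<lambda>k. complex_of_real (a k)) \<in> l2_pos n \<and>
        (\<forall>k\<ge>0. \<forall>lam\<in>annulus k. cmod (f lam) \<le> a k * exp (s * \<bar>Im (zeta lam)\<bar>)))}"

definition As_zero :: "int \<Rightarrow> real \<Rightarrow> (complex \<Rightarrow> complex) set" where
  "As_zero m s = {f. f holomorphic_on (- {0}) \<and>
     (\<exists>a::int \<Rightarrow> real. (\<forall>k\<le>0. 0 \<le> a k) \<and> (\<lambda>k. complex_of_real (a k)) \<in> l2_neg m \<and>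
        (\<forall>k\<le>0. \<forall>lam\<in>annulus k. cmod (f lam) \<le> a k * exp (s * \<bar>Im (zeta lam)\<bar>)))}"

end

theory Submission imports Defs begin

text \<open>
  Conjugating by \<open>diag(\<lambda>\<^sup>1\<^sup>/\<^sup>2 e\<^sup>-\<^sup>u\<^sup>/\<^sup>4, e\<^sup>u\<^sup>/\<^sup>4)\<close> and diagonalising the vacuum connection turns the
  frame equation into a system with diagonal \<open>\<plusminus>\<i> \<zeta>\<close>, off-diagonal part \<open>q = (\<i> u\<^sub>y - u') / 4\<close>
  and a remainder of size \<open>|\<lambda>|\<^sup>-\<^sup>1\<^sup>/\<^sup>2\<close>.  By Gronwall, the deviation from the vacuum is controlled
  by truncated Laplace transforms of \<open>q\<close> at \<open>\<plusminus>2 \<zeta>\<close>.  As \<open>\<lambda>\<close> ranges over a whole annulus,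
  square summability of these transforms along arbitrary \<open>\<lambda>\<^sub>k \<in> S\<^sub>k\<close> is a Carleson embedding.
  It follows by duality from a bound on the Gram matrix of the functions
  \<open>exp (\<i> \<xi>\<^sub>k t - \<eta>\<^sub>k |t|)\<close>, whose entries are dominated by linearised maximal operators.
  The end \<open>\<lambda> \<rightarrow> 0\<close> is reduced to \<open>\<lambda> \<rightarrow> \<infinity>\<close> by the symmetry \<open>u \<mapsto> -u\<close>, \<open>\<lambda> \<mapsto> \<lambda>\<^sup>-\<^sup>1\<close>.
\<close>

text \<open>The bound \<open>a k\<close> must hold on all of S_k, so the estimate is needed along an
  arbitrary choice of one point per annulus. For nearly real \<zeta>_k a Bessel inequality would do,
  but the real parts of the chosen \<zeta>_k may bunch together or coincide; all that is known is
  that |\<zeta>_k| lies within \<pi>/2 of k\<pi>. Once every \<eta>_k is raised by 1, this still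
  forces |j - k| \<le> |\<xi>_j - \<xi>_k| + \<eta>_j + \<eta>_k: frequencies come close only where
  the damping is strong. Hence the Gram entries are dominated by Poisson kernels in j - k whose
  height depends on the row or on the column. Row sums of such a kernel are bounded, but column sums
  need not be: heights comparable to |j - k| make them grow like a harmonic series. A plain Schur
  test therefore fails, and the quadratic form is compared with its own square. The transforms are
  truncated at every x in [0,1], and their squares have bounded sums over k at each fixed x, not
  after a supremum over x. This is why Gronwall's inequality is kept with the inhomogeneity under
  the integral.\<close>

no_notation fps_nth (infixl \<open>$\<close> 75)

hide_fact (open) Bochner_Integration.integrable_add
  Bochner_Integration.integrable_diff
  Bochner_Integration.integrable_sum
  Bochner_Integration.integral_add
  Bochner_Integration.integral_diff
  Bochner_Integration.integral_mult_left
  Bochner_Integration.integral_mult_right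
  Bochner_Integration.integral_nonneg
  Bochner_Integration.integral_norm_bound_integral
  Bochner_Integration.integral_sum
  Equivalence_Measurable_On_Borel.integral_combine

subsection \<open>Functions with an integrable derivative\<close>

abbreviation L1_01 :: "(real \<Rightarrow> 'a::euclidean_space) \<Rightarrow> bool" where
  "L1_01 f \<equiv> f absolutely_integrable_on {0..1}"

text \<open>Absolute continuity on [0,1] with density \<open>f'\<close>, in integral form: no
  pointwise derivative occurs, so \<open>f'\<close> matters only up to null sets and need only be
  integrable. The differential equations below are stated in this form.\<close>

definition ac_deriv :: "(real \<Rightarrow> 'a::euclidean_space) \<Rightarrow> (real \<Rightarrow> 'a) \<Rightarrow> bool" where
  "ac_deriv f f' \<longleftrightarrow> L1_01 f' \<and>
     (\<forall>x\<in>{0..1}. f x = f 0 + integral {0..x} f')"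

lemma ac_derivI:
  assumes "L1_01 f'" "\<And>x. x \<in> {0..1} \<Longrightarrow> f x = f 0 + integral {0..x} f'"
  shows "ac_deriv f f'"
  using assms unfolding ac_deriv_def by blast

lemma ac_deriv_integrable: "ac_deriv f f' \<Longrightarrow> L1_01 f'"
  by (simp add: ac_deriv_def)

lemma ac_deriv_integral_eq:
  "ac_deriv f f' \<Longrightarrow> x \<in> {0..1} \<Longrightarrow> f x = f 0 + integral {0..x} f'"
  unfolding ac_deriv_def by blast

lemma L1_01_on:
  fixes f :: "real \<Rightarrow> 'a::euclidean_space"
  assumes "L1_01 f" "0 \<le> x" "y \<le> 1"
  shows "f absolutely_integrable_on {x..y}" "f integrable_on {x..y}"
    "(\<lambda>t. norm (f t)) integrable_on {x..y}"
proof -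
  show *: "f absolutely_integrable_on {x..y}"
    using assms by (intro absolutely_integrable_on_subinterval[OF assms(1)]) auto
  then show "f integrable_on {x..y}" "(\<lambda>t. norm (f t)) integrable_on {x..y}"
    by (auto simp: absolutely_integrable_on_def)
qed

lemma L1_01_prod_left:
  assumes h: "bounded_bilinear (h :: 'a::euclidean_space \<Rightarrow> 'b::euclidean_space \<Rightarrow> 'c::euclidean_space)"
    and f: "L1_01 f" and g: "continuous_on {0..1} g"
  shows "L1_01 (\<lambda>x. h (f x) (g x))"
proof -
  have "bilinear (\<lambda>x y. h y x)"
    using bounded_bilinear.flip[OF h] by (simp add: bilinear_conv_bounded_bilinear)
  then show ?thesis
    by (rule absolutely_integrable_bounded_measurable_product[of "\<lambda>x y. h y x" g "{0..1}" f])
      (use f g in \<open>auto intro!: continuous_imp_measurable_on_sets_lebesgue compact_imp_bounded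
         compact_continuous_image\<close>)
qed

lemma L1_01_prod_right:
  assumes h: "bounded_bilinear (h :: 'a::euclidean_space \<Rightarrow> 'b::euclidean_space \<Rightarrow> 'c::euclidean_space)"
    and f: "L1_01 f" and g: "continuous_on {0..1} g"
  shows "L1_01 (\<lambda>x. h (g x) (f x))"
  using L1_01_prod_left[OF bounded_bilinear.flip[OF h] f g] .

lemmas L1_01_mult_left =
  L1_01_prod_left[OF bounded_bilinear_mult]
lemmas L1_01_mult_right =
  L1_01_prod_right[OF bounded_bilinear_mult]

lemma integral_diff_01:
  fixes f :: "real \<Rightarrow> 'a::euclidean_space"
  assumes "L1_01 f" "0 \<le> x" "x \<le> y" "y \<le> 1"
  shows "integral {0..y} f - integral {0..x} f = integral {x..y} f"
  using integral_combine[of 0 x y f]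
    L1_01_on[OF assms(1), of 0 y] assms
  by (simp add: algebra_simps)

lemma ac_deriv_diff:
  assumes "ac_deriv f f'" "0 \<le> x" "x \<le> y" "y \<le> 1"
  shows "f y - f x = integral {x..y} f'"
proof -
  have "f y = f 0 + integral {0..y} f'" "f x = f 0 + integral {0..x} f'"
    using assms by (intro ac_deriv_integral_eq; simp)+
  then show ?thesis
    using integral_diff_01[of f' x y] assms by (simp add: ac_deriv_integrable)
qed

lemma ac_deriv_continuous:
  assumes "ac_deriv f f'"
  shows "continuous_on {0..1} f"
proof -
  have "continuous_on {0..1} (\<lambda>x. f 0 + integral {0..x} f')"
    using assms by (intro continuous_intros indefinite_integral_continuous_1)
      (auto dest: ac_deriv_integrable simp: absolutely_integrable_on_def)
  then show ?thesis
    by (rule continuous_on_eq) (simp add: ac_deriv_integral_eq[OF assms, symmetric])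
qed

lemma ac_deriv_integral:
  assumes "L1_01 f'"
  shows "ac_deriv (\<lambda>x. c + integral {0..x} f') f'"
  using assms by (auto simp: ac_deriv_def)

lemma ac_deriv_cong:
  assumes "ac_deriv f f'" "\<And>x. x \<in> {0..1} \<Longrightarrow> f x = g x" "\<And>x. x \<in> {0..1} \<Longrightarrow> f' x = g' x"
  shows "ac_deriv g g'"
proof -
  have "L1_01 g'"
    using assms(1,3) set_integrable_cong[of lebesgue lebesgue "{0..1}" "{0..1}" f' g'] by (simp add: ac_deriv_integrable)
  moreover have "integral {0..x} f' = integral {0..x} g'" if "x \<in> {0..1}" for x
    using assms(3) that by (intro integral_cong) auto
  moreover have "f x = f 0 + integral {0..x} f'" if "x \<in> {0..1}" for x
    using assms(1) that by (rule ac_deriv_integral_eq)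
  ultimately show ?thesis
    using assms(2) by (intro ac_derivI) (metis atLeastAtMost_iff order_refl zero_le_one)+
qed

lemma ac_deriv_linear:
  assumes "ac_deriv f f'" "bounded_linear h"
  shows "ac_deriv (\<lambda>x. h (f x)) (\<lambda>x. h (f' x))"
proof (rule ac_derivI)
  interpret bounded_linear h by fact
  show "L1_01 (\<lambda>x. h (f' x))"
    using absolutely_integrable_linear[OF _ assms(2), where f = f'] assms(1) by (simp add: ac_deriv_integrable o_def)
  fix x :: real assume x: "x \<in> {0..1}"
  have "f' integrable_on {0..x}"
    using assms(1) x by (auto dest: ac_deriv_integrable intro: L1_01_on)
  then show "h (f x) = h (f 0) + integral {0..x} (\<lambda>x. h (f' x))"
    using integral_linear[OF _ assms(2), where f = f' and S = "{0..x}"] ac_deriv_integral_eq[OF assms(1) x]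
    by (simp add: o_def add)
qed

lemma ac_deriv_add:
  assumes "ac_deriv f f'" "ac_deriv g g'"
  shows "ac_deriv (\<lambda>x. f x + g x) (\<lambda>x. f' x + g' x)"
proof (rule ac_derivI)
  show "L1_01 (\<lambda>x. f' x + g' x)"
    using assms by (intro set_integral_add ac_deriv_integrable)
  fix x :: real assume x: "x \<in> {0..1}"
  then have "integral {0..x} (\<lambda>x. f' x + g' x) = integral {0..x} f' + integral {0..x} g'"
    using assms by (intro integral_add) (auto dest: ac_deriv_integrable intro: L1_01_on)
  then show "f x + g x = f 0 + g 0 + integral {0..x} (\<lambda>x. f' x + g' x)"
    using ac_deriv_integral_eq[OF assms(1) x] ac_deriv_integral_eq[OF assms(2) x] by simp
qed

lemma ac_deriv_minus:
  assumes "ac_deriv f f'"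
  shows "ac_deriv (\<lambda>x. - f x) (\<lambda>x. - f' x)"
  using ac_deriv_linear[OF assms, of uminus] by (simp add: bounded_linear_minus[OF bounded_linear_ident])

lemma ac_deriv_sub:
  assumes "ac_deriv f f'" "ac_deriv g g'"
  shows "ac_deriv (\<lambda>x. f x - g x) (\<lambda>x. f' x - g' x)"
  using ac_deriv_add[OF assms(1) ac_deriv_minus[OF assms(2)]] by simp

lemma ac_deriv_of_real: "ac_deriv (\<lambda>x. c * complex_of_real x) (\<lambda>x. c)"
  by (auto simp: ac_deriv_def scaleR_conv_of_real)

lemma ac_deriv_has_vector_derivative:
  assumes "\<And>x. x \<in> {0..1} \<Longrightarrow> (f has_vector_derivative f' x) (at x)" "continuous_on {0..1} f'"
  shows "ac_deriv f f'"
proof (rule ac_derivI)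
  show "L1_01 f'"
    using assms(2) by (rule absolutely_integrable_continuous_real)
  fix x :: real assume x: "x \<in> {0..1}"
  have "(f' has_integral f x - f 0) {0..x}"
    using x assms(1) by (intro fundamental_theorem_of_calculus) (auto intro: has_vector_derivative_at_within)
  then show "f x = f 0 + integral {0..x} f'" by (simp add: integral_unique)
qed

text \<open>Cutting [0,x] into N equal pieces shorter than \<open>d\<close> makes the local bounds
  add up, and their right-hand sides telescope to \<open>e * (m x - m 0)\<close>; then
  \<open>e\<close> tends to 0. This replaces the mean value theorem where no pointwise derivative is
  available.\<close>

lemma constant_on_01_if_local_error:
  fixes \<phi> :: "real \<Rightarrow> 'a::real_normed_vector" and m :: "real \<Rightarrow> real"
  assumes *: "\<And>e. e > 0 \<Longrightarrow> \<exists>d>0. \<forall>x y. 0 \<le> x \<longrightarrow> x \<le> y \<longrightarrow> y \<le> 1 \<longrightarrow> y - x < d \<longrightarrow>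
                 norm (\<phi> y - \<phi> x) \<le> e * (m y - m x)"
    and x: "x \<in> {0..1}"
  shows "\<phi> x = \<phi> 0"
proof -
  have le: "norm (\<phi> x - \<phi> 0) \<le> e * (m x - m 0)" if e: "e > 0" for e
  proof -
    obtain d where d: "d > 0" and D: "\<And>x y. 0 \<le> x \<Longrightarrow> x \<le> y \<Longrightarrow> y \<le> 1 \<Longrightarrow> y - x < d \<Longrightarrow>
                 norm (\<phi> y - \<phi> x) \<le> e * (m y - m x)"
      using *[OF e] by blast
    obtain N :: nat where N: "1 / d < real N" using reals_Archimedean2 by blast
    have "0 < 1 / d" using d by simp
    with N have N0: "N > 0" by (cases N) auto
    have Nd: "1 / real N < d" using N N0 d by (simp add: field_simps)
    have "norm (\<phi> (x * real k / N) - \<phi> 0) \<le> e * (m (x * real k / N) - m 0)" if "k \<le> N" for k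
      using that
    proof (induction k)
      case (Suc k)
      have 1: "x * real (Suc k) / N - x * real k / N = x / N"
        by (simp add: field_simps add_divide_distrib)
      have 2: "x / N < d" using x Nd divide_right_mono[of x 1 "real N"] by auto
      have 3: "x * real (Suc k) / N \<le> 1"
        using x Suc.prems N0 mult_mono[of x 1 "real (Suc k)" "real N"] by (simp add: field_simps)
      have 4: "0 \<le> x / N" using x by simp
      have "norm (\<phi> (x * real (Suc k) / N) - \<phi> (x * real k / N))
             \<le> e * (m (x * real (Suc k) / N) - m (x * real k / N))"
      proof (rule D)
        show "0 \<le> x * real k / N" using x by simp
      qed (use 1 2 3 4 in linarith)+
      moreover have "norm (\<phi> (x * real (Suc k) / N) - \<phi> 0)
         \<le> norm (\<phi> (x * real (Suc k) / N) - \<phi> (x * real k / N)) + norm (\<phi> (x * real k / N) - \<phi> 0)"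
        by (metis diff_add_cancel add_diff_eq norm_triangle_ineq)
      moreover have "norm (\<phi> (x * real k / N) - \<phi> 0) \<le> e * (m (x * real k / N) - m 0)"
        using Suc by simp
      ultimately show ?case unfolding right_diff_distrib by linarith
    qed auto
    from this[of N] show ?thesis using N0 by simp
  qed
  have "norm (\<phi> x - \<phi> 0) \<le> 0"
  proof (rule field_le_epsilon)
    fix e :: real assume e: "e > 0"
    have *: "0 < 1 + \<bar>m x - m 0\<bar>" by linarith
    have "norm (\<phi> x - \<phi> 0) \<le> e / (1 + \<bar>m x - m 0\<bar>) * (m x - m 0)"
      using e * by (intro le divide_pos_pos)
    also have "\<dots> \<le> e / (1 + \<bar>m x - m 0\<bar>) * (1 + \<bar>m x - m 0\<bar>)"
      using e * by (intro mult_left_mono) (auto intro!: divide_nonneg_pos)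
    also have "\<dots> = e" using * by simp
    finally show "norm (\<phi> x - \<phi> 0) \<le> 0 + e" by simp
  qed
  then show ?thesis by simp
qed

lemma uniform_continuity_01:
  fixes f :: "real \<Rightarrow> 'a::metric_space"
  assumes "continuous_on {0..1} f" "e > 0"
  obtains d where "d > 0"
    "\<And>x y. 0 \<le> x \<Longrightarrow> x \<le> 1 \<Longrightarrow> 0 \<le> y \<Longrightarrow> y \<le> 1 \<Longrightarrow> \<bar>x - y\<bar> < d \<Longrightarrow> dist (f x) (f y) < e"
proof -
  have "uniformly_continuous_on {0..1} f"
    using assms by (intro compact_uniformly_continuous) auto
  then obtain d where "d > 0" "\<forall>x\<in>{0..1}. \<forall>x'\<in>{0..1}. dist x' x < d \<longrightarrow> dist (f x') (f x) < e"
    using assms(2) unfolding uniformly_continuous_on_def by blast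
  then show thesis by (intro that[of d]) (auto simp: dist_real_def)
qed

lemma L1_01_bounded_linear:
  fixes f :: "real \<Rightarrow> 'a::euclidean_space" and h :: "'a \<Rightarrow> 'b::euclidean_space"
  assumes "bounded_linear h" "f absolutely_integrable_on A"
  shows "(\<lambda>x. h (f x)) absolutely_integrable_on A"
  using absolutely_integrable_linear[OF assms(2,1)] by (simp add: o_def)

text \<open>The increment over a short [x,y] is
  \<open>h (f y - f x) (g y) + h (f x) (g y - g x)\<close>, which is the integral of the claimed
  density with \<open>g\<close> frozen at y and \<open>f\<close> frozen at x. Uniform continuity
  bounds the freezing error by \<open>e\<close> times the L1 mass of \<open>f'\<close> and
  \<open>g'\<close> on [x,y], so \<open>constant_on_01_if_local_error\<close> applies and Fubini is
  avoided.\<close>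

lemma ac_deriv_prod:
  fixes h :: "'a::euclidean_space \<Rightarrow> 'b::euclidean_space \<Rightarrow> 'c::euclidean_space"
  assumes h: "bounded_bilinear h" and f: "ac_deriv f f'" and g: "ac_deriv g g'"
  shows "ac_deriv (\<lambda>x. h (f x) (g x)) (\<lambda>x. h (f' x) (g x) + h (f x) (g' x))"
proof (rule ac_derivI)
  interpret bounded_bilinear h by fact
  let ?D = "\<lambda>x. h (f' x) (g x) + h (f x) (g' x)"
  note fc = ac_deriv_continuous[OF f] and gc = ac_deriv_continuous[OF g]
  note fi = ac_deriv_integrable[OF f] and gi = ac_deriv_integrable[OF g]
  have D1: "L1_01 (\<lambda>x. h (f' x) (g x))"
    using L1_01_prod_left[OF h fi gc] .
  have D2: "L1_01 (\<lambda>x. h (f x) (g' x))"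
    using L1_01_prod_right[OF h gi fc] .
  show D: "L1_01 ?D"
    using D1 D2 by (rule set_integral_add)
  obtain K where K: "K > 0" "\<And>a b. norm (h a b) \<le> norm a * norm b * K" using pos_bounded by blast
  let ?\<phi> = "\<lambda>x. h (f x) (g x) - integral {0..x} ?D"
  define m where "m = (\<lambda>x. integral {0..x} (\<lambda>t. norm (f' t)) + integral {0..x} (\<lambda>t. norm (g' t)))"
  have nf: "L1_01 (\<lambda>t. norm (f' t))"
    and ng: "L1_01 (\<lambda>t. norm (g' t))"
    using fi gi by (auto simp: absolutely_integrable_on_def)
  fix x :: real assume x: "x \<in> {0..1}"
  have "?\<phi> x = ?\<phi> 0"
  proof (rule constant_on_01_if_local_error[OF _ x, where m = m])
    fix e :: real assume e: "e > 0"
    obtain d1 where d1: "d1 > 0" "\<And>x y. 0 \<le> x \<Longrightarrow> x \<le> 1 \<Longrightarrow> 0 \<le> y \<Longrightarrow> y \<le> 1 \<Longrightarrow> \<bar>x - y\<bar> < d1 \<Longrightarrow> dist (f x) (f y) < e / K"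
      using uniform_continuity_01[OF fc, of "e/K"] e K by auto
    obtain d2 where d2: "d2 > 0" "\<And>x y. 0 \<le> x \<Longrightarrow> x \<le> 1 \<Longrightarrow> 0 \<le> y \<Longrightarrow> y \<le> 1 \<Longrightarrow> \<bar>x - y\<bar> < d2 \<Longrightarrow> dist (g x) (g y) < e / K"
      using uniform_continuity_01[OF gc, of "e/K"] e K by auto
    have "norm (?\<phi> y - ?\<phi> x) \<le> e * (m y - m x)"
      if xy: "0 \<le> x" "x \<le> y" "y \<le> 1" "y - x < min d1 d2" for x y
    proof -
      note I = L1_01_on(2)[OF _ \<open>0 \<le> x\<close> \<open>y \<le> 1\<close>]
      note I' = L1_01_on(1)[OF _ \<open>0 \<le> x\<close> \<open>y \<le> 1\<close>]
      have 1: "integral {0..y} ?D - integral {0..x} ?D =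
            integral {x..y} (\<lambda>t. h (f' t) (g t)) + integral {x..y} (\<lambda>t. h (f t) (g' t))"
        using integral_diff_01[OF D xy(1-3)] I[OF D1] I[OF D2] by (simp add: integral_add)
      have 2: "integral {x..y} (\<lambda>t. h (f' t) (g y)) = h (f y - f x) (g y)"
        using integral_linear[OF I[OF fi] bounded_linear_left, of "g y"] ac_deriv_diff[OF f xy(1-3)]
        by (simp add: o_def)
      have 3: "integral {x..y} (\<lambda>t. h (f x) (g' t)) = h (f x) (g y - g x)"
        using integral_linear[OF I[OF gi] bounded_linear_right, of "f x"] ac_deriv_diff[OF g xy(1-3)]
        by (simp add: o_def)
      have i2: "(\<lambda>t. h (f' t) (g y)) integrable_on {x..y}" "(\<lambda>t. h (f x) (g' t)) integrable_on {x..y}"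
        using L1_01_bounded_linear[OF bounded_linear_left I'[OF fi]]
          L1_01_bounded_linear[OF bounded_linear_right I'[OF gi]]
        by (auto simp: absolutely_integrable_on_def)
      have "?\<phi> y - ?\<phi> x = h (f y - f x) (g y) + h (f x) (g y - g x)
          - (integral {0..y} ?D - integral {0..x} ?D)"
        by (simp add: diff_left diff_right)
      also have "\<dots> = integral {x..y} (\<lambda>t. h (f' t) (g y) - h (f' t) (g t))
             + integral {x..y} (\<lambda>t. h (f x) (g' t) - h (f t) (g' t))"
        unfolding 1 2[symmetric] 3[symmetric]
        by (subst (1 2) integral_diff) (use i2 I[OF D1] I[OF D2] in auto)
      also have "norm \<dots> \<le> integral {x..y} (\<lambda>t. e * norm (f' t)) + integral {x..y} (\<lambda>t. e * norm (g' t))"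
      proof (rule order_trans[OF norm_triangle_ineq add_mono])
        show "norm (integral {x..y} (\<lambda>t. h (f' t) (g y) - h (f' t) (g t))) \<le> integral {x..y} (\<lambda>t. e * norm (f' t))"
        proof (rule integral_norm_bound_integral)
          fix t assume t: "t \<in> {x..y}"
          have "norm (h (f' t) (g y) - h (f' t) (g t)) \<le> norm (f' t) * norm (g y - g t) * K"
            using K(2)[of "f' t" "g y - g t"] by (simp add: diff_right)
          also have "\<dots> \<le> norm (f' t) * (e / K) * K"
            using d2(2)[of y t] t xy K by (intro mult_right_mono mult_left_mono) (auto simp: dist_norm)
          finally show "norm (h (f' t) (g y) - h (f' t) (g t)) \<le> e * norm (f' t)" using K(1) by (simp add: mult.commute)
        qed (intro integrable_diff i2 I[OF D1]
            integrable_on_mult_right I[OF nf])+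
        show "norm (integral {x..y} (\<lambda>t. h (f x) (g' t) - h (f t) (g' t))) \<le> integral {x..y} (\<lambda>t. e * norm (g' t))"
        proof (rule integral_norm_bound_integral)
          fix t assume t: "t \<in> {x..y}"
          have "norm (h (f x) (g' t) - h (f t) (g' t)) \<le> norm (f x - f t) * norm (g' t) * K"
            using K(2)[of "f x - f t" "g' t"] by (simp add: diff_left)
          also have "\<dots> \<le> (e / K) * norm (g' t) * K"
            using d1(2)[of x t] t xy K by (intro mult_right_mono) (auto simp: dist_norm)
          finally show "norm (h (f x) (g' t) - h (f t) (g' t)) \<le> e * norm (g' t)" using K by simp
        qed (intro integrable_diff i2 I[OF D2]
            integrable_on_mult_right I[OF ng])+
      qed
      also have "\<dots> = e * (m y - m x)"
        using integral_diff_01[OF nf xy(1-3)] integral_diff_01[OF ng xy(1-3)]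
        by (simp add: m_def algebra_simps)
      finally show ?thesis .
    qed
    then show "\<exists>d>0. \<forall>x y. 0 \<le> x \<longrightarrow> x \<le> y \<longrightarrow> y \<le> 1 \<longrightarrow> y - x < d \<longrightarrow> norm (?\<phi> y - ?\<phi> x) \<le> e * (m y - m x)"
      using d1 d2 by (intro exI[of _ "min d1 d2"]) auto
  qed
  then show "h (f x) (g x) = h (f 0) (g 0) + integral {0..x} ?D" by (simp add: algebra_simps)
qed

lemmas ac_deriv_mult = ac_deriv_prod[OF bounded_bilinear_mult]

subsection \<open>A Carleson-type inequality for Laplace transforms\<close>

text \<open>Up to a factor between 1 and 2 this is the Poisson kernel h / (h^2 + d^2) of height
  \<open>h\<close>; the form with h + |d| makes comparisons monotone and sums telescope.\<close>

definition kern :: "real \<Rightarrow> real \<Rightarrow> real" where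
  "kern h d = h / (h + \<bar>d\<bar>)\<^sup>2"

lemma kern_nonneg: "h \<ge> 0 \<Longrightarrow> 0 \<le> kern h d"
  by (simp add: kern_def)

lemma kern_minus: "kern h (- d) = kern h d"
  by (simp add: kern_def)

lemma sum_kern_nat:
  assumes h: "h \<ge> 1"
  shows "(\<Sum>n<Suc N. kern h (real n)) \<le> 2 - h / (h + real N)"
proof (induction N)
  case 0
  then show ?case using h by (simp add: kern_def power2_eq_square)
next
  case (Suc N)
  \<comment> \<open>Lowering one of the two equal factors by 1 makes the term telescope.\<close>
  have "h / (h + real (Suc N))\<^sup>2 \<le> h / ((h + real N) * (h + real (Suc N)))"
    using h by (intro divide_left_mono mult_pos_pos) (auto simp: power2_eq_square intro!: mult_right_mono)
  also have "\<dots> = h / (h + real N) - h / (h + real (Suc N))"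
    using h by (simp add: field_simps)
  finally show ?case using Suc by (simp add: kern_def)
qed

lemma sum_kern_nat_le:
  assumes h: "h \<ge> 1" and "finite A"
  shows "(\<Sum>n\<in>A. kern h (real n)) \<le> 2"
proof -
  obtain N where N: "A \<subseteq> {..<Suc N}"
    using finite_nat_iff_bounded[of A] \<open>finite A\<close> lessThan_subset_iff by (metis subset_trans lessI less_imp_le_nat)
  have "(\<Sum>n\<in>A. kern h (real n)) \<le> (\<Sum>n<Suc N. kern h (real n))"
    using N h by (intro sum_mono2) (auto intro: kern_nonneg)
  also have "\<dots> \<le> 2 - h / (h + real N)" by (rule sum_kern_nat[OF h])
  also have "\<dots> \<le> 2" using h by simp
  finally show ?thesis .
qed

text \<open>The map from k to |j - k| is injective on each side of j, so each half is a sum over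
  distinct natural numbers and contributes at most 2.\<close>

lemma sum_kern_le:
  assumes h: "h \<ge> 1" and K: "finite (K :: int set)"
  shows "(\<Sum>k\<in>K. kern h (of_int (j - k))) \<le> 4"
proof -
  let ?Q = "\<lambda>k. kern h (of_int (j - k))"
  have half: "sum ?Q A \<le> 2" if "finite A" "inj_on (\<lambda>k. nat \<bar>j - k\<bar>) A" for A
  proof -
    have "sum ?Q A = (\<Sum>k\<in>A. kern h (real (nat \<bar>j - k\<bar>)))"
      by (intro sum.cong) (auto simp: kern_def)
    also have "\<dots> = (\<Sum>n\<in>(\<lambda>k. nat \<bar>j - k\<bar>) ` A. kern h (real n))"
      using that by (simp add: sum.reindex)
    also have "\<dots> \<le> 2" using that by (intro sum_kern_nat_le h) auto
    finally show ?thesis .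
  qed
  have "sum ?Q K = sum ?Q {k\<in>K. k \<le> j} + sum ?Q {k\<in>K. \<not> k \<le> j}"
    using K by (subst sum.union_disjoint[symmetric]) (auto intro!: sum.cong)
  also have "\<dots> \<le> 2 + 2"
    using K by (intro add_mono half) (auto simp: inj_on_def)
  finally show ?thesis by simp
qed

text \<open>One of |j - k| and |l - k| is at least half of |j - l|. If it is |j - k|, the kernel of
  height \<open>h\<close> is itself comparable to its value at j - l. Otherwise, for |j - l| \<le> h
  that kernel never exceeds 1/h, which is comparable to its value at j - l; for |j - l| > h the
  kernel of height \<open>h'\<close> is at most 4 h' / |j - l|^2, and h' \<le> h. So the larger
  height always survives.\<close>

lemma kern_mult_le:
  assumes h: "1 \<le> h'" "h' \<le> h"
  shows "kern h (j - k) * kern h' (l - k)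
    \<le> 16 * kern h (j - l) * (kern h' (l - k) + kern h (j - k))"
proof -
  let ?d = "\<bar>j - l\<bar>"
  note nn = kern_nonneg[of h] kern_nonneg[of h']
  have A: ?thesis if "kern h (j - k) \<le> 16 * kern h (j - l)"
  proof -
    have "kern h (j - k) * kern h' (l - k) \<le> 16 * kern h (j - l) * kern h' (l - k)"
      using that h by (intro mult_right_mono nn) auto
    also have "\<dots> \<le> 16 * kern h (j - l) * (kern h' (l - k) + kern h (j - k))"
      using h by (intro mult_left_mono mult_nonneg_nonneg nn) (auto intro: nn)
    finally show ?thesis .
  qed
  have B: ?thesis if "kern h' (l - k) \<le> 16 * kern h (j - l)"
  proof -
    have "kern h (j - k) * kern h' (l - k) \<le> kern h (j - k) * (16 * kern h (j - l))"
      using that h by (intro mult_left_mono nn) auto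
    also have "\<dots> = 16 * kern h (j - l) * kern h (j - k)" by simp
    also have "\<dots> \<le> 16 * kern h (j - l) * (kern h' (l - k) + kern h (j - k))"
      using h by (intro mult_left_mono mult_nonneg_nonneg nn) (auto intro: nn)
    finally show ?thesis .
  qed
  have q4: "g / (g + c)\<^sup>2 \<le> 4 * (g / (g + ?d)\<^sup>2)" if "g \<ge> 1" "?d / 2 \<le> c" for g c :: real
  proof -
    have "(g + ?d)\<^sup>2 \<le> (2 * (g + c))\<^sup>2" using that by (intro power_mono) auto
    then have "(g + ?d)\<^sup>2 \<le> 4 * (g + c)\<^sup>2" by (simp only: power_mult_distrib) simp
    moreover have "(g + ?d)\<^sup>2 > 0" "(g + c)\<^sup>2 > 0" using that by (auto intro!: zero_less_power add_pos_nonneg)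
    ultimately show ?thesis using that(1) by (simp add: field_simps)
  qed
  consider "?d / 2 \<le> \<bar>j - k\<bar>" | "?d / 2 \<le> \<bar>l - k\<bar>" "?d \<le> h" | "?d / 2 \<le> \<bar>l - k\<bar>" "h < ?d"
    by argo
  then show ?thesis
  proof cases
    case 1
    from q4[OF _ 1, of h] h have "kern h (j - k) \<le> 4 * kern h (j - l)"
      by (simp add: kern_def)
    also have "\<dots> \<le> 16 * kern h (j - l)" using nn(1)[of "j - l"] h by simp
    finally show ?thesis by (rule A)
  next
    case 2
    have "h / (h + \<bar>j - k\<bar>)\<^sup>2 \<le> h / h\<^sup>2"
      using h by (intro divide_left_mono power_mono) auto
    also have "\<dots> = 4 * (h / (h + h)\<^sup>2)" using h by (simp add: power2_eq_square)
    also have "\<dots> \<le> 4 * (h / (h + ?d)\<^sup>2)"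
      using h 2 by (intro mult_left_mono divide_left_mono power_mono mult_pos_pos zero_less_power) auto
    finally have "kern h (j - k) \<le> 4 * kern h (j - l)"
      by (simp add: kern_def)
    also have "\<dots> \<le> 16 * kern h (j - l)" using nn(1)[of "j - l"] h by simp
    finally show ?thesis by (rule A)
  next
    case 3
    from q4[OF _ 3(1), of h'] h have "kern h' (l - k) \<le> 4 * (h' / (h' + ?d)\<^sup>2)"
      by (simp add: kern_def)
    also have "\<dots> \<le> 4 * (h / ?d\<^sup>2)"
      using h 3 by (intro mult_left_mono frac_le power_mono zero_less_power) auto
    also have "\<dots> = 16 * (h / (?d + ?d)\<^sup>2)" by (simp add: power2_eq_square)
    also have "\<dots> \<le> 16 * (h / (h + ?d)\<^sup>2)"
      using h 3 by (intro mult_left_mono divide_left_mono power_mono mult_pos_pos zero_less_power) auto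
    finally have "kern h' (l - k) \<le> 16 * kern h (j - l)"
      by (simp add: kern_def)
    then show ?thesis by (rule B)
  qed
qed

lemma sum_kern_mult_le_aux:
  assumes h: "1 \<le> h'" "h' \<le> h" and K: "finite (K :: int set)"
  shows "(\<Sum>k\<in>K. kern h (of_int (j - k)) * kern h' (of_int (l - k)))
    \<le> 128 * kern h (of_int (j - l))"
proof -
  have "(\<Sum>k\<in>K. kern h (of_int (j - k)) * kern h' (of_int (l - k)))
    \<le> (\<Sum>k\<in>K. 16 * kern h (of_int (j - l)) *
          (kern h' (of_int (l - k)) + kern h (of_int (j - k))))"
    using kern_mult_le[OF h, of "of_int j" "of_int _" "of_int l"] by (intro sum_mono) simp
  also have "\<dots> = 16 * kern h (of_int (j - l)) *
      ((\<Sum>k\<in>K. kern h' (of_int (l - k))) + (\<Sum>k\<in>K. kern h (of_int (j - k))))"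
    by (simp only: sum_distrib_left[symmetric] sum.distrib)
  also have "\<dots> \<le> 16 * kern h (of_int (j - l)) * (4 + 4)"
    using h K by (intro mult_left_mono add_mono sum_kern_le) (auto intro: kern_nonneg)
  finally show ?thesis by simp
qed

lemma sum_kern_mult_le:
  assumes h: "1 \<le> h'" "1 \<le> h" and K: "finite (K :: int set)"
  shows "(\<Sum>k\<in>K. kern h (of_int (j - k)) * kern h' (of_int (l - k)))
    \<le> 128 * (kern h (of_int (j - l)) + kern h' (of_int (l - j)))"
proof (cases "h' \<le> h")
  case True
  then have "(\<Sum>k\<in>K. kern h (of_int (j - k)) * kern h' (of_int (l - k)))
    \<le> 128 * kern h (of_int (j - l))"
    using h K by (intro sum_kern_mult_le_aux)
  then show ?thesis using kern_nonneg[of h' "of_int (l - j)"] h by simp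
next
  case False
  then have "(\<Sum>k\<in>K. kern h' (of_int (l - k)) * kern h (of_int (j - k)))
    \<le> 128 * kern h' (of_int (l - j))"
    using h K by (intro sum_kern_mult_le_aux) auto
  then show ?thesis using kern_nonneg[of h "of_int (j - l)"] h by (simp add: mult.commute)
qed

text \<open>The form \<open>V\<close> on the left satisfies \<open>V\<^sup>2 \<le> 256 V \<Sum> x\<^sub>k\<^sup>2\<close>, because the composition of two
  kernels is again dominated by such kernels.\<close>
lemma carleson_form_le:
  fixes x h :: "int \<Rightarrow> real"
  assumes K: "finite K" and x: "\<And>k. k \<in> K \<Longrightarrow> 0 \<le> x k" and h: "\<And>k. k \<in> K \<Longrightarrow> 1 \<le> h k"
  shows "(\<Sum>j\<in>K. \<Sum>k\<in>K. x j * x k * kern (h j) (of_int (j - k))) \<le> 256 * (\<Sum>k\<in>K. (x k)\<^sup>2)"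
proof -
  define Q where "Q j k = kern (h j) (of_int (j - k))" for j k
  define V where "V = (\<Sum>j\<in>K. \<Sum>k\<in>K. x j * x k * Q j k)"
  define X where "X = (\<Sum>k\<in>K. (x k)\<^sup>2)"
  have Q0: "0 \<le> Q j k" if "j \<in> K" for j k using h[OF that] by (auto simp: Q_def intro: kern_nonneg)
  have V0: "V \<ge> 0" unfolding V_def using x Q0 by (intro sum_nonneg mult_nonneg_nonneg) auto
  have X0: "X \<ge> 0" unfolding X_def by (intro sum_nonneg) auto
  have "V = (\<Sum>k\<in>K. x k * (\<Sum>j\<in>K. x j * Q j k))"
    unfolding V_def by (subst sum.swap) (simp add: sum_distrib_left mult_ac)
  then have "V\<^sup>2 \<le> X * (\<Sum>k\<in>K. (\<Sum>j\<in>K. x j * Q j k)\<^sup>2)"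
    unfolding X_def by (simp add: Cauchy_Schwarz_ineq_sum)
  also have "(\<Sum>k\<in>K. (\<Sum>j\<in>K. x j * Q j k)\<^sup>2) = (\<Sum>k\<in>K. \<Sum>j\<in>K. \<Sum>l\<in>K. x j * x l * (Q j k * Q l k))"
    by (simp add: power2_eq_square sum_product mult_ac)
  also have "\<dots> = (\<Sum>j\<in>K. \<Sum>l\<in>K. x j * x l * (\<Sum>k\<in>K. Q j k * Q l k))"
    by (subst sum.swap, rule sum.cong, rule refl, subst sum.swap) (simp add: sum_distrib_left)
  also have "\<dots> \<le> (\<Sum>j\<in>K. \<Sum>l\<in>K. x j * x l * (128 * (Q j l + Q l j)))"
    unfolding Q_def using K x h
    by (intro sum_mono mult_left_mono sum_kern_mult_le) auto
  also have "\<dots> = 128 * ((\<Sum>j\<in>K. \<Sum>l\<in>K. x j * x l * Q j l) + (\<Sum>j\<in>K. \<Sum>l\<in>K. x j * x l * Q l j))"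
    by (simp add: sum_distrib_left sum.distrib[symmetric] algebra_simps)
  also have "(\<Sum>j\<in>K. \<Sum>l\<in>K. x j * x l * Q l j) = V"
    unfolding V_def by (subst sum.swap) (simp add: mult_ac)
  finally have "V\<^sup>2 \<le> X * (256 * V)" using X0 V_def by (simp add: mult_left_mono)
  then have "V * V \<le> V * (256 * X)" by (simp add: power2_eq_square mult_ac)
  then have "V \<le> 256 * X"
    using V0 X0 by (cases "V = 0") (auto simp: mult_le_cancel_left)
  then show ?thesis by (simp add: V_def X_def Q_def)
qed

text \<open>Centred at \<open>x\<close> and damped on both sides. On one side it is the exponential
  of a Laplace transform based at \<open>x\<close>; the other side is invisible to functions
  supported on one side of \<open>x\<close>, but it turns the transform 1/(\<eta> - i\<xi>) of a
  one-sided exponential into a Poisson kernel, which decays quadratically instead of linearly in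
  \<xi>.\<close>

definition poisson_fun :: "real \<Rightarrow> real \<Rightarrow> real \<Rightarrow> real \<Rightarrow> complex" where
  "poisson_fun x \<xi> \<eta> t = exp (\<i> * of_real (\<xi> * (t - x)) - of_real (\<eta> * \<bar>t - x\<bar>))"

lemma continuous_on_poisson_fun: "continuous_on A (poisson_fun x \<xi> \<eta>)"
  unfolding poisson_fun_def by (intro continuous_intros)

lemma poisson_fun_mult_cnj:
  "poisson_fun x \<xi> \<eta> t * cnj (poisson_fun x \<xi>' \<eta>' t) = poisson_fun x (\<xi> - \<xi>') (\<eta> + \<eta>') t"
  unfolding poisson_fun_def exp_cnj exp_add[symmetric]
  by (rule arg_cong[of _ _ exp]) (simp add: algebra_simps)

text \<open>Integration by parts on each half: the tent weight vanishes at x - 2 and x + 2, and the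
  first-order terms 2/a and 2/b at the centre, with \<open>b\<close> conjugate to \<open>a\<close>,
  add up to the real number 4\<eta>/(\<eta>^2 + \<xi>^2). The terms with 1/a^2 and 1/b^2 are
  absorbed by \<eta> \<ge> 2. A sharp cutoff would leave boundary terms decaying only like
  1/|\<xi>|.\<close>

lemma norm_integral_poisson_fun_le:
  assumes \<eta>: "\<eta> \<ge> 2"
  shows "norm (integral {x-2..x+2} (\<lambda>t. of_real (2 - \<bar>t - x\<bar>) * poisson_fun x \<xi> \<eta> t)) \<le> 6 * \<eta> / (\<eta>\<^sup>2 + \<xi>\<^sup>2)"
proof -
  define a where "a = Complex \<eta> (- \<xi>)"
  define b where "b = Complex \<eta> \<xi>"
  have ab: "a \<noteq> 0" "b \<noteq> 0" using \<eta> by (auto simp: a_def b_def complex_eq_iff)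
  let ?f = "\<lambda>t. of_real (2 - \<bar>t - x\<bar>) * poisson_fun x \<xi> \<eta> t"
  \<comment> \<open>\<open>F\<close> and \<open>G\<close> are antiderivatives of the integrand to
    the right and to the left of \<open>x\<close>, where |t - x| is linear.\<close>
  define F where "F c = - (2 - (c - of_real x)) * exp (- a * (c - of_real x)) / a
    + exp (- a * (c - of_real x)) / a\<^sup>2" for c :: complex
  define G where "G c = (2 + (c - of_real x)) * exp (b * (c - of_real x)) / b
    - exp (b * (c - of_real x)) / b\<^sup>2" for c :: complex
  have F': "(F has_field_derivative (2 - (c - of_real x)) * exp (- a * (c - of_real x))) (at c)" for c
    unfolding F_def using ab by (auto intro!: derivative_eq_intros simp: field_simps power2_eq_square)
  have G': "(G has_field_derivative (2 + (c - of_real x)) * exp (b * (c - of_real x))) (at c)" for c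
    unfolding G_def using ab by (auto intro!: derivative_eq_intros simp: field_simps power2_eq_square)
  have Ri: "((\<lambda>t. (2 - (of_real t - of_real x)) * exp (- a * (of_real t - of_real x))) has_integral
      F (of_real (x+2)) - F (of_real x)) {x..x+2}"
    by (intro fundamental_theorem_of_calculus has_vector_derivative_real_field F') auto
  have Li: "((\<lambda>t. (2 + (of_real t - of_real x)) * exp (b * (of_real t - of_real x))) has_integral
      G (of_real x) - G (of_real (x - 2))) {x-2..x}"
    by (intro fundamental_theorem_of_calculus has_vector_derivative_real_field G') auto
  have R: "(?f has_integral F (of_real (x+2)) - F (of_real x)) {x..x+2}"
  proof (rule has_integral_eq[OF _ Ri])
    fix t assume "t \<in> {x..x+2}"
    then have "\<bar>t - x\<bar> = t - x" by auto
    moreover have "\<i> * of_real (\<xi> * (t - x)) - of_real (\<eta> * (t - x)) = - a * (of_real t - of_real x)"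
      by (simp add: a_def complex_eq_iff algebra_simps)
    ultimately show "(2 - (of_real t - of_real x)) * exp (- a * (of_real t - of_real x)) = ?f t"
      by (simp add: poisson_fun_def)
  qed
  have L: "(?f has_integral G (of_real x) - G (of_real (x - 2))) {x-2..x}"
  proof (rule has_integral_eq[OF _ Li])
    fix t assume "t \<in> {x-2..x}"
    then have "\<bar>t - x\<bar> = - (t - x)" by auto
    moreover have "\<i> * of_real (\<xi> * (t - x)) - of_real (\<eta> * - (t - x)) = b * (of_real t - of_real x)"
      by (simp add: b_def complex_eq_iff algebra_simps)
    ultimately show "(2 + (of_real t - of_real x)) * exp (b * (of_real t - of_real x)) = ?f t"
      unfolding poisson_fun_def by (simp only:) simp
  qed
  have n: "(norm a)\<^sup>2 = \<eta>\<^sup>2 + \<xi>\<^sup>2" "(norm b)\<^sup>2 = \<eta>\<^sup>2 + \<xi>\<^sup>2"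
    by (auto simp: a_def b_def cmod_def)
  have pos: "\<eta>\<^sup>2 + \<xi>\<^sup>2 > 0" using \<eta> by (intro add_pos_nonneg) auto
  have "a * b = of_real (\<eta>\<^sup>2 + \<xi>\<^sup>2)" "a + b = of_real (2 * \<eta>)"
    by (auto simp: a_def b_def complex_eq_iff power2_eq_square)
  moreover have "2 / a + 2 / b = 2 * (a + b) / (a * b)"
    using ab by (simp add: field_simps)
  ultimately have main: "2 / a + 2 / b = of_real (4 * \<eta> / (\<eta>\<^sup>2 + \<xi>\<^sup>2))"
    by simp
  have e: "norm (exp (- a * 2)) \<le> 1" "norm (exp (- b * 2)) \<le> 1"
    using \<eta> by (auto simp: a_def b_def)
  have "integral {x-2..x+2} ?f = (G (of_real x) - G (of_real (x - 2))) + (F (of_real (x+2)) - F (of_real x))"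
    using has_integral_combine[OF _ _ L R] by (simp add: integral_unique)
  also have "\<dots> = (2 / a + 2 / b) + (exp (- a * 2) - 1) / a\<^sup>2 + (exp (- b * 2) - 1) / b\<^sup>2"
    by (simp add: F_def G_def diff_divide_distrib)
  also have "norm \<dots> \<le> 4 * \<eta> / (\<eta>\<^sup>2 + \<xi>\<^sup>2) + 2 / (\<eta>\<^sup>2 + \<xi>\<^sup>2) + 2 / (\<eta>\<^sup>2 + \<xi>\<^sup>2)"
  proof (rule order_trans[OF norm_triangle_ineq], rule add_mono,
      rule order_trans[OF norm_triangle_ineq], rule add_mono)
    show "norm (2 / a + 2 / b) \<le> 4 * \<eta> / (\<eta>\<^sup>2 + \<xi>\<^sup>2)"
      unfolding main norm_of_real using \<eta> pos by simp
    have "norm (exp (- a * 2) - 1) \<le> 2" "norm (exp (- b * 2) - 1) \<le> 2"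
      using e norm_triangle_ineq4[of "exp (- a * 2)" 1] norm_triangle_ineq4[of "exp (- b * 2)" 1]
      unfolding norm_one by linarith+
    then show "norm ((exp (- a * 2) - 1) / a\<^sup>2) \<le> 2 / (\<eta>\<^sup>2 + \<xi>\<^sup>2)"
      "norm ((exp (- b * 2) - 1) / b\<^sup>2) \<le> 2 / (\<eta>\<^sup>2 + \<xi>\<^sup>2)"
      unfolding norm_divide norm_power n using pos by (auto intro!: divide_right_mono)
  qed
  also have "\<dots> = (4 * \<eta> + 4) / (\<eta>\<^sup>2 + \<xi>\<^sup>2)" by (simp add: add_divide_distrib)
  also have "\<dots> \<le> 6 * \<eta> / (\<eta>\<^sup>2 + \<xi>\<^sup>2)"
    using \<eta> pos by (intro divide_right_mono) auto
  finally show ?thesis .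
qed

text \<open>With H = \<eta> + \<eta>', the assumption gives (H + |d|)^2 \<le> (2H + |\<xi>|)^2 \<le>
  5(H^2 + \<xi>^2). The numerator H is then split into \<eta> and \<eta>', and in each denominator H
  is lowered to the height in its numerator. The constant is 5 times 6.\<close>

lemma gram_le_kern:
  assumes "\<eta> \<ge> 1" "\<eta>' \<ge> 1" "\<bar>d\<bar> \<le> \<bar>\<xi>\<bar> + \<eta> + \<eta>'"
  shows "6 * (\<eta> + \<eta>') / ((\<eta> + \<eta>')\<^sup>2 + \<xi>\<^sup>2) \<le> 30 * (kern \<eta> d + kern \<eta>' d)"
proof -
  define H where "H = \<eta> + \<eta>'"
  have H: "H \<ge> 2" using assms by (simp add: H_def)
  have "(H + \<bar>d\<bar>)\<^sup>2 \<le> (2 * H + \<bar>\<xi>\<bar>)\<^sup>2"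
    using assms H by (intro power_mono) (auto simp: H_def)
  also have "\<dots> \<le> 5 * (H\<^sup>2 + \<xi>\<^sup>2)"
  proof -
    have "0 \<le> (H - 2 * \<bar>\<xi>\<bar>)\<^sup>2" by simp
    then show ?thesis by (simp add: power2_eq_square algebra_simps)
  qed
  finally have 1: "(H + \<bar>d\<bar>)\<^sup>2 \<le> 5 * (H\<^sup>2 + \<xi>\<^sup>2)" .
  have "6 * H / (H\<^sup>2 + \<xi>\<^sup>2) = (5 * (6 * H)) / (5 * (H\<^sup>2 + \<xi>\<^sup>2))"
    by (rule mult_divide_mult_cancel_left[symmetric]) simp
  also have "\<dots> \<le> (5 * (6 * H)) / (H + \<bar>d\<bar>)\<^sup>2"
    using 1 H by (intro divide_left_mono mult_pos_pos) (auto intro!: add_pos_nonneg zero_less_power)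
  also have "\<dots> = 30 * (\<eta> / (H + \<bar>d\<bar>)\<^sup>2 + \<eta>' / (H + \<bar>d\<bar>)\<^sup>2)"
    by (simp add: H_def add_divide_distrib)
  also have "\<dots> \<le> 30 * (kern \<eta> d + kern \<eta>' d)"
    unfolding kern_def using assms
    by (intro mult_left_mono add_mono divide_left_mono power_mono mult_pos_pos zero_less_power) (auto simp: H_def)
  finally show ?thesis by (simp add: H_def)
qed

text \<open>Duality: the sum S of the squares is the pairing of \<open>g\<close> with h = \<Sum> cnj
  (f k) e_k, so it suffices to bound the squared L2 norm of \<open>h\<close> by a multiple of S,
  which is a bound on the Gram matrix of the e_k. Passing from [0,1] to the tent weight on [x-2,x+2]
  only increases that norm and gives Gram entries with quadratic decay.\<close>

lemma poisson_family_aux: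
  fixes g :: "real \<Rightarrow> complex" and \<xi> \<eta> :: "int \<Rightarrow> real"
  assumes K: "finite K" and \<eta>: "\<And>k. k \<in> K \<Longrightarrow> 1 \<le> \<eta> k" and x: "x \<in> {0..1}"
    and sep: "\<And>j k. j \<in> K \<Longrightarrow> k \<in> K \<Longrightarrow> of_int \<bar>j - k\<bar> \<le> \<bar>\<xi> j - \<xi> k\<bar> + \<eta> j + \<eta> k"
    and g: "L1_01 g" "(\<lambda>t. (norm (g t))\<^sup>2) integrable_on {0..1}"
  shows "(\<Sum>k\<in>K. (norm (integral {0..1} (\<lambda>t. poisson_fun x (\<xi> k) (\<eta> k) t * g t)))\<^sup>2)
    \<le> 15360 * integral {0..1} (\<lambda>t. (norm (g t))\<^sup>2)"
proof -
  define e where "e k = poisson_fun x (\<xi> k) (\<eta> k)" for k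
  define f where "f k = integral {0..1} (\<lambda>t. e k t * g t)" for k
  define S where "S = (\<Sum>k\<in>K. (norm (f k))\<^sup>2)"
  define h where "h t = (\<Sum>k\<in>K. cnj (f k) * e k t)" for t
  define G where "G j k = integral {x-2..x+2} (\<lambda>t. of_real (2 - \<bar>t - x\<bar>) * (e j t * cnj (e k t)))" for j k
  have ec: "continuous_on A (e k)" for A k unfolding e_def by (rule continuous_on_poisson_fun)
  have hc: "continuous_on A h" for A unfolding h_def by (intro continuous_intros ec)
  have eg: "L1_01 (\<lambda>t. e k t * g t)" for k
    by (rule L1_01_mult_right[OF g(1) ec])
  have hg: "L1_01 (\<lambda>t. h t * g t)"
    by (rule L1_01_mult_right[OF g(1) hc])
  have S0: "S \<ge> 0" unfolding S_def by (intro sum_nonneg) auto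
  have "of_real S = (\<Sum>k\<in>K. cnj (f k) * f k)"
    by (simp add: S_def complex_norm_square mult.commute del: of_real_power)
  also have "\<dots> = (\<Sum>k\<in>K. integral {0..1} (\<lambda>t. cnj (f k) * (e k t * g t)))"
    by (simp add: f_def)
  also have "\<dots> = integral {0..1} (\<lambda>t. \<Sum>k\<in>K. cnj (f k) * (e k t * g t))"
    using K eg by (intro integral_sum[symmetric]) (auto simp: absolutely_integrable_on_def intro: integrable_on_mult_right)
  also have "\<dots> = integral {0..1} (\<lambda>t. h t * g t)"
    by (simp add: h_def sum_distrib_right mult.assoc)
  finally have S_eq: "of_real S = integral {0..1} (\<lambda>t. h t * g t)" .
  have hi: "(\<lambda>t. (norm (h t))\<^sup>2) integrable_on {a..b}" for a b
    by (intro integrable_continuous_real continuous_intros hc)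
  have "S = norm (integral {0..1} (\<lambda>t. h t * g t))"
    using S0 by (simp flip: S_eq)
  \<comment> \<open>Weights of the arithmetic-geometric mean inequality: the bound
    \<open>15360 * S\<close> for the squared norm of \<open>h\<close>, divided by 30720, is S/2 and
    can be moved to the left.\<close>
  also have "\<dots> \<le> integral {0..1} (\<lambda>t. 7680 * (norm (g t))\<^sup>2 + (norm (h t))\<^sup>2 / 30720)"
  proof (rule integral_norm_bound_integral)
    show "(\<lambda>t. 7680 * (norm (g t))\<^sup>2 + (norm (h t))\<^sup>2 / 30720) integrable_on {0..1}"
      using g(2) hi by (intro integrable_add integrable_on_mult_right integrable_on_divide)
    fix t :: real
    have "0 \<le> (15360 * norm (g t) - norm (h t))\<^sup>2" by simp
    then show "norm (h t * g t) \<le> 7680 * (norm (g t))\<^sup>2 + (norm (h t))\<^sup>2 / 30720"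
      by (simp add: norm_mult power2_eq_square algebra_simps)
  qed (use hg in \<open>auto simp: absolutely_integrable_on_def\<close>)
  also have "\<dots> = 7680 * integral {0..1} (\<lambda>t. (norm (g t))\<^sup>2) + integral {0..1} (\<lambda>t. (norm (h t))\<^sup>2) / 30720"
    using g(2) hi by (simp add: integral_add integrable_on_mult_right integrable_on_divide)
  also have "integral {0..1} (\<lambda>t. (norm (h t))\<^sup>2) \<le> 15360 * S"
  proof -
    let ?w = "\<lambda>t. 2 - \<bar>t - x\<bar>"
    have wi: "(\<lambda>t. ?w t * (norm (h t))\<^sup>2) integrable_on {a..b}" for a b
      by (intro integrable_continuous_real continuous_intros hc)
    have "integral {0..1} (\<lambda>t. (norm (h t))\<^sup>2) \<le> integral {0..1} (\<lambda>t. ?w t * (norm (h t))\<^sup>2)"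
    proof (rule integral_le)
      fix t :: real assume "t \<in> {0..1}"
      then have "1 \<le> ?w t" using x by auto
      then show "(norm (h t))\<^sup>2 \<le> ?w t * (norm (h t))\<^sup>2"
        using mult_right_mono[of 1 "?w t" "(norm (h t))\<^sup>2"] by simp
    qed (use hi wi in auto)
    also have "\<dots> \<le> integral {x-2..x+2} (\<lambda>t. ?w t * (norm (h t))\<^sup>2)"
      using x by (intro integral_subset_le wi) auto
    also have "\<dots> = norm (complex_of_real (integral {x-2..x+2} (\<lambda>t. ?w t * (norm (h t))\<^sup>2)))"
    proof -
      have "0 \<le> integral {x-2..x+2} (\<lambda>t. ?w t * (norm (h t))\<^sup>2)"
        by (intro integral_nonneg[OF wi] mult_nonneg_nonneg) auto
      then show ?thesis by simp
    qed
    also have "complex_of_real (integral {x-2..x+2} (\<lambda>t. ?w t * (norm (h t))\<^sup>2))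
        = integral {x-2..x+2} (\<lambda>t. of_real (?w t * (norm (h t))\<^sup>2))"
    proof -
      have "integral {x-2..x+2} (complex_of_real \<circ> (\<lambda>t. ?w t * (norm (h t))\<^sup>2))
          = complex_of_real (integral {x-2..x+2} (\<lambda>t. ?w t * (norm (h t))\<^sup>2))"
        by (rule integral_linear[OF wi bounded_linear_of_real])
      then show ?thesis by (simp add: o_def)
    qed
    also have "\<dots> = integral {x-2..x+2} (\<lambda>t. \<Sum>j\<in>K. \<Sum>k\<in>K. cnj (f j) * f k * (of_real (?w t) * (e j t * cnj (e k t))))"
    proof (intro integral_cong)
      fix t
      have "complex_of_real ((norm (h t))\<^sup>2) = h t * cnj (h t)"
        by (rule complex_norm_square)
      also have "\<dots> = (\<Sum>j\<in>K. \<Sum>k\<in>K. (cnj (f j) * e j t) * (f k * cnj (e k t)))"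
        by (simp add: h_def sum_product)
      finally show "complex_of_real (?w t * (norm (h t))\<^sup>2) =
        (\<Sum>j\<in>K. \<Sum>k\<in>K. cnj (f j) * f k * (of_real (?w t) * (e j t * cnj (e k t))))"
        by (simp only: of_real_mult sum_distrib_left mult_ac)
    qed
    also have "\<dots> = (\<Sum>j\<in>K. \<Sum>k\<in>K. cnj (f j) * f k * G j k)"
    proof -
      have i: "(\<lambda>t. cnj (f j) * f k * (of_real (?w t) * (e j t * cnj (e k t)))) integrable_on {x-2..x+2}" for j k
        by (intro integrable_continuous_real continuous_intros ec)
      show ?thesis
        unfolding G_def using K i by (simp add: integral_sum integrable_sum)
    qed
    also have "norm \<dots> \<le> (\<Sum>j\<in>K. \<Sum>k\<in>K. norm (f j) * norm (f k) *
        (30 * (kern (\<eta> j) (of_int (j - k)) + kern (\<eta> k) (of_int (j - k)))))"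
    proof (intro order_trans[OF norm_sum] sum_mono)
      fix j k assume jk: "j \<in> K" "k \<in> K"
      have "norm (G j k) \<le> 6 * (\<eta> j + \<eta> k) / ((\<eta> j + \<eta> k)\<^sup>2 + (\<xi> j - \<xi> k)\<^sup>2)"
        unfolding G_def e_def poisson_fun_mult_cnj
        using \<eta>[OF jk(1)] \<eta>[OF jk(2)] by (intro norm_integral_poisson_fun_le) auto
      also have "\<dots> \<le> 30 * (kern (\<eta> j) (of_int (j - k)) + kern (\<eta> k) (of_int (j - k)))"
        using \<eta> jk sep[OF jk] by (intro gram_le_kern) auto
      finally show "norm (cnj (f j) * f k * G j k) \<le> norm (f j) * norm (f k) *
        (30 * (kern (\<eta> j) (of_int (j - k)) + kern (\<eta> k) (of_int (j - k))))"
        by (simp add: norm_mult mult_left_mono)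
    qed
    also have "\<dots> = 30 * ((\<Sum>j\<in>K. \<Sum>k\<in>K. norm (f j) * norm (f k) * kern (\<eta> j) (of_int (j - k)))
       + (\<Sum>j\<in>K. \<Sum>k\<in>K. norm (f j) * norm (f k) * kern (\<eta> k) (of_int (j - k))))"
      by (simp add: sum_distrib_left sum.distrib[symmetric] algebra_simps)
    also have "(\<Sum>j\<in>K. \<Sum>k\<in>K. norm (f j) * norm (f k) * kern (\<eta> k) (of_int (j - k)))
      = (\<Sum>j\<in>K. \<Sum>k\<in>K. norm (f j) * norm (f k) * kern (\<eta> j) (of_int (j - k)))"
      using kern_minus[of _ "of_int (_ - _)"]
      by (subst sum.swap) (simp add: mult.commute flip: of_int_minus)
    \<comment> \<open>The constant 15360 arises here as 30 times (256 + 256).\<close>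
    also have "30 * (\<dots> + \<dots>) \<le> 30 * (256 * S + 256 * S)"
      unfolding S_def using K \<eta> by (intro mult_left_mono add_mono carleson_form_le) auto
    finally show ?thesis by simp
  qed
  finally have "S \<le> 15360 * integral {0..1} (\<lambda>t. (norm (g t))\<^sup>2)" by simp
  then show ?thesis by (simp add: S_def f_def e_def)
qed

text \<open>Here heights may be 0. Moving a factor exp |t - x| into \<open>g\<close> raises every
  height by 1 and costs at most exp 2 in the squared norm, as |t - x| \<le> 1. The separation of the
  points comes from the radius: it differs from |\<xi> k| by at most \<eta> k and from 2\<pi>k by at
  most \<pi>.\<close>

lemma poisson_family_half:
  fixes g :: "real \<Rightarrow> complex" and \<xi> \<eta> :: "int \<Rightarrow> real"
  assumes K: "finite K" and \<eta>: "\<And>k. k \<in> K \<Longrightarrow> 0 \<le> \<eta> k" and x: "x \<in> {0..1}"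
    and sgn: "\<And>j k. j \<in> K \<Longrightarrow> k \<in> K \<Longrightarrow> \<bar>\<xi> j - \<xi> k\<bar> = \<bar>\<bar>\<xi> j\<bar> - \<bar>\<xi> k\<bar>\<bar>"
    and r: "\<And>k. k \<in> K \<Longrightarrow> \<bar>sqrt ((\<xi> k)\<^sup>2 + (\<eta> k)\<^sup>2) - 2 * pi * of_int k\<bar> \<le> pi"
    and g: "L1_01 g" "(\<lambda>t. (norm (g t))\<^sup>2) integrable_on {0..1}"
  shows "(\<Sum>k\<in>K. (norm (integral {0..1} (\<lambda>t. poisson_fun x (\<xi> k) (\<eta> k) t * g t)))\<^sup>2)
    \<le> 15360 * exp 2 * integral {0..1} (\<lambda>t. (norm (g t))\<^sup>2)"
proof -
  define g' where "g' t = of_real (exp \<bar>t - x\<bar>) * g t" for t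
  have c: "continuous_on {0..1} (\<lambda>t. complex_of_real (exp \<bar>t - x\<bar>))" by (intro continuous_intros)
  have g': "L1_01 g'"
    unfolding g'_def by (rule L1_01_mult_right[OF g(1) c])
  have g2: "L1_01 (\<lambda>t. (norm (g t))\<^sup>2)"
    using g(2) by (intro nonnegative_absolutely_integrable_1) auto
  have "L1_01 (\<lambda>t. (exp \<bar>t - x\<bar>)\<^sup>2 * (norm (g t))\<^sup>2)"
    by (rule L1_01_mult_right[OF g2]) (intro continuous_intros)
  then have g'2: "(\<lambda>t. (norm (g' t))\<^sup>2) integrable_on {0..1}"
    by (simp add: g'_def norm_mult power_mult_distrib absolutely_integrable_on_def)
  have eq: "poisson_fun x (\<xi> k) (\<eta> k) t * g t = poisson_fun x (\<xi> k) (\<eta> k + 1) t * g' t" for k t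
  proof -
    have "poisson_fun x (\<xi> k) (\<eta> k + 1) t * complex_of_real (exp \<bar>t - x\<bar>) = poisson_fun x (\<xi> k) (\<eta> k) t"
      unfolding poisson_fun_def exp_of_real[symmetric] exp_add[symmetric]
      by (rule arg_cong[of _ _ exp]) (simp add: algebra_simps)
    then show ?thesis by (simp add: g'_def mult.assoc[symmetric])
  qed
  have "(\<Sum>k\<in>K. (norm (integral {0..1} (\<lambda>t. poisson_fun x (\<xi> k) (\<eta> k + 1) t * g' t)))\<^sup>2)
    \<le> 15360 * integral {0..1} (\<lambda>t. (norm (g' t))\<^sup>2)"
  proof (rule poisson_family_aux[OF K _ x _ g' g'2])
    fix k assume "k \<in> K"
    then show "1 \<le> \<eta> k + 1" using \<eta> by simp
  next
    fix j k assume jk: "j \<in> K" "k \<in> K"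
    have s: "\<bar>\<xi> k\<bar> \<le> sqrt ((\<xi> k)\<^sup>2 + (\<eta> k)\<^sup>2)" "sqrt ((\<xi> k)\<^sup>2 + (\<eta> k)\<^sup>2) \<le> \<bar>\<xi> k\<bar> + \<eta> k" if "k \<in> K" for k
      using sqrt_sum_squares_le_sum_abs[of "\<xi> k" "\<eta> k"] \<eta>[OF that] by (auto simp: real_sqrt_sum_squares_ge1)
    have "2 * pi * of_int \<bar>j - k\<bar> \<le> \<bar>\<xi> j - \<xi> k\<bar> + \<eta> j + \<eta> k + 2 * pi"
    proof -
      have "2 * pi * of_int \<bar>j - k\<bar> = \<bar>2 * pi * of_int j - 2 * pi * of_int k\<bar>"
        by (simp add: abs_mult flip: right_diff_distrib)
      then show ?thesis
        unfolding sgn[OF jk] using r[OF jk(1)] r[OF jk(2)] s[OF jk(1)] s[OF jk(2)] \<eta>[OF jk(1)] \<eta>[OF jk(2)] by linarith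
    qed
    \<comment> \<open>The two raised heights contribute 4\<pi> on the right, which pays for the
      error 2\<pi> made by the two radii.\<close>
    also have "\<dots> \<le> 2 * pi * (\<bar>\<xi> j - \<xi> k\<bar> + (\<eta> j + 1) + (\<eta> k + 1))"
    proof -
      have "1 * (\<bar>\<xi> j - \<xi> k\<bar> + \<eta> j + \<eta> k) \<le> 2 * pi * (\<bar>\<xi> j - \<xi> k\<bar> + \<eta> j + \<eta> k)"
        using \<eta>[OF jk(1)] \<eta>[OF jk(2)] pi_gt3 by (intro mult_right_mono) auto
      then show ?thesis using pi_gt3 by (simp add: algebra_simps)
    qed
    finally show "of_int \<bar>j - k\<bar> \<le> \<bar>\<xi> j - \<xi> k\<bar> + (\<eta> j + 1) + (\<eta> k + 1)"
      by (simp add: mult_le_cancel_left)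
  qed
  also have "integral {0..1} (\<lambda>t. (norm (g' t))\<^sup>2) \<le> integral {0..1} (\<lambda>t. exp 2 * (norm (g t))\<^sup>2)"
  proof (rule integral_le[OF g'2])
    show "(\<lambda>t. exp 2 * (norm (g t))\<^sup>2) integrable_on {0..1}" using g(2) by (intro integrable_on_mult_right)
    fix t :: real assume "t \<in> {0..1}"
    then have "(exp \<bar>t - x\<bar>)\<^sup>2 \<le> exp 2"
      using x by (auto simp: exp_double[symmetric])
    then show "(norm (g' t))\<^sup>2 \<le> exp 2 * (norm (g t))\<^sup>2"
      by (simp add: g'_def norm_mult power_mult_distrib mult_right_mono)
  qed
  finally show ?thesis by (simp add: eq mult.assoc)
qed

text \<open>Within the indices with \<xi> k \<ge> 0, and within the remaining ones, differences of
  frequencies are differences of moduli; treating the two groups separately doubles the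
  constant.\<close>

lemma poisson_family_le:
  fixes g :: "real \<Rightarrow> complex" and \<xi> \<eta> :: "int \<Rightarrow> real"
  assumes K: "finite K" and \<eta>: "\<And>k. k \<in> K \<Longrightarrow> 0 \<le> \<eta> k" and x: "x \<in> {0..1}"
    and r: "\<And>k. k \<in> K \<Longrightarrow> \<bar>sqrt ((\<xi> k)\<^sup>2 + (\<eta> k)\<^sup>2) - 2 * pi * of_int k\<bar> \<le> pi"
    and g: "L1_01 g" "(\<lambda>t. (norm (g t))\<^sup>2) integrable_on {0..1}"
  shows "(\<Sum>k\<in>K. (norm (integral {0..1} (\<lambda>t. poisson_fun x (\<xi> k) (\<eta> k) t * g t)))\<^sup>2)
    \<le> 30720 * exp 2 * integral {0..1} (\<lambda>t. (norm (g t))\<^sup>2)"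
proof -
  let ?F = "\<lambda>k. (norm (integral {0..1} (\<lambda>t. poisson_fun x (\<xi> k) (\<eta> k) t * g t)))\<^sup>2"
  have "sum ?F K = sum ?F {k\<in>K. 0 \<le> \<xi> k} + sum ?F {k\<in>K. \<not> 0 \<le> \<xi> k}"
    using K by (subst sum.union_disjoint[symmetric]) (auto intro!: sum.cong)
  moreover have "sum ?F {k\<in>K. 0 \<le> \<xi> k} \<le> 15360 * exp 2 * integral {0..1} (\<lambda>t. (norm (g t))\<^sup>2)"
    by (intro poisson_family_half x g) (use K \<eta> r in auto)
  moreover have "sum ?F {k\<in>K. \<not> 0 \<le> \<xi> k} \<le> 15360 * exp 2 * integral {0..1} (\<lambda>t. (norm (g t))\<^sup>2)"
    by (intro poisson_family_half x g) (use K \<eta> r in auto)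
  ultimately show ?thesis by simp
qed

subsection \<open>Weak derivatives\<close>

lemma integrable_lebesgue_on_iff:
  fixes f :: "real \<Rightarrow> 'a::euclidean_space"
  shows "integrable (lebesgue_on {0..1}) f \<longleftrightarrow> L1_01 f"
  by (simp add: integrable_restrict_space set_integrable_def)

lemma test_fun_ac_deriv:
  assumes "test_fun_01 \<phi> \<phi>'"
  shows "ac_deriv \<phi> \<phi>'" "\<phi> 0 = 0" "\<phi> 1 = 0"
proof -
  show "ac_deriv \<phi> \<phi>'"
    using assms unfolding test_fun_01_def
    by (intro ac_deriv_has_vector_derivative)
      (auto simp: has_real_derivative_iff_has_vector_derivative intro: continuous_on_subset)
  obtain K where "K \<subseteq> {0<..<1}" "\<And>x. x \<notin> K \<Longrightarrow> \<phi> x = 0"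
    using assms unfolding test_fun_01_def by blast
  then show "\<phi> 0 = 0" "\<phi> 1 = 0"
    by (meson greaterThanLessThan_iff less_irrefl subsetD)+
qed

lemma ac_deriv_test_fun:
  assumes "ac_deriv f g" "test_fun_01 \<phi> \<phi>'"
  shows "(LINT x|lebesgue_on {0..1}. \<phi>' x *\<^sub>R f x) = - (LINT x|lebesgue_on {0..1}. \<phi> x *\<^sub>R g x)"
proof -
  note p = test_fun_ac_deriv[OF assms(2)]
  note h = bounded_bilinear_scaleR[where 'a = 'a]
  have 1: "L1_01 (\<lambda>x. \<phi>' x *\<^sub>R f x)"
    by (rule L1_01_prod_left[OF h ac_deriv_integrable[OF p(1)] ac_deriv_continuous[OF assms(1)]])
  have 2: "L1_01 (\<lambda>x. \<phi> x *\<^sub>R g x)"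
    by (rule L1_01_prod_right[OF h ac_deriv_integrable[OF assms(1)] ac_deriv_continuous[OF p(1)]])
  have "ac_deriv (\<lambda>x. \<phi> x *\<^sub>R f x) (\<lambda>x. \<phi>' x *\<^sub>R f x + \<phi> x *\<^sub>R g x)"
    by (rule ac_deriv_prod[OF h p(1) assms(1)])
  from ac_deriv_integral_eq[OF this, of 1] p
  have "integral {0..1} (\<lambda>x. \<phi>' x *\<^sub>R f x + \<phi> x *\<^sub>R g x) = 0" by simp
  moreover have "integral {0..1} (\<lambda>x. \<phi>' x *\<^sub>R f x + \<phi> x *\<^sub>R g x) =
      integral {0..1} (\<lambda>x. \<phi>' x *\<^sub>R f x) + integral {0..1} (\<lambda>x. \<phi> x *\<^sub>R g x)"
    using 1 2 by (intro integral_add) (auto simp: absolutely_integrable_on_def)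
  moreover have "(LINT x|lebesgue_on {0..1}. \<phi>' x *\<^sub>R f x) = integral {0..1} (\<lambda>x. \<phi>' x *\<^sub>R f x)"
    "(LINT x|lebesgue_on {0..1}. \<phi> x *\<^sub>R g x) = integral {0..1} (\<lambda>x. \<phi> x *\<^sub>R g x)"
    using 1 2 by (auto intro!: lebesgue_integral_eq_integral simp: integrable_lebesgue_on_iff)
  ultimately show ?thesis by (simp add: eq_neg_iff_add_eq_0)
qed

text \<open>The primitive vanishes left of \<open>d\<close> because \<psi> does, and right of 1 - d
  because the total integral is 0; continuity of \<psi> makes it continuously
  differentiable.\<close>

lemma test_fun_integral:
  assumes c: "continuous_on UNIV \<psi>" and d: "0 < d" "d < 1/2"
    and z: "\<And>x. x \<notin> {d..1-d} \<Longrightarrow> \<psi> x = 0" and i: "integral {0..1} \<psi> = 0"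
  shows "test_fun_01 (\<lambda>x. integral {0..x} \<psi>) \<psi>"
proof -
  let ?\<phi> = "\<lambda>x. integral {0..x} \<psi>"
  have lo: "?\<phi> x = 0" if "x < d" for x
  proof -
    have "integral {0..x} \<psi> = integral {0..x} (\<lambda>_. 0)"
      using that z by (intro integral_cong) auto
    then show ?thesis by simp
  qed
  have ci: "\<psi> integrable_on {a..b}" for a b
    using c by (intro integrable_continuous_real) (auto intro: continuous_on_subset)
  have hi: "?\<phi> x = 0" if "x > 1 - d" for x
  proof -
    have 0: "integral {a..b} \<psi> = 0" if "a > 1 - d" for a b
    proof -
      have "integral {a..b} \<psi> = integral {a..b} (\<lambda>_. 0)"
        using that z by (intro integral_cong) auto
      then show ?thesis by simp
    qed
    show ?thesis
    proof (cases "x \<le> 1")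
      case True
      then show ?thesis
        using integral_combine[of 0 x 1 \<psi>] ci 0[of x 1] that i d by simp
    next
      case False
      then show ?thesis
        using integral_combine[of 0 1 x \<psi>] ci 0[of 1 x] i d by simp
    qed
  qed
  have "(?\<phi> has_real_derivative \<psi> x) (at x)" for x
  \<comment> \<open>For negative \<open>x\<close> the interval of integration is empty and the
    primitive is 0 by convention, so it agrees with the zero function on all of x < d. For x \<ge> d
    the point is interior to {0..x+1}, and the one-sided theorem gives a full derivative.\<close>
  proof (cases "x < d")
    case True
    have "((\<lambda>x. 0) has_real_derivative \<psi> x) (at x)"
      using z[of x] True by simp
    then show ?thesis
      by (rule has_field_derivative_transform_within_open[where S = "{..<d}"]) (use lo True in auto)
  next
    case False
    have "(?\<phi> has_real_derivative \<psi> x) (at x within {0..x+1})"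
      using False d c by (intro integral_has_real_derivative) (auto intro: continuous_on_subset)
    moreover have "at x within {0..x+1} = at x"
      using False d by (intro at_within_interior) auto
    ultimately show ?thesis by simp
  qed
  moreover have "compact {d..1-d}" "{d..1-d} \<subseteq> {0<..<1}" using d by auto
  moreover have "?\<phi> x = 0" if "x \<notin> {d..1-d}" for x
    using that lo[of x] hi[of x] by auto
  ultimately show ?thesis using c unfolding test_fun_01_def by blast
qed

text \<open>The test function \<open>\<theta> \<cdot> (w - c)\<close>, with a cutoff \<open>\<theta>\<close> and the \<open>\<theta>\<close>-weighted mean \<open>c\<close>
  of \<open>w\<close>, turns the hypothesis into \<open>\<integral> \<theta> (w - c)\<^sup>2 = 0\<close>.\<close>
lemma du_Bois_Reymond_interior:
  fixes w :: "real \<Rightarrow> real"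
  assumes w: "continuous_on {0..1} w" and d: "0 < d" "d < 1/2"
    and 0: "\<And>\<phi> \<phi>'. test_fun_01 \<phi> \<phi>' \<Longrightarrow> integral {0..1} (\<lambda>x. \<phi>' x * w x) = 0"
  shows "\<exists>c. \<forall>x. d < x \<longrightarrow> x < 1 - d \<longrightarrow> w x = c"
proof -
  define \<theta> where "\<theta> x = max 0 (min (x - d) (1 - d - x))" for x :: real
  define c where "c = integral {0..1} (\<lambda>x. \<theta> x * w x) / integral {0..1} \<theta>"
  \<comment> \<open>Continuity of \<open>w\<close> is known on [0,1] only, while a test function
    lives on the whole line; clamping the argument extends \<open>w\<close> continuously.\<close>
  define \<psi> where "\<psi> x = \<theta> x * (w (max 0 (min 1 x)) - c)" for x
  have \<theta>c: "continuous_on A \<theta>" for A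
    unfolding \<theta>_def by (intro continuous_intros)
  have wc: "continuous_on UNIV (\<lambda>x. w (max 0 (min 1 x)))"
    by (rule continuous_on_compose2[OF w]) (auto intro!: continuous_intros)
  have \<psi>c: "continuous_on UNIV \<psi>"
    unfolding \<psi>_def by (intro continuous_intros \<theta>c wc)
  have \<psi>_eq: "\<psi> x = \<theta> x * (w x - c)" if "x \<in> {0..1}" for x
  proof -
    have "max 0 (min 1 x) = x" using that by auto
    then show ?thesis by (simp add: \<psi>_def)
  qed
  have \<theta>0: "\<theta> x \<ge> 0" for x by (simp add: \<theta>_def)
  have "integral {0..1} \<theta> \<noteq> 0"
    using integral_eq_0_iff[OF \<theta>c, of 0 1] \<theta>0 d
    by (auto simp: \<theta>_def intro!: bexI[of _ "1/2"])
  have cint: "(\<lambda>x. \<theta> x * w x) integrable_on {0..1}" "\<theta> integrable_on {0..1}"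
    using w \<theta>c by (auto intro!: integrable_continuous_real continuous_intros)
  have "integral {0..1} \<psi> = integral {0..1} (\<lambda>x. \<theta> x * w x - c * \<theta> x)"
    by (intro integral_cong) (auto simp: \<psi>_eq algebra_simps)
  also have "\<dots> = integral {0..1} (\<lambda>x. \<theta> x * w x) - c * integral {0..1} \<theta>"
    using cint by (subst integral_diff) (auto intro: integrable_on_mult_right)
  also have "\<dots> = 0" using \<open>integral {0..1} \<theta> \<noteq> 0\<close> by (simp add: c_def)
  finally have i0: "integral {0..1} \<psi> = 0" .
  have "test_fun_01 (\<lambda>x. integral {0..x} \<psi>) \<psi>"
    by (rule test_fun_integral[OF \<psi>c d _ i0]) (auto simp: \<psi>_def \<theta>_def)
  from 0[OF this] have i1: "integral {0..1} (\<lambda>x. \<psi> x * w x) = 0" .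
  have pint: "(\<lambda>x. \<psi> x * w x) integrable_on {0..1}" "\<psi> integrable_on {0..1}"
    using w \<psi>c by (auto intro!: integrable_continuous_real continuous_intros intro: continuous_on_subset)
  have "integral {0..1} (\<lambda>x. \<theta> x * (w x - c)\<^sup>2) = integral {0..1} (\<lambda>x. \<psi> x * w x - c * \<psi> x)"
    by (intro integral_cong) (auto simp: \<psi>_eq algebra_simps power2_eq_square)
  also have "\<dots> = integral {0..1} (\<lambda>x. \<psi> x * w x) - c * integral {0..1} \<psi>"
    using pint by (subst integral_diff) (auto intro: integrable_on_mult_right)
  also have "\<dots> = 0" using i0 i1 by simp
  finally have "integral {0..1} (\<lambda>x. \<theta> x * (w x - c)\<^sup>2) = 0" .
  then have z: "\<forall>x\<in>{0..1}. \<theta> x * (w x - c)\<^sup>2 = 0"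
    using \<theta>0 by (subst (asm) integral_eq_0_iff) (auto intro!: continuous_intros \<theta>c w)
  have "w x = c" if "d < x" "x < 1 - d" for x
  proof -
    have "\<theta> x > 0" using that by (simp add: \<theta>_def)
    moreover have "\<theta> x * (w x - c)\<^sup>2 = 0" using z that d by auto
    ultimately show ?thesis by simp
  qed
  then show ?thesis by blast
qed

text \<open>All the interior intervals contain 1/2, so their constants agree, and continuity carries
  the value to the endpoints.\<close>

lemma du_Bois_Reymond:
  fixes w :: "real \<Rightarrow> real"
  assumes w: "continuous_on {0..1} w"
    and 0: "\<And>\<phi> \<phi>'. test_fun_01 \<phi> \<phi>' \<Longrightarrow> integral {0..1} (\<lambda>x. \<phi>' x * w x) = 0"
    and x: "x \<in> {0..1}"
  shows "w x = w 0"
proof -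
  have eq: "w x = w (1/2)" if x: "x \<in> {0<..<1}" for x
  proof -
    define d where "d = min (min x (1 - x)) (1/2) / 2"
    have d: "0 < d" "d < 1/2" "d < x" "x < 1 - d" using x by (auto simp: d_def min_def field_simps)
    obtain c where "\<forall>x. d < x \<longrightarrow> x < 1 - d \<longrightarrow> w x = c"
      using du_Bois_Reymond_interior[OF w d(1,2)] 0 by blast
    then show ?thesis using d by simp
  qed
  have cl: "closure {0<..<1::real} = {0..1}" by simp
  have "w x = w (1/2)" if "x \<in> {0..1}" for x
    using continuous_constant_on_closure[of "{0<..<1}" w "w (1/2)" x] eq w that unfolding cl by blast
  from this[of x] this[of 0] x show ?thesis by simp
qed

text \<open>The primitive of \<open>g\<close> has weak derivative \<open>g\<close> too, so each
  component of its difference from \<open>f\<close> satisfies the du Bois-Reymond hypothesis. As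
  \<open>f\<close> is continuous, equality holds at every point, in particular at 0 and 1, where
  frames are evaluated.\<close>

lemma weak_deriv_iff_ac_deriv:
  fixes f g :: "real \<Rightarrow> 'a::euclidean_space"
  assumes f: "continuous_on {0..1} f"
  shows "has_weak_derivative_01 f g \<longleftrightarrow> ac_deriv f g"
proof
  assume "ac_deriv f g"
  then show "has_weak_derivative_01 f g"
    unfolding has_weak_derivative_01_def integrable_lebesgue_on_iff
    using ac_deriv_test_fun absolutely_integrable_continuous_real[OF f] ac_deriv_integrable by blast
next
  assume weak: "has_weak_derivative_01 f g"
  then have g: "L1_01 g"
    and eq: "\<And>\<phi> \<phi>'. test_fun_01 \<phi> \<phi>' \<Longrightarrow>
        (LINT x|lebesgue_on {0..1}. \<phi>' x *\<^sub>R f x) = - (LINT x|lebesgue_on {0..1}. \<phi> x *\<^sub>R g x)"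
    by (auto simp: has_weak_derivative_01_def integrable_lebesgue_on_iff)
  define G where "G x = integral {0..x} g" for x
  have G: "ac_deriv G g" using ac_deriv_integral[OF g, of 0] by (simp add: G_def[abs_def])
  note Gc = ac_deriv_continuous[OF G]
  have "(f x - G x) \<bullet> b = (f 0 - G 0) \<bullet> b" if x: "x \<in> {0..1}" and "b \<in> Basis" for x b
  proof (rule du_Bois_Reymond[OF _ _ x])
    show "continuous_on {0..1} (\<lambda>x. (f x - G x) \<bullet> b)" using f Gc by (intro continuous_intros)
    fix \<phi> \<phi>' assume t: "test_fun_01 \<phi> \<phi>'"
    have \<phi>c: "continuous_on {0..1} \<phi>'"
      using t by (auto simp: test_fun_01_def intro: continuous_on_subset)
    have i: "L1_01 (\<lambda>x. \<phi>' x *\<^sub>R f x)"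
      "L1_01 (\<lambda>x. \<phi>' x *\<^sub>R G x)"
      using f Gc \<phi>c by (auto intro!: absolutely_integrable_continuous_real continuous_intros)
    then have i': "(\<lambda>x. \<phi>' x *\<^sub>R f x) integrable_on {0..1}" "(\<lambda>x. \<phi>' x *\<^sub>R G x) integrable_on {0..1}"
      by (auto simp: absolutely_integrable_on_def)
    have "integral {0..1} (\<lambda>x. \<phi>' x *\<^sub>R f x) = integral {0..1} (\<lambda>x. \<phi>' x *\<^sub>R G x)"
      using eq[OF t] ac_deriv_test_fun[OF G t] i
      by (simp add: lebesgue_integral_eq_integral integrable_lebesgue_on_iff)
    then have *: "integral {0..1} (\<lambda>x. \<phi>' x *\<^sub>R f x - \<phi>' x *\<^sub>R G x) = 0"
      using i' by (simp add: integral_diff)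
    have "(\<lambda>x. \<phi>' x * ((f x - G x) \<bullet> b)) = (\<lambda>v. v \<bullet> b) \<circ> (\<lambda>x. \<phi>' x *\<^sub>R f x - \<phi>' x *\<^sub>R G x)"
      by (simp add: fun_eq_iff inner_diff_left algebra_simps)
    moreover have "integral {0..1} ((\<lambda>v. v \<bullet> b) \<circ> (\<lambda>x. \<phi>' x *\<^sub>R f x - \<phi>' x *\<^sub>R G x)) = 0"
      by (subst integral_linear)
        (use i' * in \<open>auto intro: bounded_linear_inner_left integrable_diff\<close>)
    ultimately show "integral {0..1} (\<lambda>x. \<phi>' x * ((f x - G x) \<bullet> b)) = 0" by simp
  qed
  then have const: "f x - G x = f 0 - G 0" if "x \<in> {0..1}" for x
    using that by (meson euclidean_eqI)
  have "f x = f 0 + G x" if "x \<in> {0..1}" for x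
    using const[OF that] by (simp add: G_def[of 0] algebra_simps)
  then show "ac_deriv f g"
    using g unfolding G_def by (intro ac_derivI)
qed

subsection \<open>Linear systems with integrable coefficients\<close>

lemma ac_deriv_power:
  fixes m :: "real \<Rightarrow> 'a::{real_normed_field, euclidean_space}"
  assumes "ac_deriv m \<mu>"
  shows "ac_deriv (\<lambda>x. m x ^ Suc n) (\<lambda>x. real (Suc n) *\<^sub>R (\<mu> x * m x ^ n))"
proof (induction n)
  case 0
  then show ?case using assms by simp
next
  case (Suc n)
  show ?case
    by (rule ac_deriv_cong[OF ac_deriv_mult[OF assms Suc.IH]])
      (simp_all add: scaleR_conv_of_real algebra_simps)
qed

lemma L1_01_scaled_norm:
  fixes A :: "real \<Rightarrow> 'a::euclidean_space"
  assumes "A absolutely_integrable_on S"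
  shows "(\<lambda>t. K * norm (A t)) absolutely_integrable_on S"
  using assms set_integrable_norm[OF assms] by (intro set_integrable_mult_right) simp

text \<open>These are the terms of the Picard series, not its partial sums: the n-th one is
  homogeneous of degree n in the coefficient \<open>A\<close>, and the solution is their
  sum.\<close>

primrec picard :: "('a::euclidean_space \<Rightarrow> 'b::euclidean_space \<Rightarrow> 'b) \<Rightarrow> (real \<Rightarrow> 'a) \<Rightarrow> 'b \<Rightarrow> nat \<Rightarrow> real \<Rightarrow> 'b"
  where
  "picard h A y 0 = (\<lambda>x. y)"
| "picard h A y (Suc n) = (\<lambda>x. integral {0..x} (\<lambda>t. h (A t) (picard h A y n t)))"

lemma picard_continuous:
  assumes h: "bounded_bilinear h" and A: "L1_01 A"
  shows "continuous_on {0..1} (picard h A y n)"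
proof (induction n)
  case (Suc n)
  have "L1_01 (\<lambda>t. h (A t) (picard h A y n t))"
    by (rule L1_01_prod_left[OF h A Suc])
  then show ?case
    by (auto simp: absolutely_integrable_on_def intro: indefinite_integral_continuous_1)
qed simp

lemma picard_integrable:
  assumes h: "bounded_bilinear h" and A: "L1_01 A"
  shows "L1_01 (\<lambda>t. h (A t) (picard h A y n t))"
  by (rule L1_01_prod_left[OF h A picard_continuous[OF h A]])

text \<open>The n-fold iterated integral runs over a simplex, whence the factorial. In the
  induction, \<open>ac_deriv_power\<close> integrates \<mu> m^n exactly, where \<open>m\<close> is
  the primitive of \<mu> = K |A|.\<close>

lemma norm_picard_le:
  assumes h: "bounded_bilinear h" and A: "L1_01 A"
    and K: "\<And>a b. norm (h a b) \<le> norm a * norm b * K" "K \<ge> 0"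
    and x: "x \<in> {0..1}"
  shows "norm (picard h A y n x) \<le> norm y * (K * integral {0..x} (\<lambda>t. norm (A t))) ^ n / fact n"
  using x
proof (induction n arbitrary: x)
  case (Suc n)
  define \<mu> where "\<mu> t = K * norm (A t)" for t
  define m where "m x = integral {0..x} \<mu>" for x
  have m_eq: "m x = K * integral {0..x} (\<lambda>t. norm (A t))" for x
    unfolding m_def \<mu>_def by (rule integral_mult_right)
  have \<mu>: "L1_01 \<mu>"
    unfolding \<mu>_def by (rule L1_01_scaled_norm[OF A])
  have m: "ac_deriv m \<mu>" using ac_deriv_integral[OF \<mu>, of 0] by (simp add: m_def[abs_def])
  have mc: "continuous_on {0..1} (\<lambda>t. norm y * m t ^ n / fact n)"
    by (intro continuous_intros ac_deriv_continuous[OF m]) simp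
  have *: "L1_01 (\<lambda>t. \<mu> t * (norm y * m t ^ n / fact n))"
    by (rule L1_01_mult_left[OF \<mu> mc])
  have "norm (picard h A y (Suc n) x) \<le> integral {0..x} (\<lambda>t. \<mu> t * (norm y * m t ^ n / fact n))"
    unfolding picard.simps
  proof (rule integral_norm_bound_integral)
    show "(\<lambda>t. h (A t) (picard h A y n t)) integrable_on {0..x}"
      "(\<lambda>t. \<mu> t * (norm y * m t ^ n / fact n)) integrable_on {0..x}"
      using L1_01_on(2)[OF picard_integrable[OF h A]] L1_01_on(2)[OF *] Suc.prems
      by auto
    fix t assume "t \<in> {0..x}"
    then have "norm (picard h A y n t) \<le> norm y * m t ^ n / fact n"
      unfolding m_eq using Suc.prems by (intro Suc.IH) auto
    then have "norm (A t) * norm (picard h A y n t) * K \<le> norm (A t) * (norm y * m t ^ n / fact n) * K"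
      using K(2) by (intro mult_right_mono mult_left_mono) auto
    then show "norm (h (A t) (picard h A y n t)) \<le> \<mu> t * (norm y * m t ^ n / fact n)"
      using K(1)[of "A t" "picard h A y n t"] by (simp add: \<mu>_def mult_ac)
  qed
  also have "\<dots> = integral {0..x} (\<lambda>t. norm y / fact (Suc n) * (real (Suc n) * (\<mu> t * m t ^ n)))"
    by (intro integral_cong) (simp add: field_simps del: of_nat_Suc)
  also have "\<dots> = norm y / fact (Suc n) * integral {0..x} (\<lambda>t. real (Suc n) * (\<mu> t * m t ^ n))"
    by (rule integral_mult_right)
  also have "integral {0..x} (\<lambda>t. real (Suc n) * (\<mu> t * m t ^ n)) = m x ^ Suc n"
    using ac_deriv_integral_eq[OF ac_deriv_power[OF m] Suc.prems, of n] by (simp add: m_def[of 0])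
  finally show ?case by (simp add: m_eq)
qed simp

lemma picard_uniform_limit:
  assumes h: "bounded_bilinear h" and A: "L1_01 A"
  shows "uniform_limit {0..1} (\<lambda>N x. \<Sum>n<N. picard h A y n x) (\<lambda>x. \<Sum>n. picard h A y n x) sequentially"
proof -
  obtain K where K: "K > 0" "\<And>a b. norm (h a b) \<le> norm a * norm b * K"
    using bounded_bilinear.pos_bounded[OF h] by blast
  define B where "B = K * integral {0..1} (\<lambda>t. norm (A t))"
  show ?thesis
  proof (rule Weierstrass_m_test)
    fix n and x :: real assume x: "x \<in> {0..1}"
    have nA: "L1_01 (\<lambda>t. norm (A t))"
      using A by (auto simp: absolutely_integrable_on_def)
    have "integral {0..x} (\<lambda>t. norm (A t)) \<le> integral {0..1} (\<lambda>t. norm (A t))"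
      using x L1_01_on(2)[OF nA] by (intro integral_subset_le) auto
    moreover have "0 \<le> integral {0..x} (\<lambda>t. norm (A t))"
      using x L1_01_on(2)[OF nA] by (intro integral_nonneg) auto
    ultimately have "norm y * (K * integral {0..x} (\<lambda>t. norm (A t))) ^ n / fact n \<le> norm y * B ^ n / fact n"
      unfolding B_def using K by (intro divide_right_mono mult_left_mono power_mono) auto
    then show "norm (picard h A y n x) \<le> norm y * B ^ n / fact n"
      using norm_picard_le[OF h A K(2) _ x, of y n] K(1) by linarith
  next
    show "summable (\<lambda>n. norm y * B ^ n / fact n)"
      using summable_mult[OF summable_exp[of B], of "norm y"] by (simp add: field_simps)
  qed
qed

text \<open>Each partial sum is \<open>y\<close> plus the integral of \<open>A\<close> applied to
  the preceding one; uniform convergence against the integrable \<open>A\<close> passes to the limit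
  under the integral.\<close>

lemma picard_solution:
  assumes h: "bounded_bilinear h" and A: "L1_01 A"
  shows "ac_deriv (\<lambda>x. \<Sum>n. picard h A y n x) (\<lambda>x. h (A x) (\<Sum>n. picard h A y n x))"
    "(\<Sum>n. picard h A y n 0) = y"
proof -
  let ?Y = "\<lambda>x. \<Sum>n. picard h A y n x" and ?S = "\<lambda>N x. \<Sum>n<N. picard h A y n x"
  interpret bounded_bilinear h by fact
  note lim = picard_uniform_limit[OF h A, of y]
  note pc = picard_continuous[OF h A] and pint = picard_integrable[OF h A]
  have Sc: "continuous_on {0..1} (?S N)" for N by (intro continuous_intros pc)
  have Yc: "continuous_on {0..1} ?Y"
    by (rule uniform_limit_theorem[OF _ lim]) (simp_all add: Sc)
  have AY: "L1_01 (\<lambda>x. h (A x) (?Y x))"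
    by (rule L1_01_prod_left[OF h A Yc])
  have "picard h A y n 0 = (if n = 0 then y else 0)" for n by (cases n) auto
  then have "(\<lambda>n. picard h A y n 0) sums y"
    using sums_single[of 0 "\<lambda>_. y"] by presburger
  then show Y0: "?Y 0 = y" by (rule sums_unique[symmetric])
  obtain K where K: "K > 0" "\<And>a b. norm (h a b) \<le> norm a * norm b * K"
    using pos_bounded by blast
  show "ac_deriv ?Y (\<lambda>x. h (A x) (?Y x))"
  proof (rule ac_derivI[OF AY])
    fix x :: real assume x: "x \<in> {0..1}"
    note I = L1_01_on(2)[of _ 0 x]
    have nA: "L1_01 (\<lambda>t. norm (A t))"
      using A by (auto simp: absolutely_integrable_on_def)
    have SS: "?S (Suc N) x = y + integral {0..x} (\<lambda>t. h (A t) (?S N t))" for N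
    proof -
      have "integral {0..x} (\<lambda>t. h (A t) (?S N t)) = (\<Sum>n<N. integral {0..x} (\<lambda>t. h (A t) (picard h A y n t)))"
        unfolding sum_right using x I[OF pint] by (intro integral_sum) auto
      then show ?thesis by (simp only: sum.lessThan_Suc_shift picard.simps)
    qed
    have ASi: "(\<lambda>t. h (A t) (?S N t)) integrable_on {0..x}" for N
      using x by (intro I L1_01_prod_left[OF h A Sc]) auto
    \<comment> \<open>Error budget: a uniform distance e / c contributes at most (c - 1) e / c under
      the integral and e / c outside, together \<open>e\<close>.\<close>
    define c where "c = 1 + K * integral {0..x} (\<lambda>t. norm (A t))"
    have c: "c \<ge> 1" unfolding c_def using x K I[OF nA] by (auto intro!: mult_nonneg_nonneg integral_nonneg)
    have "norm (?Y x - (y + integral {0..x} (\<lambda>t. h (A t) (?Y t)))) \<le> 0"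
    proof (rule field_le_epsilon)
      fix e :: real assume e: "e > 0"
      have "\<forall>\<^sub>F N in sequentially. \<forall>x\<in>{0..1}. dist (?S N x) (?Y x) < e / c"
        using lim e c unfolding uniform_limit_iff by auto
      then obtain N where N: "\<And>n x. n \<ge> N \<Longrightarrow> x \<in> {0..1} \<Longrightarrow> norm (?S n x - ?Y x) < e / c"
        unfolding eventually_sequentially dist_norm by blast
      have "norm (integral {0..x} (\<lambda>t. h (A t) (?S N t) - h (A t) (?Y t))) \<le> integral {0..x} (\<lambda>t. K * (e / c) * norm (A t))"
      proof (rule integral_norm_bound_integral)
        fix t assume "t \<in> {0..x}"
        then have "t \<in> {0..1}" using x by auto
        then have "norm (A t) * norm (?S N t - ?Y t) * K \<le> norm (A t) * (e / c) * K"
          using N[of N t] K(1) by (intro mult_right_mono mult_left_mono) auto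
        then show "norm (h (A t) (?S N t) - h (A t) (?Y t)) \<le> K * (e / c) * norm (A t)"
          using K(2)[of "A t" "?S N t - ?Y t"] by (simp add: diff_right mult_ac)
      qed (use x in \<open>intro integrable_diff integrable_on_mult_right ASi I[OF AY] I[OF nA]; simp\<close>)+
      also have "\<dots> = K * (e / c) * integral {0..x} (\<lambda>t. norm (A t))" by (rule integral_mult_right)
      finally have 1: "norm (integral {0..x} (\<lambda>t. h (A t) (?S N t) - h (A t) (?Y t))) \<le> (c - 1) * (e / c)"
        by (simp add: c_def mult_ac)
      have 2: "integral {0..x} (\<lambda>t. h (A t) (?S N t) - h (A t) (?Y t)) = ?S (Suc N) x - y - integral {0..x} (\<lambda>t. h (A t) (?Y t))"
        unfolding SS using x ASi I[OF AY] by (simp add: integral_diff)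
      have 3: "norm (?S (Suc N) x - ?Y x) \<le> e / c" using N[of "Suc N" x] x by simp
      have "?Y x - (y + integral {0..x} (\<lambda>t. h (A t) (?Y t))) =
        (?S (Suc N) x - y - integral {0..x} (\<lambda>t. h (A t) (?Y t))) - (?S (Suc N) x - ?Y x)"
        by (simp only: algebra_simps)
      also have "norm \<dots> \<le> (c - 1) * (e / c) + e / c"
        using 1 3 unfolding 2 by (rule order_trans[OF norm_triangle_ineq4 add_mono])
      also have "\<dots> = 0 + e" using c by (simp add: field_simps)
      finally show "norm (?Y x - (y + integral {0..x} (\<lambda>t. h (A t) (?Y t)))) \<le> 0 + e" .
    qed
    then show "?Y x = ?Y 0 + integral {0..x} (\<lambda>t. h (A t) (?Y t))" unfolding Y0 by simp
  qed
qed

text \<open>The Picard iteration for \<open>y' = f' y\<close> is the exponential series of \<open>f - f(0)\<close>.\<close>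
lemma ac_deriv_exp:
  fixes f :: "real \<Rightarrow> 'a::{real_normed_field, euclidean_space}"
  assumes f: "ac_deriv f f'"
  shows "ac_deriv (\<lambda>x. exp (f x)) (\<lambda>x. f' x * exp (f x))"
proof -
  define m where "m x = f x - f 0" for x
  have m: "ac_deriv m f'"
    by (rule ac_deriv_cong[OF ac_deriv_sub[OF f ac_deriv_integral[of "\<lambda>_. 0" "f 0"]]]) (simp_all add: m_def)
  have "picard (*) f' 1 n x = m x ^ n /\<^sub>R fact n" if "x \<in> {0..1}" for n x
    using that
  proof (induction n arbitrary: x)
    case (Suc n)
    have "picard (*) f' 1 (Suc n) x =
        integral {0..x} (\<lambda>t. (1 / fact (Suc n)) *\<^sub>R (real (Suc n) *\<^sub>R (f' t * m t ^ n)))"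
      unfolding picard.simps using Suc by (intro integral_cong) (simp add: field_simps del: of_nat_Suc)
    also have "\<dots> = (1 / fact (Suc n)) *\<^sub>R integral {0..x} (\<lambda>t. real (Suc n) *\<^sub>R (f' t * m t ^ n))"
      by (rule integral_cmul)
    also have "integral {0..x} (\<lambda>t. real (Suc n) *\<^sub>R (f' t * m t ^ n)) = m x ^ Suc n"
      using ac_deriv_integral_eq[OF ac_deriv_power[OF m] Suc.prems, of n] by (simp add: m_def[of 0])
    finally show ?case by (simp add: divide_inverse)
  qed simp
  then have "(\<Sum>n. picard (*) f' 1 n x) = exp (m x)" if "x \<in> {0..1}" for x
    using that by (simp add: exp_def)
  then have "ac_deriv (\<lambda>x. exp (m x)) (\<lambda>x. f' x * exp (m x))"
    by (intro ac_deriv_cong[OF picard_solution(1)[OF bounded_bilinear_mult ac_deriv_integrable[OF f], of 1]]) auto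
  from ac_deriv_linear[OF this bounded_linear_mult_right[of "exp (f 0)"]] show ?thesis
    by (rule ac_deriv_cong) (simp_all add: m_def exp_diff)
qed

text \<open>With \<Phi> the integral of \<mu> \<rho> and \<open>m\<close> that of \<mu>, the density
  of \<Phi> exp (- m) is at most \<mu> f. Keeping \<open>f\<close> under the integral, without
  monotonicity or a supremum, is what later allows squares to be summed over k at each fixed
  time.\<close>

lemma gronwall_01:
  fixes \<rho> f \<mu> :: "real \<Rightarrow> real"
  assumes \<mu>: "L1_01 \<mu>" "\<And>t. t \<in> {0..1} \<Longrightarrow> 0 \<le> \<mu> t"
    and \<rho>: "continuous_on {0..1} \<rho>" and f: "continuous_on {0..1} f" "\<And>t. t \<in> {0..1} \<Longrightarrow> 0 \<le> f t"
    and le: "\<And>t. t \<in> {0..1} \<Longrightarrow> \<rho> t \<le> f t + integral {0..t} (\<lambda>t. \<mu> t * \<rho> t)"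
    and x: "x \<in> {0..1}"
  shows "\<rho> x \<le> f x + exp (integral {0..x} \<mu>) * integral {0..x} (\<lambda>t. \<mu> t * f t)"
proof -
  define \<Phi> where "\<Phi> = (\<lambda>x. integral {0..x} (\<lambda>t. \<mu> t * \<rho> t))"
  define m where "m = (\<lambda>x. integral {0..x} \<mu>)"
  have \<mu>\<rho>: "L1_01 (\<lambda>t. \<mu> t * \<rho> t)"
    and \<mu>f: "L1_01 (\<lambda>t. \<mu> t * f t)"
    using L1_01_mult_left[OF \<mu>(1)] \<rho> f by auto
  have d\<Phi>: "ac_deriv \<Phi> (\<lambda>t. \<mu> t * \<rho> t)"
    using ac_deriv_integral[OF \<mu>\<rho>, of 0] by (simp add: \<Phi>_def)
  have dm: "ac_deriv m \<mu>"
    using ac_deriv_integral[OF \<mu>(1), of 0] by (simp add: m_def)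
  have de: "ac_deriv (\<lambda>x. exp (- m x)) (\<lambda>x. - \<mu> x * exp (- m x))"
    using ac_deriv_exp[OF ac_deriv_minus[OF dm]] .
  have dp: "ac_deriv (\<lambda>x. \<Phi> x * exp (- m x)) (\<lambda>x. \<mu> x * \<rho> x * exp (- m x) + \<Phi> x * (- \<mu> x * exp (- m x)))"
    using ac_deriv_mult[OF d\<Phi> de] .
  have m0: "0 \<le> m t" if "t \<in> {0..1}" for t
    unfolding m_def using that \<mu> by (intro integral_nonneg) (auto intro: L1_01_on)
  have "\<Phi> x * exp (- m x) = \<Phi> 0 * exp (- m 0) + integral {0..x} (\<lambda>x. \<mu> x * \<rho> x * exp (- m x) + \<Phi> x * (- \<mu> x * exp (- m x)))"
    using dp x by (rule ac_deriv_integral_eq)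
  also have "\<Phi> 0 * exp (- m 0) = 0" by (simp add: \<Phi>_def)
  also have "0 + integral {0..x} (\<lambda>x. \<mu> x * \<rho> x * exp (- m x) + \<Phi> x * (- \<mu> x * exp (- m x))) \<le> integral {0..x} (\<lambda>t. \<mu> t * f t)"
    unfolding add_0
  proof (rule integral_le)
    fix t assume "t \<in> {0..x}"
    with x have t: "t \<in> {0..1}" by auto
    have "\<mu> t * \<rho> t * exp (- m t) + \<Phi> t * (- \<mu> t * exp (- m t)) = \<mu> t * exp (- m t) * (\<rho> t - \<Phi> t)"
      by (simp add: algebra_simps)
    also have "\<dots> \<le> \<mu> t * exp (- m t) * f t"
      using le[OF t] \<mu>(2)[OF t] by (intro mult_left_mono) (auto simp: \<Phi>_def)
    also have "\<dots> \<le> \<mu> t * 1 * f t"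
      using \<mu>(2)[OF t] f(2)[OF t] m0[OF t] by (intro mult_right_mono mult_left_mono) auto
    finally show "\<mu> t * \<rho> t * exp (- m t) + \<Phi> t * (- \<mu> t * exp (- m t)) \<le> \<mu> t * f t" by simp
  qed (use x L1_01_on(2)[OF ac_deriv_integrable[OF dp], of 0 x] L1_01_on(2)[OF \<mu>f, of 0 x] in auto)
  finally have "\<Phi> x * exp (- m x) * exp (m x) \<le> integral {0..x} (\<lambda>t. \<mu> t * f t) * exp (m x)"
    by (rule mult_right_mono) auto
  then have "\<Phi> x \<le> exp (m x) * integral {0..x} (\<lambda>t. \<mu> t * f t)"
    by (simp add: exp_minus mult.assoc) (simp add: mult.commute)
  then show ?thesis using le[OF x] by (simp add: \<Phi>_def m_def)
qed

lemma linear_system_unique: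
  fixes h :: "'a::euclidean_space \<Rightarrow> 'b::euclidean_space \<Rightarrow> 'b"
  assumes h: "bounded_bilinear h" and A: "L1_01 A"
    and Y: "ac_deriv Y (\<lambda>x. h (A x) (Y x))" and Z: "ac_deriv Z (\<lambda>x. h (A x) (Z x))"
    and eq: "Y 0 = Z 0" and x: "x \<in> {0..1}"
  shows "Y x = Z x"
proof -
  interpret bounded_bilinear h by fact
  obtain K where K: "K > 0" "\<And>a b. norm (h a b) \<le> norm a * norm b * K"
    using pos_bounded by blast
  have D: "ac_deriv (\<lambda>x. Y x - Z x) (\<lambda>x. h (A x) (Y x) - h (A x) (Z x))"
    by (rule ac_deriv_sub[OF Y Z])
  have \<mu>: "L1_01 (\<lambda>t. K * norm (A t))"
    by (rule L1_01_scaled_norm[OF A])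
  have Dc: "continuous_on {0..1} (\<lambda>x. norm (Y x - Z x))"
    by (intro continuous_intros ac_deriv_continuous[OF D])
  have "norm (Y x - Z x) \<le> 0 + exp (integral {0..x} (\<lambda>t. K * norm (A t))) * integral {0..x} (\<lambda>t. K * norm (A t) * 0)"
  proof (rule gronwall_01[OF \<mu> _ Dc _ _ _ x])
    fix t :: real assume t: "t \<in> {0..1}"
    have \<mu>D: "L1_01 (\<lambda>t. K * norm (A t) * norm (Y t - Z t))"
      by (rule L1_01_mult_left[OF \<mu> Dc])
    have "Y t - Z t = integral {0..t} (\<lambda>x. h (A x) (Y x) - h (A x) (Z x))"
      using ac_deriv_integral_eq[OF D t] eq by simp
    also have "norm \<dots> \<le> integral {0..t} (\<lambda>t. K * norm (A t) * norm (Y t - Z t))"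
    proof (rule integral_norm_bound_integral)
      fix s show "norm (h (A s) (Y s) - h (A s) (Z s)) \<le> K * norm (A s) * norm (Y s - Z s)"
        using K(2)[of "A s" "Y s - Z s"] by (simp add: diff_right mult_ac)
    qed (use t L1_01_on(2)[OF ac_deriv_integrable[OF D]] L1_01_on(2)[OF \<mu>D] in auto)
    finally show "norm (Y t - Z t) \<le> 0 + integral {0..t} (\<lambda>t. K * norm (A t) * norm (Y t - Z t))" by simp
  qed (use K in auto)
  then show ?thesis by simp
qed

section \<open>Holomorphic dependence on the spectral parameter\<close>

lemma matrix_scaleR_left: "(r *\<^sub>R A) ** B = r *\<^sub>R (A ** B)" for A B :: "complex^2^2"
  by (simp only: matrix_matrix_mult_def vec_eq_iff vec_lambda_beta vector_scaleR_component scaleR_sum_right mult_scaleR_left) simp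
lemma matrix_scaleR_right: "A ** (r *\<^sub>R B) = r *\<^sub>R (A ** B)" for A B :: "complex^2^2"
  by (simp only: matrix_matrix_mult_def vec_eq_iff vec_lambda_beta vector_scaleR_component scaleR_sum_right mult_scaleR_right) simp
lemma matrix_add_left: "(A + B) ** C = A ** C + (B ** C :: complex^2^2)"
  by (simp only: matrix_matrix_mult_def vec_eq_iff vec_lambda_beta vector_add_component sum.distrib distrib_right) simp
lemma bilinear_matrix_mult:
  "bounded_bilinear ((**) :: complex^2^2 \<Rightarrow> complex^2^2 \<Rightarrow> complex^2^2)"
  unfolding bilinear_conv_bounded_bilinear[symmetric] bilinear_def
  by (intro conjI allI linearI matrix_add_ldistrib matrix_add_left matrix_scaleR_left matrix_scaleR_right)

text \<open>Finite sums of products p(l) C(x), up to equality on S and [0,1]. Integration in x stays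
  within this class and acts on the factors C alone, so holomorphy in l is preserved without
  differentiating under an integral sign.\<close>

inductive separable_family :: "complex set \<Rightarrow> (complex \<Rightarrow> real \<Rightarrow> complex) \<Rightarrow> bool" for S where
  prod: "p holomorphic_on S \<Longrightarrow> continuous_on {0..1} C \<Longrightarrow> separable_family S (\<lambda>l x. p l * C x)"
| add: "separable_family S T \<Longrightarrow> separable_family S T' \<Longrightarrow> separable_family S (\<lambda>l x. T l x + T' l x)"
| cong: "separable_family S T \<Longrightarrow> (\<And>l x. l \<in> S \<Longrightarrow> x \<in> {0..1} \<Longrightarrow> T l x = T' l x) \<Longrightarrow> separable_family S T'"

lemma separable_family_holomorphic:
  assumes "separable_family S T" "x \<in> {0..1}"
  shows "(\<lambda>l. T l x) holomorphic_on S"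
  using assms
proof induction
  case (prod p C)
  then show ?case by (intro holomorphic_intros)
next
  case (add T T')
  then show ?case by (intro holomorphic_intros)
next
  case (cong T T')
  show ?case by (rule holomorphic_transform[OF cong.IH[OF cong.prems] cong.hyps(2)[OF _ cong.prems]])
qed

lemma separable_family_continuous:
  assumes "separable_family S T" "l \<in> S"
  shows "continuous_on {0..1} (T l)"
  using assms
proof induction
  case (prod p C)
  then show ?case by (intro continuous_intros)
next
  case (add T T')
  then show ?case by (intro continuous_intros)
next
  case (cong T T')
  show ?case by (rule continuous_on_eq[OF cong.IH[OF cong.prems] cong.hyps(2)[OF cong.prems]])
qed

lemma separable_family_mult:
  assumes "separable_family S T" "p holomorphic_on S"
  shows "separable_family S (\<lambda>l x. p l * T l x)"
  using assms
proof induction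
  case (prod q C)
  then have "separable_family S (\<lambda>l x. (p l * q l) * C x)"
    by (intro separable_family.prod holomorphic_intros) auto
  then show ?case by (simp add: mult.assoc)
next
  case (add T T')
  then show ?case using separable_family.add by (simp add: distrib_left)
next
  case (cong T T')
  from cong.IH[OF cong.prems] show ?case by (rule separable_family.cong) (simp add: cong.hyps)
qed

lemma separable_family_integral:
  assumes "separable_family S T" and q: "L1_01 q"
  shows "separable_family S (\<lambda>l x. integral {0..x} (\<lambda>t. q t * T l t))"
  using assms(1)
proof induction
  case (prod p C)
  have qC: "L1_01 (\<lambda>t. q t * C t)"
    by (rule L1_01_mult_left[OF q prod(2)])
  have "separable_family S (\<lambda>l x. p l * integral {0..x} (\<lambda>t. q t * C t))"
    using prod(1) qC by (intro separable_family.prod indefinite_integral_continuous_1)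
      (auto simp: absolutely_integrable_on_def)
  moreover have "(\<lambda>l x. p l * integral {0..x} (\<lambda>t. q t * C t)) = (\<lambda>l x. integral {0..x} (\<lambda>t. q t * (p l * C t)))"
    by (simp add: mult.left_commute flip: integral_mult_right)
  ultimately show ?case by simp
next
  case (add T T')
  show ?case
  proof (rule separable_family.cong[OF separable_family.add[OF add.IH]])
    fix l x assume lx: "l \<in> S" "x \<in> {0..1::real}"
    have "L1_01 (\<lambda>t. q t * T l t)" "L1_01 (\<lambda>t. q t * T' l t)"
      using add.hyps separable_family_continuous lx(1) by (auto intro!: L1_01_mult_left[OF q])
    then have "(\<lambda>t. q t * T l t) integrable_on {0..x}" "(\<lambda>t. q t * T' l t) integrable_on {0..x}"
      using lx(2) by (auto intro: L1_01_on)
    then show "integral {0..x} (\<lambda>t. q t * T l t) + integral {0..x} (\<lambda>t. q t * T' l t) =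
      integral {0..x} (\<lambda>t. q t * (T l t + T' l t))"
      by (simp add: distrib_left integral_add)
  qed
next
  case (cong T T')
  show ?case
    by (rule separable_family.cong[OF cong.IH]) (use cong.hyps in \<open>auto intro!: integral_cong\<close>)
qed

lemma norm_matrix_le:
  fixes A :: "complex^'n^'m"
  shows "norm A \<le> (\<Sum>i\<in>UNIV. \<Sum>j\<in>UNIV. norm (A $ i $ j))"
proof -
  have le: "norm v \<le> (\<Sum>j\<in>UNIV. norm (v $ j))" for v :: "complex^'n"
    unfolding norm_vec_def by (intro L2_set_le_sum) auto
  have "norm A \<le> (\<Sum>i\<in>UNIV. norm (A $ i))"
    unfolding norm_vec_def[of A] by (intro L2_set_le_sum) auto
  also have "\<dots> \<le> (\<Sum>i\<in>UNIV. \<Sum>j\<in>UNIV. norm (A $ i $ j))"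
    by (intro sum_mono le)
  finally show ?thesis .
qed

lemma matrix_component_integral:
  fixes F :: "real \<Rightarrow> complex^2^2"
  assumes "F integrable_on S"
  shows "integral S F $ i $ j = integral S (\<lambda>t. F t $ i $ j)"
proof -
  have "bounded_linear (\<lambda>M :: complex^2^2. M $ i $ j)"
    by (rule bounded_linear_compose[OF bounded_linear_vec_nth bounded_linear_vec_nth])
  from integral_linear[OF assms this] show ?thesis by (simp add: o_def)
qed

lemma L1_01_matrix:
  fixes A :: "real \<Rightarrow> complex^2^2"
  assumes "\<And>i j. (\<lambda>t. A t $ i $ j) absolutely_integrable_on S"
  shows "A absolutely_integrable_on S"
proof -
  have lin: "bounded_linear (\<lambda>z::complex. axis i (axis j z) :: complex^2^2)" for i j
    by (rule linear_conv_bounded_linear[THEN iffD1])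
      (auto intro!: linearI simp: vec_eq_iff axis_def)
  have "(\<lambda>t. \<Sum>i\<in>UNIV. \<Sum>j\<in>UNIV. axis i (axis j (A t $ i $ j)) :: complex^2^2) absolutely_integrable_on S"
    by (intro absolutely_integrable_sum L1_01_bounded_linear[OF lin] assms finite)
  moreover have "(\<Sum>i\<in>UNIV. \<Sum>j\<in>UNIV. axis i (axis j (A t $ i $ j))) = A t" for t
  proof -
    have "(\<Sum>i\<in>UNIV. \<Sum>j\<in>UNIV. axis i (axis j (A t $ i $ j)) :: complex^2^2) $ k $ l = A t $ k $ l" for k l
      using exhaust_2[of k] exhaust_2[of l] by (auto simp: axis_def sum_2)
    then show ?thesis by (simp add: vec_eq_iff)
  qed
  ultimately show ?thesis by simp
qed

text \<open>The coefficient is a Laurent polynomial in \<open>l\<close> with entries integrable in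
  t, so one integration step brings in only the holomorphic factors 1, l and 1/l.\<close>

lemma picard_separable:
  fixes A :: "complex \<Rightarrow> real \<Rightarrow> complex^2^2" and Y :: "complex^2^2"
  assumes A: "\<And>l t i j. A l t $ i $ j = p i j t + l * q i j t + inverse l * r i j t"
    and p: "\<And>i j. L1_01 (p i j)"
    and q: "\<And>i j. L1_01 (q i j)"
    and r: "\<And>i j. L1_01 (r i j)"
  shows "separable_family (- {0}) (\<lambda>l x. picard (**) (A l) Y n x $ i $ j)"
proof (induction n arbitrary: i j)
  case 0
  have "separable_family (- {0}) (\<lambda>l x. 1 * Y $ i $ j)"
    by (intro separable_family.prod) auto
  then show ?case by simp
next
  case (Suc n)
  have Ai: "L1_01 (A l)" for l
  proof (rule L1_01_matrix)
    fix i j show "L1_01 (\<lambda>t. A l t $ i $ j)"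
      unfolding A by (intro set_integral_add set_integrable_mult_right p q r)
  qed
  let ?P = "\<lambda>l x. picard (**) (A l) Y n x"
  let ?I = "\<lambda>q l x k. integral {0..x} (\<lambda>t. q i k t * ?P l t $ k $ j)"
  have s: "separable_family (- {0}) (\<lambda>l x. ?I p l x k + l * ?I q l x k + inverse l * ?I r l x k)" for k
    by (intro separable_family.add separable_family_mult separable_family_integral Suc.IH p q r holomorphic_intros) auto
  show ?case
  proof (rule separable_family.cong[OF separable_family.add[OF s[of 1] s[of 2]]])
    fix l :: complex and x :: real assume l: "l \<in> - {0}" and x: "x \<in> {0..1}"
    have int: "(\<lambda>t. q i k t * ?P l t $ k $ j) integrable_on {0..x}" if "\<And>i j. L1_01 (q i j)" for q k
    proof -
      have "L1_01 (\<lambda>t. q i k t * ?P l t $ k $ j)"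
        by (intro L1_01_mult_left that separable_family_continuous[OF Suc.IH l])
      then show ?thesis using x by (intro L1_01_on(2)) auto
    qed
    have k: "integral {0..x} (\<lambda>t. A l t $ i $ k * ?P l t $ k $ j) = ?I p l x k + l * ?I q l x k + inverse l * ?I r l x k"
      "(\<lambda>t. A l t $ i $ k * ?P l t $ k $ j) integrable_on {0..x}" for k
    proof -
      have *: "(\<lambda>t. A l t $ i $ k * ?P l t $ k $ j) = (\<lambda>t. p i k t * ?P l t $ k $ j
          + l * (q i k t * ?P l t $ k $ j) + inverse l * (r i k t * ?P l t $ k $ j))"
        unfolding A by (simp add: algebra_simps)
      show "integral {0..x} (\<lambda>t. A l t $ i $ k * ?P l t $ k $ j) = ?I p l x k + l * ?I q l x k + inverse l * ?I r l x k"
        unfolding *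
        by (simp only: integral_add
            integrable_add integrable_on_mult_right int p q r
            integral_mult_right)
      show "(\<lambda>t. A l t $ i $ k * ?P l t $ k $ j) integrable_on {0..x}"
        unfolding * using int[where q = p and k = k, OF p] int[where q = q and k = k, OF q] int[where q = r and k = k, OF r]
        by (intro integrable_add integrable_on_mult_right)
    qed
    have "(\<lambda>t. A l t ** ?P l t) integrable_on {0..x}"
      using picard_integrable[OF bilinear_matrix_mult Ai] x by (intro L1_01_on(2)) auto
    from matrix_component_integral[OF this]
    have "picard (**) (A l) Y (Suc n) x $ i $ j =
      integral {0..x} (\<lambda>t. A l t $ i $ 1 * ?P l t $ 1 $ j + A l t $ i $ 2 * ?P l t $ 2 $ j)"
      by (simp add: matrix_matrix_mult_def sum_2)
    also have "\<dots> = integral {0..x} (\<lambda>t. A l t $ i $ 1 * ?P l t $ 1 $ j) + integral {0..x} (\<lambda>t. A l t $ i $ 2 * ?P l t $ 2 $ j)"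
      by (intro integral_add k)
    finally show "?I p l x 1 + l * ?I q l x 1 + inverse l * ?I r l x 1
       + (?I p l x 2 + l * ?I q l x 2 + inverse l * ?I r l x 2) = picard (**) (A l) Y (Suc n) x $ i $ j"
      unfolding k by simp
  qed
qed

text \<open>The factorial bound of \<open>norm_picard_le\<close> is uniform on small closed discs
  avoiding 0, and a locally uniform limit of holomorphic partial sums is holomorphic.\<close>

lemma picard_holomorphic:
  fixes A :: "complex \<Rightarrow> real \<Rightarrow> complex^2^2" and Y :: "complex^2^2"
  assumes A: "\<And>l t i j. A l t $ i $ j = p i j t + l * q i j t + inverse l * r i j t"
    and p: "\<And>i j. L1_01 (p i j)"
    and q: "\<And>i j. L1_01 (q i j)"
    and r: "\<And>i j. L1_01 (r i j)"
  shows "(\<lambda>l. (\<Sum>n. picard (**) (A l) Y n 1) $ i $ j) holomorphic_on - {0}"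
proof (rule holomorphic_uniform_sequence)
  let ?P = "\<lambda>l n. picard (**) (A l) Y n 1"
  show "open (- {0::complex})" by auto
  show "(\<lambda>l. \<Sum>n<N. ?P l n $ i $ j) holomorphic_on - {0}" for N
    by (rule holomorphic_on_sum, rule separable_family_holomorphic[OF picard_separable[OF A p q r]]) auto
  have Ai: "L1_01 (A l)" for l
  proof (rule L1_01_matrix)
    fix i j show "L1_01 (\<lambda>t. A l t $ i $ j)"
      unfolding A by (intro set_integral_add set_integrable_mult_right p q r)
  qed
  obtain K where K: "K > 0" "\<And>(a :: complex^2^2) (b :: complex^2^2). norm (a ** b) \<le> norm a * norm b * K"
    using bounded_bilinear.pos_bounded[OF bilinear_matrix_mult] by blast
  fix z :: complex assume "z \<in> - {0}"
  then have z: "z \<noteq> 0" by simp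
  \<comment> \<open>On the closed disc of this radius, |l| \<le> 2 |z| and |1/l| \<le> 2 / |z|, so
    the function \<open>w\<close> defined next dominates \<open>norm (A l t)\<close> for every
    \<open>l\<close> in it.\<close>
  define d where "d = norm z / 2"
  have d: "d > 0" using z by (simp add: d_def)
  define w where "w t = (\<Sum>i\<in>UNIV. \<Sum>j\<in>UNIV. norm (p i j t) + 2 * norm z * norm (q i j t) + 2 / norm z * norm (r i j t))" for t
  have wi: "w integrable_on {0..1}"
    using p q r unfolding w_def absolutely_integrable_on_def
    by (intro integrable_sum integrable_add integrable_on_mult_right finite) auto
  have l: "norm l \<le> 2 * norm z" "norm (inverse l) \<le> 2 / norm z" "l \<noteq> 0" if "l \<in> cball z d" for l
  proof -
    have "norm (z - l) \<le> norm z / 2" using that by (simp add: dist_norm d_def)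
    moreover have "norm z \<le> norm (z - l) + norm l" "norm l \<le> norm (z - l) + norm z"
      using norm_triangle_ineq[of "z - l" l] norm_triangle_ineq4[of z "z - l"] by auto
    ultimately have *: "norm l \<le> 2 * norm z" "norm l \<ge> norm z / 2" by auto
    then show "norm l \<le> 2 * norm z" by simp
    show "l \<noteq> 0" using * z by auto
    then show "norm (inverse l) \<le> 2 / norm z"
    proof -
      have "inverse (norm l) \<le> inverse (norm z / 2)"
        using * z by (intro le_imp_inverse_le) auto
      then show ?thesis by (simp add: norm_inverse)
    qed
  qed
  define B where "B = K * integral {0..1} w"
  have "uniform_limit (cball z d) (\<lambda>N l. \<Sum>n<N. ?P l n $ i $ j) (\<lambda>l. \<Sum>n. ?P l n $ i $ j) sequentially"
  proof (rule Weierstrass_m_test)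
    fix n l assume lz: "l \<in> cball z d"
    have "integral {0..1} (\<lambda>t. norm (A l t)) \<le> integral {0..1} w"
    proof (rule integral_le)
      show "(\<lambda>t. norm (A l t)) integrable_on {0..1}" using Ai by (auto simp: absolutely_integrable_on_def)
      fix t :: real
      have "norm (A l t $ i $ j) \<le> norm (p i j t) + 2 * norm z * norm (q i j t) + 2 / norm z * norm (r i j t)" for i j
        unfolding A
        by (intro order_trans[OF norm_triangle_ineq] add_mono order_refl) (auto simp only: norm_mult norm_ge_zero intro!: mult_right_mono l[OF lz])
      then show "norm (A l t) \<le> w t"
        unfolding w_def by (intro order_trans[OF norm_matrix_le] sum_mono)
    qed (rule wi)
    moreover have "0 \<le> integral {0..1} (\<lambda>t. norm (A l t))"
      by (rule integral_nonneg) (use Ai in \<open>auto simp: absolutely_integrable_on_def\<close>)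
    ultimately have "norm Y * (K * integral {0..1} (\<lambda>t. norm (A l t))) ^ n / fact n \<le> norm Y * B ^ n / fact n"
      unfolding B_def using K by (intro divide_right_mono mult_left_mono power_mono) auto
    moreover have "norm (?P l n) \<le> norm Y * (K * integral {0..1} (\<lambda>t. norm (A l t))) ^ n / fact n"
      using K by (intro norm_picard_le[OF bilinear_matrix_mult Ai]) auto
    moreover have "norm (?P l n $ i $ j) \<le> norm (?P l n)"
      by (rule order_trans[OF Finite_Cartesian_Product.norm_nth_le Finite_Cartesian_Product.norm_nth_le])
    ultimately show "norm (?P l n $ i $ j) \<le> norm Y * B ^ n / fact n" by linarith
  next
    show "summable (\<lambda>n. norm Y * B ^ n / fact n)"
      using summable_mult[OF summable_exp[of B], of "norm Y"] by (simp add: field_simps)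
  qed
  moreover have "(\<Sum>n. ?P l n $ i $ j) = (\<Sum>n. ?P l n) $ i $ j" for l
  proof -
    have "(\<lambda>N. \<Sum>n<N. ?P l n) \<longlonglongrightarrow> (\<Sum>n. ?P l n)"
      using picard_uniform_limit[OF bilinear_matrix_mult Ai[of l], of Y]
      by (rule tendsto_uniform_limitI) simp
    then have "(\<lambda>N. (\<Sum>n<N. ?P l n) $ i $ j) \<longlonglongrightarrow> (\<Sum>n. ?P l n) $ i $ j"
      by (intro tendsto_vec_nth)
    then have "(\<lambda>n. ?P l n $ i $ j) sums ((\<Sum>n. ?P l n) $ i $ j)"
      by (simp add: sums_def sum_component)
    then show ?thesis by (rule sums_unique[symmetric])
  qed
  ultimately have "uniform_limit (cball z d) (\<lambda>N l. \<Sum>n<N. ?P l n $ i $ j) (\<lambda>l. (\<Sum>n. ?P l n) $ i $ j) sequentially"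
    by simp
  moreover have "cball z d \<subseteq> - {0}" using l(3) by blast
  ultimately show "\<exists>d>0. cball z d \<subseteq> - {0} \<and>
    uniform_limit (cball z d) (\<lambda>N l. \<Sum>n<N. ?P l n $ i $ j) (\<lambda>l. (\<Sum>n. ?P l n) $ i $ j) sequentially"
    using d by blast
qed

subsection \<open>Frames and the monodromy\<close>

lemma L2_01_integrable:
  assumes "f \<in> L2_01"
  shows "L1_01 f" "(\<lambda>x. (cmod (f x))\<^sup>2) integrable_on {0..1}"
proof -
  show 2: "(\<lambda>x. (cmod (f x))\<^sup>2) integrable_on {0..1}"
    using assms by (intro integrable_on_lebesgue_on) (auto simp: L2_01_def)
  show "L1_01 f"
  proof (rule measurable_bounded_by_integrable_imp_absolutely_integrable)
    show "(\<lambda>x. 1 + (cmod (f x))\<^sup>2) integrable_on {0..1}"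
      by (intro integrable_add 2) auto
    fix x
    have "0 \<le> (cmod (f x) - 1)\<^sup>2" by simp
    then have "2 * cmod (f x) \<le> 1 + (cmod (f x))\<^sup>2" by (simp add: power2_eq_square algebra_simps)
    then show "cmod (f x) \<le> 1 + (cmod (f x))\<^sup>2" using norm_ge_zero[of "f x"] by linarith
  qed (use assms in \<open>auto simp: L2_01_def\<close>)
qed

lemma PotE:
  assumes "(u, uy) \<in> Pot"
  obtains u' where "ac_deriv u u'" "u' \<in> L2_01" "uy \<in> L2_01" "u 1 = u 0"
  using assms by (auto simp: Pot_def W12_01_def weak_deriv_iff_ac_deriv)

lemma alpha_components:
  "alpha u uy l x $ 1 $ 1 = \<i> * uy x / 4"
  "alpha u uy l x $ 1 $ 2 = - (exp (u x / 2) + inverse l * exp (- u x / 2)) / 4"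
  "alpha u uy l x $ 2 $ 1 = (exp (u x / 2) + l * exp (- u x / 2)) / 4"
  "alpha u uy l x $ 2 $ 2 = - \<i> * uy x / 4"
  unfolding alpha_def vector_scaleR_component vector_2 by (simp_all add: scaleR_conv_of_real field_simps)

lemma alpha_decomposition:
  assumes u: "continuous_on {0..1} u" and uy: "L1_01 uy"
  obtains p q r :: "2 \<Rightarrow> 2 \<Rightarrow> real \<Rightarrow> complex" where
    "\<And>l t i j. alpha u uy l t $ i $ j = p i j t + l * q i j t + inverse l * r i j t"
    "\<And>i j. L1_01 (p i j)"
    "\<And>i j. L1_01 (q i j)"
    "\<And>i j. L1_01 (r i j)"
proof
  define p :: "2 \<Rightarrow> 2 \<Rightarrow> real \<Rightarrow> complex" where
    "p i j t = (if i = 1 then if j = 1 then \<i> / 4 * uy t else - exp (u t / 2) / 4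
      else if j = 1 then exp (u t / 2) / 4 else - \<i> / 4 * uy t)" for i j t
  define q :: "2 \<Rightarrow> 2 \<Rightarrow> real \<Rightarrow> complex" where
    "q i j t = (if i = 2 \<and> j = 1 then exp (- u t / 2) / 4 else 0)" for i j t
  define r :: "2 \<Rightarrow> 2 \<Rightarrow> real \<Rightarrow> complex" where
    "r i j t = (if i = 1 \<and> j = 2 then - exp (- u t / 2) / 4 else 0)" for i j t
  show "alpha u uy l t $ i $ j = p i j t + l * q i j t + inverse l * r i j t" for l t i j
    using exhaust_2[of i] exhaust_2[of j]
    by (auto simp: alpha_components p_def q_def r_def add_divide_distrib)
  have uy': "L1_01 (\<lambda>t. c * uy t)" for c
    by (intro set_integrable_mult_right uy)
  show "L1_01 (p i j)" for i j
  proof (cases "i = j")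
    case True
    then have "p i j = (\<lambda>t. (if i = 1 then \<i> / 4 else - \<i> / 4) * uy t)"
      using exhaust_2[of i] by (auto simp: p_def)
    then show ?thesis using uy' by simp
  next
    case False
    then show ?thesis
      using exhaust_2[of i] exhaust_2[of j] u unfolding p_def
      by (auto intro!: absolutely_integrable_continuous_real continuous_intros)
  qed
  show "L1_01 (q i j)" for i j
    by (cases "i = 2 \<and> j = 1")
      (use u in \<open>auto simp: q_def[abs_def] intro!: absolutely_integrable_continuous_real continuous_intros\<close>)
  show "L1_01 (r i j)" for i j
    by (cases "i = 1 \<and> j = 2")
      (use u in \<open>auto simp: r_def[abs_def] intro!: absolutely_integrable_continuous_real continuous_intros\<close>)
qed

lemma alpha_integrable:
  assumes u: "continuous_on {0..1} u" and uy: "L1_01 uy"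
  shows "L1_01 (alpha u uy l)"
proof -
  obtain p q r where A: "\<And>l t i j. alpha u uy l t $ i $ j = p i j t + l * q i j t + inverse l * r i j t"
    and p: "\<And>i j. L1_01 (p i j)"
    and q: "\<And>i j. L1_01 (q i j)"
    and r: "\<And>i j. L1_01 (r i j)"
    using alpha_decomposition[OF u uy] by blast
  show ?thesis
  proof (rule L1_01_matrix)
    fix i j show "L1_01 (\<lambda>t. alpha u uy l t $ i $ j)"
      unfolding A by (intro set_integral_add set_integrable_mult_right p q r)
  qed
qed

lemma is_frame_iff:
  "is_frame u uy l F \<longleftrightarrow> F 0 = mat 1 \<and> ac_deriv F (\<lambda>x. alpha u uy l x ** F x)"
  unfolding is_frame_def using weak_deriv_iff_ac_deriv ac_deriv_continuous by blast

text \<open>Uniqueness of frames makes the definite description meaningful; after this, any frame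
  found by hand computes the monodromy.\<close>

lemma monodromy_eqI:
  assumes u: "continuous_on {0..1} u" and uy: "L1_01 uy"
    and F: "is_frame u uy l F"
  shows "monodromy u uy l = F 1"
  unfolding monodromy_def
proof (rule the_equality)
  show "\<exists>G. is_frame u uy l G \<and> F 1 = G 1" using F by blast
  fix M assume "\<exists>G. is_frame u uy l G \<and> M = G 1"
  then obtain G where G: "is_frame u uy l G" "M = G 1" by blast
  have "G 1 = F 1"
  proof (rule linear_system_unique[OF bilinear_matrix_mult alpha_integrable[OF u uy]])
    show "ac_deriv G (\<lambda>x. alpha u uy l x ** G x)" "ac_deriv F (\<lambda>x. alpha u uy l x ** F x)" "G 0 = F 0"
      using F G(1) unfolding is_frame_iff by simp_all
  qed simp
  then show "M = F 1" using G by simp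
qed

lemma is_frame_picard:
  assumes u: "continuous_on {0..1} u" and uy: "L1_01 uy"
  shows "is_frame u uy l (\<lambda>x. \<Sum>n. picard (**) (alpha u uy l) (mat 1) n x)"
  unfolding is_frame_iff
  by (intro conjI picard_solution[OF bilinear_matrix_mult alpha_integrable[OF u uy]])

lemma monodromy_holomorphic:
  assumes u: "continuous_on {0..1} u" and uy: "L1_01 uy"
  shows "(\<lambda>l. monodromy u uy l $ i $ j) holomorphic_on - {0}"
proof -
  obtain p q r where A: "\<And>l t i j. alpha u uy l t $ i $ j = p i j t + l * q i j t + inverse l * r i j t"
    and p: "\<And>i j. L1_01 (p i j)"
    and q: "\<And>i j. L1_01 (q i j)"
    and r: "\<And>i j. L1_01 (r i j)"
    using alpha_decomposition[OF u uy] by blast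
  have "monodromy u uy l = (\<Sum>n. picard (**) (alpha u uy l) (mat 1) n 1)" for l
    by (rule monodromy_eqI[OF u uy is_frame_picard[OF u uy]])
  then show ?thesis
    using picard_holomorphic[of "alpha u uy", OF A p q r] by simp
qed

lemma ac_deriv_matrix_component:
  assumes "ac_deriv F (\<lambda>x. A x ** (F x :: complex^2^2))"
  shows "ac_deriv (\<lambda>x. F x $ i $ j) (\<lambda>x. A x $ i $ 1 * F x $ 1 $ j + A x $ i $ 2 * F x $ 2 $ j)"
proof -
  have "bounded_linear (\<lambda>M :: complex^2^2. M $ i $ j)"
    by (rule bounded_linear_compose[OF bounded_linear_vec_nth bounded_linear_vec_nth])
  from ac_deriv_linear[OF assms this] show ?thesis
    by (simp add: matrix_matrix_mult_def sum_2)
qed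

lemma ac_deriv_matrixI:
  fixes F F' :: "real \<Rightarrow> complex^2^2"
  assumes "\<And>i j. ac_deriv (\<lambda>x. F x $ i $ j) (\<lambda>x. F' x $ i $ j)"
  shows "ac_deriv F F'"
proof (rule ac_derivI)
  show F': "L1_01 F'"
    by (intro L1_01_matrix ac_deriv_integrable[OF assms])
  fix x :: real assume x: "x \<in> {0..1}"
  have "F' integrable_on {0..x}" using F' x by (intro L1_01_on(2)) auto
  then have "F x $ i $ j = (F 0 + integral {0..x} F') $ i $ j" for i j
    using ac_deriv_integral_eq[OF assms x, of i j] by (simp add: matrix_component_integral)
  then show "F x = F 0 + integral {0..x} F'" by (simp add: vec_eq_iff)
qed

text \<open>The substitution \<open>u \<mapsto> -u\<close>, \<open>\<lambda> \<mapsto> \<lambda>\<^sup>-\<^sup>1\<close> conjugates the connection by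
  \<open>diag(\<lambda>\<^sup>1\<^sup>/\<^sup>2, \<lambda>\<^sup>-\<^sup>1\<^sup>/\<^sup>2)\<close>; this exchanges the two ends of the punctured plane.\<close>
lemma monodromy_inverse:
  assumes u: "continuous_on {0..1} u" and uy: "L1_01 uy" and l: "l \<noteq> 0"
  shows "monodromy (\<lambda>x. - u x) uy (inverse l) $ 1 $ 1 = monodromy u uy l $ 1 $ 1"
    "monodromy (\<lambda>x. - u x) uy (inverse l) $ 1 $ 2 = l * monodromy u uy l $ 1 $ 2"
    "monodromy (\<lambda>x. - u x) uy (inverse l) $ 2 $ 1 = inverse l * monodromy u uy l $ 2 $ 1"
    "monodromy (\<lambda>x. - u x) uy (inverse l) $ 2 $ 2 = monodromy u uy l $ 2 $ 2"
proof -
  define F where "F = (\<lambda>x. \<Sum>n. picard (**) (alpha u uy l) (mat 1) n x)"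
  have F: "is_frame u uy l F" unfolding F_def by (rule is_frame_picard[OF u uy])
  define G :: "real \<Rightarrow> complex^2^2" where
    "G x = vector [vector [F x $ 1 $ 1, l * F x $ 1 $ 2], vector [inverse l * F x $ 2 $ 1, F x $ 2 $ 2]]" for x
  have G: "G x $ 1 $ 1 = F x $ 1 $ 1" "G x $ 1 $ 2 = l * F x $ 1 $ 2"
    "G x $ 2 $ 1 = inverse l * F x $ 2 $ 1" "G x $ 2 $ 2 = F x $ 2 $ 2" for x
    by (simp_all add: G_def)
  note c = ac_deriv_matrix_component[OF conjunct2[OF F[unfolded is_frame_iff]]]
  let ?A = "alpha (\<lambda>x. - u x) uy (inverse l)"
  have "ac_deriv G (\<lambda>x. ?A x ** G x)"
  proof (rule ac_deriv_matrixI)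
    have *: "(?A x ** G x) $ i $ j = ?A x $ i $ 1 * G x $ 1 $ j + ?A x $ i $ 2 * G x $ 2 $ j" for x i j
      by (simp add: matrix_matrix_mult_def sum_2)
    have 11: "ac_deriv (\<lambda>x. G x $ 1 $ 1) (\<lambda>x. (?A x ** G x) $ 1 $ 1)"
      by (rule ac_deriv_cong[OF c[of 1 1]]) (use l in \<open>simp_all only: * G alpha_components inverse_inverse_eq, simp_all add: field_simps\<close>)
    have 12: "ac_deriv (\<lambda>x. G x $ 1 $ 2) (\<lambda>x. (?A x ** G x) $ 1 $ 2)"
      by (rule ac_deriv_cong[OF ac_deriv_linear[OF c[of 1 2] bounded_linear_mult_right[of l]]])
        (use l in \<open>simp_all only: * G alpha_components inverse_inverse_eq, simp_all add: field_simps\<close>)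
    have 21: "ac_deriv (\<lambda>x. G x $ 2 $ 1) (\<lambda>x. (?A x ** G x) $ 2 $ 1)"
      by (rule ac_deriv_cong[OF ac_deriv_linear[OF c[of 2 1] bounded_linear_mult_right[of "inverse l"]]])
        (use l in \<open>simp_all only: * G alpha_components inverse_inverse_eq, simp_all add: field_simps\<close>)
    have 22: "ac_deriv (\<lambda>x. G x $ 2 $ 2) (\<lambda>x. (?A x ** G x) $ 2 $ 2)"
      by (rule ac_deriv_cong[OF c[of 2 2]]) (use l in \<open>simp_all only: * G alpha_components inverse_inverse_eq, simp_all add: field_simps\<close>)
    fix i j :: 2
    show "ac_deriv (\<lambda>x. G x $ i $ j) (\<lambda>x. (?A x ** G x) $ i $ j)"
      using 11 12 21 22 exhaust_2[of i] exhaust_2[of j] by auto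
  qed
  moreover have "G 0 = mat 1"
    using F by (simp add: is_frame_iff vec_eq_iff forall_2 G mat_def)
  ultimately have "is_frame (\<lambda>x. - u x) uy (inverse l) G" by (simp add: is_frame_iff)
  then have "monodromy (\<lambda>x. - u x) uy (inverse l) = G 1"
    by (intro monodromy_eqI uy continuous_intros u)
  moreover have "monodromy u uy l = F 1" by (rule monodromy_eqI[OF u uy F])
  ultimately show "monodromy (\<lambda>x. - u x) uy (inverse l) $ 1 $ 1 = monodromy u uy l $ 1 $ 1"
    "monodromy (\<lambda>x. - u x) uy (inverse l) $ 1 $ 2 = l * monodromy u uy l $ 1 $ 2"
    "monodromy (\<lambda>x. - u x) uy (inverse l) $ 2 $ 1 = inverse l * monodromy u uy l $ 2 $ 1"
    "monodromy (\<lambda>x. - u x) uy (inverse l) $ 2 $ 2 = monodromy u uy l $ 2 $ 2"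
    by (simp_all add: G)
qed

subsection \<open>Asymptotics of the diagonalised system\<close>

lemma norm_integral_01_le:
  fixes f :: "real \<Rightarrow> 'a::euclidean_space"
  assumes "L1_01 f" "L1_01 g" "x \<in> {0..1}"
    and "\<And>t. t \<in> {0..x} \<Longrightarrow> norm (f t) \<le> g t"
  shows "norm (integral {0..x} f) \<le> integral {0..x} g"
  using assms L1_01_on(2)[OF assms(1), of 0 x] L1_01_on(2)[OF assms(2), of 0 x]
  by (intro integral_norm_bound_integral) auto

text \<open>The integral of (p - s f)^2 is a quadratic polynomial in \<open>s\<close> that is
  nowhere negative; it is evaluated at its minimum s = I / F.\<close>

lemma integral_Cauchy_Schwarz_01:
  fixes p f :: "real \<Rightarrow> real"
  assumes p: "(\<lambda>t. (p t)\<^sup>2) integrable_on {0..1}" and f: "(\<lambda>t. (f t)\<^sup>2) integrable_on {0..1}"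
    and pf: "(\<lambda>t. p t * f t) integrable_on {0..1}"
  shows "(integral {0..1} (\<lambda>t. p t * f t))\<^sup>2 \<le> integral {0..1} (\<lambda>t. (p t)\<^sup>2) * integral {0..1} (\<lambda>t. (f t)\<^sup>2)"
proof -
  define P I F where "P = integral {0..1} (\<lambda>t. (p t)\<^sup>2)" and "I = integral {0..1} (\<lambda>t. p t * f t)"
    and "F = integral {0..1} (\<lambda>t. (f t)\<^sup>2)"
  have q: "0 \<le> P - 2 * s * I + s\<^sup>2 * F" for s
  proof -
    have i: "((\<lambda>t. (p t)\<^sup>2 - 2 * s * (p t * f t) + s\<^sup>2 * (f t)\<^sup>2) has_integral P - 2 * s * I + s\<^sup>2 * F) {0..1}"
      unfolding P_def I_def F_def
      by (intro has_integral_add has_integral_diff has_integral_mult_right integrable_integral p f pf)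
    show ?thesis
    proof (rule has_integral_nonneg[OF i])
      fix t have "(p t)\<^sup>2 - 2 * s * (p t * f t) + s\<^sup>2 * (f t)\<^sup>2 = (p t - s * f t)\<^sup>2"
        by (simp add: power2_eq_square algebra_simps)
      then show "0 \<le> (p t)\<^sup>2 - 2 * s * (p t * f t) + s\<^sup>2 * (f t)\<^sup>2" by simp
    qed
  qed
  have F0: "F \<ge> 0" unfolding F_def by (rule integral_nonneg[OF f]) simp
  have "I\<^sup>2 \<le> P * F"
  proof (cases "F = 0")
    case True
    have "I = 0"
    proof (rule ccontr)
      assume "I \<noteq> 0"
      \<comment> \<open>With F = 0 the polynomial reduces to P - 2 s I, which equals -1 at this
        \<open>s\<close>.\<close>
      then show False using q[of "(P + 1) / (2 * I)"] True by (simp add: field_simps)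
    qed
    then show ?thesis using True by simp
  next
    case False
    then have "0 \<le> (P - 2 * (I / F) * I + (I / F)\<^sup>2 * F) * F"
      using q[of "I / F"] F0 by (intro mult_nonneg_nonneg) auto
    also have "\<dots> = P * F - I\<^sup>2" using False by (simp add: field_simps power2_eq_square)
    finally show ?thesis by simp
  qed
  then show ?thesis by (simp add: P_def I_def F_def)
qed

lemma ac_deriv_exp_linear: "ac_deriv (\<lambda>x. exp (c * complex_of_real x)) (\<lambda>x. c * exp (c * complex_of_real x))"
  by (rule ac_deriv_exp[OF ac_deriv_of_real])

text \<open>The remainder of the diagonalised system after one step of the Picard iteration; the
  remaining steps enter through the Gronwall factor in \<open>total_error\<close>.\<close>
definition picard_error :: "(real \<Rightarrow> complex) \<Rightarrow> real \<Rightarrow> complex \<Rightarrow> complex \<Rightarrow> real \<Rightarrow> real" where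
  "picard_error q c z e x =
     norm (integral {0..x} (\<lambda>t. exp (- 2 * \<i> * z * of_real t) * q t)) +
     norm (integral {0..x} (\<lambda>t. exp (- 2 * \<i> * z * of_real (x - t)) * q t)) + c * norm e"

text \<open>The right-hand side of \<open>gronwall_01\<close> at 1, with inhomogeneity
  \<open>picard_error\<close> and coefficient |q| + 2C. Each of the two components contributes C to
  the coefficient and 2C |e| to the inhomogeneity, hence 2C and 4C.\<close>

definition total_error :: "(real \<Rightarrow> complex) \<Rightarrow> real \<Rightarrow> complex \<Rightarrow> complex \<Rightarrow> real" where
  "total_error q C z e = picard_error q (4 * C) z e 1 +
     exp (integral {0..1} (\<lambda>t. norm (q t) + 2 * C)) *
     integral {0..1} (\<lambda>t. (norm (q t) + 2 * C) * picard_error q (4 * C) z e t)"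

lemma picard_error_continuous:
  assumes q: "L1_01 q"
  shows "continuous_on {0..1} (picard_error q c z e)"
proof -
  have eq: "exp (- 2 * \<i> * z * complex_of_real (x - t)) =
     exp (- 2 * \<i> * z * of_real x) * exp (2 * \<i> * z * of_real t)" for x t
    unfolding exp_add[symmetric] by (rule arg_cong[of _ _ exp]) (simp add: algebra_simps)
  have e: "continuous_on A (\<lambda>t. exp (w * complex_of_real t))" for A w by (intro continuous_intros)
  have i: "continuous_on {0..1} (\<lambda>x. integral {0..x} (\<lambda>t. exp (w * of_real t) * q t))" for w
    using L1_01_mult_right[OF q e]
    by (intro indefinite_integral_continuous_1) (auto simp: absolutely_integrable_on_def)
  show ?thesis
    unfolding picard_error_def eq mult.assoc[of "exp (- 2 * \<i> * z * complex_of_real _)"]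
      integral_mult_right
    by (intro continuous_intros e i)
qed

text \<open>\<open>Yp\<close> and \<open>Ym\<close> are the components along the eigenvectors of the vacuum connection; after
  division by the dominant exponential \<open>exp (\<i> z x)\<close> both stay bounded.\<close>
lemma diagonal_system_estimate:
  fixes q A B Yp Ym :: "real \<Rightarrow> complex" and z e \<sigma> :: complex and C :: real
  assumes q: "L1_01 q"
    and A: "continuous_on {0..1} A" "\<And>x. x \<in> {0..1} \<Longrightarrow> norm (A x) \<le> C"
    and B: "continuous_on {0..1} B" "\<And>x. x \<in> {0..1} \<Longrightarrow> norm (B x) \<le> C"
    and e: "norm e \<le> 1" and z: "Im z \<le> 0" and \<sigma>: "norm \<sigma> = 1"
    and Yp: "ac_deriv Yp (\<lambda>x. \<i> * z * Yp x + q x * Ym x + e * (A x * Yp x + B x * Ym x))"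
    and Ym: "ac_deriv Ym (\<lambda>x. - (\<i> * z) * Ym x + q x * Yp x - e * (A x * Ym x + B x * Yp x))"
    and init: "Yp 0 = 1" "Ym 0 = \<sigma>"
  shows "norm (Yp 1 - exp (\<i> * z)) + norm (Ym 1 - \<sigma> * exp (- (\<i> * z)))
      \<le> exp (- Im z) * total_error q C z e"
proof -
  define f where "f = picard_error q (4 * C) z e"
  have C0: "0 \<le> C" using order_trans[OF norm_ge_zero A(2), of 0] by simp
  have nq: "L1_01 (\<lambda>t. norm (q t))"
    using q by (auto simp: absolutely_integrable_on_def)
  define E where "E x = exp (- (\<i> * z) * complex_of_real x)" for x
  define E' where "E' x = exp ((\<i> * z) * complex_of_real x)" for x
  have dE: "ac_deriv E (\<lambda>x. - (\<i> * z) * E x)" and dE': "ac_deriv E' (\<lambda>x. \<i> * z * E' x)"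
    unfolding E_def E'_def by (rule ac_deriv_exp_linear)+
  have EE: "E x * E' x = 1" for x by (simp add: E_def E'_def exp_add[symmetric])
  define w1 where "w1 x = Yp x * E x" for x
  define w2 where "w2 x = Ym x * E x" for x
  define D where "D x = A x * w1 x + B x * w2 x" for x
  define D' where "D' x = A x * w2 x + B x * w1 x" for x
  define G where "G x t = exp (- 2 * \<i> * z * complex_of_real (x - t))" for x t
  have w1: "ac_deriv w1 (\<lambda>x. q x * w2 x + e * D x)"
    unfolding w1_def
    by (rule ac_deriv_cong[OF ac_deriv_mult[OF Yp dE]]) (simp_all add: w2_def w1_def D_def algebra_simps)
  \<comment> \<open>Multiplication by \<open>E'\<close> removes the diagonal term of the
    \<open>Ym\<close> equation. Returning to \<open>w2\<close> multiplies by \<open>E\<close> twice,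
    which produces the kernel \<open>G x t\<close>, bounded by 1 for t \<le> x because Im z \<le>
    0.\<close>
  have v: "ac_deriv (\<lambda>x. Ym x * E' x) (\<lambda>x. (E' x * E' x) * (q x * w1 x - e * D' x))"
  proof (rule ac_deriv_cong[OF ac_deriv_mult[OF Ym dE']])
    fix x
    have "E' x * E' x * (q x * w1 x - e * D' x) = (E x * E' x) * E' x * (q x * Yp x - e * (A x * Ym x + B x * Yp x))"
      by (simp add: w1_def w2_def D'_def algebra_simps)
    then show "(- (\<i> * z) * Ym x + q x * Yp x - e * (A x * Ym x + B x * Yp x)) * E' x + Ym x * (\<i> * z * E' x) =
         E' x * E' x * (q x * w1 x - e * D' x)"
      unfolding EE mult_1_left by (simp add: algebra_simps)
  qed simp
  have Yc: "continuous_on {0..1} Yp" "continuous_on {0..1} Ym"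
    using ac_deriv_continuous Yp Ym by auto
  have Ec: "continuous_on X E" "continuous_on X E'" for X
    unfolding E_def E'_def by (intro continuous_intros)+
  have wc: "continuous_on {0..1} w1" "continuous_on {0..1} w2"
    unfolding w1_def w2_def by (intro continuous_intros Yc Ec)+
  have Dc: "continuous_on {0..1} D" "continuous_on {0..1} D'"
    unfolding D_def D'_def by (intro continuous_intros wc A B)+
  have Gc: "continuous_on {0..1} (G x)" for x
    unfolding G_def by (intro continuous_intros)
  have G_EE: "G x t = (E x * E x) * (E' t * E' t)" for x t
    unfolding G_def E_def E'_def exp_add[symmetric] by (rule arg_cong[of _ _ exp]) (simp add: algebra_simps)
  have G1: "norm (G x t) \<le> 1" if "t \<le> x" for x t
    using z that by (simp add: G_def mult_nonpos_nonneg)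
  have w2_eq: "w2 x = \<sigma> * G x 0 + integral {0..x} (\<lambda>t. G x t * (q t * w1 t - e * D' t))" if x: "x \<in> {0..1}" for x
  proof -
    have "w2 x = (Ym x * E' x) * (E x * E x)" using EE[of x] by (simp add: w2_def mult_ac)
    also have "Ym x * E' x = \<sigma> + integral {0..x} (\<lambda>t. (E' t * E' t) * (q t * w1 t - e * D' t))"
      using ac_deriv_integral_eq[OF v x] init by (simp add: E'_def)
    finally have "w2 x = \<sigma> * (E x * E x) + (E x * E x) * integral {0..x} (\<lambda>t. (E' t * E' t) * (q t * w1 t - e * D' t))"
      by (simp add: algebra_simps)
    then show ?thesis
      by (simp only: G_EE mult.assoc integral_mult_right) (simp add: E'_def)
  qed
  have w1_eq: "w1 x = 1 + integral {0..x} (\<lambda>t. q t * w2 t + e * D t)" if x: "x \<in> {0..1}" for x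
    using ac_deriv_integral_eq[OF w1 x] init by (simp add: w1_def E_def)
  \<comment> \<open>The unperturbed solution is \<open>w1 = 1\<close> and
    \<open>w2 = \<sigma> * G x 0\<close>. Inserting it into the two integral equations produces
    \<open>\<sigma> * R\<close> in the first and \<open>Q\<close> in the second.\<close>
  define R where "R x = integral {0..x} (\<lambda>t. G t 0 * q t)" for x
  define Q where "Q x = integral {0..x} (\<lambda>t. G x t * q t)" for x
  have f_eq: "f x = norm (R x) + norm (Q x) + 4 * C * norm e" for x
    by (simp add: f_def picard_error_def R_def Q_def G_def)
  have G0c: "continuous_on {0..1} (\<lambda>t. G t 0)" unfolding G_def by (intro continuous_intros)
  have fc: "continuous_on {0..1} f"
    unfolding f_def by (rule picard_error_continuous[OF q])
  define d1 where "d1 x = w1 x - 1" for x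
  define d2 where "d2 x = w2 x - \<sigma> * G x 0" for x
  let ?\<rho> = "\<lambda>t. norm (d1 t) + norm (d2 t)"
  have dc: "continuous_on {0..1} d1" "continuous_on {0..1} d2"
    unfolding d1_def d2_def by (intro continuous_intros wc G0c)+
  \<comment> \<open>The bound |e| \<le> 1 is spent only on the part proportional to the deviation,
    which joins the Gronwall coefficient. The part from the unperturbed solution keeps its factor
    |e|, which will be square summable over the annuli.\<close>
  have nD: "norm (e * D t) \<le> C * ?\<rho> t + 2 * C * norm e" "norm (e * D' t) \<le> C * ?\<rho> t + 2 * C * norm e"
    if t: "t \<in> {0..1}" for t
  proof -
    have "norm (w1 t) \<le> norm (d1 t) + 1" using norm_triangle_ineq[of "d1 t" 1] by (simp add: d1_def)
    moreover have "norm (w2 t) \<le> norm (d2 t) + norm (\<sigma> * G t 0)"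
      using norm_triangle_ineq[of "d2 t" "\<sigma> * G t 0"] by (simp add: d2_def)
    moreover have "norm (\<sigma> * G t 0) \<le> 1" using G1[of 0 t] t \<sigma> by (simp add: norm_mult)
    ultimately have w: "C * (norm (w1 t) + norm (w2 t)) \<le> C * (?\<rho> t + 2)" using C0 by (intro mult_left_mono) auto
    have eC: "norm (e * X) \<le> C * ?\<rho> t + 2 * C * norm e" if "norm X \<le> C * (norm (w1 t) + norm (w2 t))" for X
    proof -
      have "norm e * norm X \<le> norm e * (C * ?\<rho> t + 2 * C)"
        using that w by (intro mult_left_mono) (auto simp: algebra_simps)
      moreover have "norm e * (C * ?\<rho> t) \<le> 1 * (C * ?\<rho> t)" using e C0 by (intro mult_right_mono) auto
      ultimately show ?thesis by (simp add: norm_mult algebra_simps)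
    qed
    have "norm (D t) \<le> norm (A t) * norm (w1 t) + norm (B t) * norm (w2 t)"
      "norm (D' t) \<le> norm (A t) * norm (w2 t) + norm (B t) * norm (w1 t)"
      unfolding D_def D'_def norm_mult[symmetric] by (rule norm_triangle_ineq)+
    moreover have "norm (A t) * norm (w1 t) \<le> C * norm (w1 t)" "norm (A t) * norm (w2 t) \<le> C * norm (w2 t)"
      "norm (B t) * norm (w1 t) \<le> C * norm (w1 t)" "norm (B t) * norm (w2 t) \<le> C * norm (w2 t)"
      using A(2)[OF t] B(2)[OF t] by (auto intro: mult_right_mono)
    ultimately have "norm (D t) \<le> C * (norm (w1 t) + norm (w2 t))" "norm (D' t) \<le> C * (norm (w1 t) + norm (w2 t))"
      unfolding distrib_left by linarith+
    then show "norm (e * D t) \<le> C * ?\<rho> t + 2 * C * norm e" "norm (e * D' t) \<le> C * ?\<rho> t + 2 * C * norm e"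
      by (auto intro: eC)
  qed
  define c where "c = 2 * C * norm e"
  have c0: "c \<ge> 0" and c4: "4 * C * norm e = 2 * c" unfolding c_def using C0 by simp_all
  let ?\<mu> = "\<lambda>t. norm (q t) + 2 * C"
  have \<mu>: "L1_01 ?\<mu>"
    by (intro set_integral_add nq absolutely_integrable_continuous_real continuous_intros)
  have main: "?\<rho> 1 \<le> f 1 + exp (integral {0..1} ?\<mu>) * integral {0..1} (\<lambda>t. ?\<mu> t * f t)"
  proof (rule gronwall_01[OF \<mu> _ _ fc])
    show "continuous_on {0..1} ?\<rho>" by (intro continuous_intros dc)
    show "0 \<le> f t" "0 \<le> ?\<mu> t" for t using C0 by (simp_all add: f_eq)
    fix t :: real assume t: "t \<in> {0..1}"
    let ?g1 = "\<lambda>s. norm (q s) * norm (d2 s) + (C * ?\<rho> s + c)" and ?g2 = "\<lambda>s. norm (q s) * norm (d1 s) + (C * ?\<rho> s + c)"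
    have g: "L1_01 ?g1" "L1_01 ?g2"
      by (intro set_integral_add L1_01_mult_left nq absolutely_integrable_continuous_real continuous_intros dc)+
    have i1: "L1_01 (\<lambda>s. q s * d2 s + e * D s)"
      by (intro set_integral_add L1_01_mult_left[OF q dc(2)]
          absolutely_integrable_continuous_real continuous_intros Dc)
    have i2: "L1_01 (\<lambda>s. G t s * (q s * d1 s - e * D' s))"
      by (intro L1_01_mult_right[OF _ Gc] set_integral_diff L1_01_mult_left[OF q dc(1)]
          absolutely_integrable_continuous_real continuous_intros Dc)
    have iR: "L1_01 (\<lambda>t. G t 0 * q t)" by (rule L1_01_mult_right[OF q G0c])
    have iQ: "L1_01 (\<lambda>s. G t s * q s)" by (rule L1_01_mult_right[OF q Gc])
    have "d1 t = integral {0..t} (\<lambda>s. \<sigma> * (G s 0 * q s) + (q s * d2 s + e * D s))"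
      unfolding d1_def w1_eq[OF t] by (simp add: d2_def algebra_simps)
    also have "\<dots> = \<sigma> * R t + integral {0..t} (\<lambda>s. q s * d2 s + e * D s)"
      unfolding R_def integral_mult_right[symmetric]
      using t by (intro integral_add integrable_on_mult_right
          L1_01_on(2)[OF iR] L1_01_on(2)[OF i1]) auto
    also have "norm \<dots> \<le> norm (R t) + integral {0..t} ?g1"
    proof (intro order_trans[OF norm_triangle_ineq] add_mono)
      show "norm (\<sigma> * R t) \<le> norm (R t)" by (simp add: norm_mult \<sigma>)
      show "norm (integral {0..t} (\<lambda>s. q s * d2 s + e * D s)) \<le> integral {0..t} ?g1"
      proof (rule norm_integral_01_le[OF i1 g(1) t])
        fix s assume "s \<in> {0..t}"
        then have s: "s \<in> {0..1}" using t by auto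
        have "norm (q s * d2 s + e * D s) \<le> norm (q s) * norm (d2 s) + norm (e * D s)"
          unfolding norm_mult[symmetric, of "q s"] by (rule norm_triangle_ineq)
        then show "norm (q s * d2 s + e * D s) \<le> ?g1 s" using nD(1)[OF s] unfolding c_def by linarith
      qed
    qed
    finally have 1: "norm (d1 t) \<le> norm (R t) + integral {0..t} ?g1" .
    have "d2 t = integral {0..t} (\<lambda>s. G t s * q s + G t s * (q s * d1 s - e * D' s))"
      unfolding d2_def w2_eq[OF t] by (simp add: d1_def algebra_simps)
    also have "\<dots> = Q t + integral {0..t} (\<lambda>s. G t s * (q s * d1 s - e * D' s))"
      unfolding Q_def
      using t by (intro integral_add
          L1_01_on(2)[OF iQ] L1_01_on(2)[OF i2]) auto
    also have "norm \<dots> \<le> norm (Q t) + integral {0..t} ?g2"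
    proof (intro order_trans[OF norm_triangle_ineq] add_mono order_refl)
      show "norm (integral {0..t} (\<lambda>s. G t s * (q s * d1 s - e * D' s))) \<le> integral {0..t} ?g2"
      proof (rule norm_integral_01_le[OF i2 g(2) t])
        fix s assume "s \<in> {0..t}"
        then have s: "s \<in> {0..1}" "s \<le> t" using t by auto
        have "norm (q s * d1 s - e * D' s) \<le> norm (q s) * norm (d1 s) + norm (e * D' s)"
          unfolding norm_mult[symmetric, of "q s"] by (rule norm_triangle_ineq4)
        then have "norm (q s * d1 s - e * D' s) \<le> ?g2 s" using nD(2)[OF s(1)] unfolding c_def by linarith
        then have "norm (G t s) * norm (q s * d1 s - e * D' s) \<le> 1 * ?g2 s"
          using G1[OF s(2)] by (intro mult_mono) auto
        then show "norm (G t s * (q s * d1 s - e * D' s)) \<le> ?g2 s" by (simp add: norm_mult)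
      qed
    qed
    finally have 2: "norm (d2 t) \<le> norm (Q t) + integral {0..t} ?g2" .
    have q\<rho>: "L1_01 (\<lambda>s. ?\<mu> s * ?\<rho> s)"
      by (intro L1_01_mult_left \<mu> continuous_intros dc)
    have "integral {0..t} ?g1 + integral {0..t} ?g2 = integral {0..t} (\<lambda>s. ?g1 s + ?g2 s)"
      using g t by (intro integral_add[symmetric] L1_01_on(2)) auto
    also have "\<dots> = integral {0..t} (\<lambda>s. ?\<mu> s * ?\<rho> s + 2 * c)"
      by (intro integral_cong) (simp add: algebra_simps)
    also have "\<dots> = integral {0..t} (\<lambda>s. ?\<mu> s * ?\<rho> s) + t * (2 * c)"
      using L1_01_on(2)[OF q\<rho>, of 0 t] t
      by (subst integral_add) auto
    also have "\<dots> \<le> integral {0..t} (\<lambda>s. ?\<mu> s * ?\<rho> s) + 2 * c"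
      using t c0 mult_right_mono[of t 1 "2 * c"] by simp
    finally show "?\<rho> t \<le> f t + integral {0..t} (\<lambda>s. ?\<mu> s * ?\<rho> s)"
      using 1 2 unfolding f_eq c4 by linarith
  qed auto
  have n: "norm (exp (\<i> * z)) = exp (- Im z)" by simp
  have E1: "exp (\<i> * z) * E 1 = 1" unfolding E_def by (simp add: exp_add[symmetric])
  have "Yp 1 - exp (\<i> * z) = exp (\<i> * z) * d1 1"
    using E1 by (simp add: d1_def w1_def algebra_simps)
  moreover have "Ym 1 - \<sigma> * exp (- (\<i> * z)) = exp (\<i> * z) * d2 1"
  proof -
    have "exp (\<i> * z) * G 1 0 = exp (- (\<i> * z))"
      unfolding G_def exp_add[symmetric] by (rule arg_cong[of _ _ exp]) simp
    then show ?thesis using E1 by (simp add: d2_def w2_def algebra_simps)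
  qed
  ultimately have "norm (Yp 1 - exp (\<i> * z)) + norm (Ym 1 - \<sigma> * exp (- (\<i> * z))) = exp (- Im z) * ?\<rho> 1"
    by (simp only: norm_mult n distrib_left)
  also have "\<dots> \<le> exp (- Im z) * total_error q C z e"
    using main unfolding total_error_def f_def by (intro mult_left_mono) auto
  finally show ?thesis .
qed

text \<open>At each x, two Carleson estimates, based at 0 and at x, and the bound on the
  \<open>e k\<close> control the sum of the squared Picard errors; Cauchy-Schwarz in t transfers
  this to the Gronwall term. The bound depends on \<open>q\<close> and \<open>C\<close> only, as the
  selection of points is arbitrary.\<close>

lemma sum_total_error_le:
  fixes q :: "real \<Rightarrow> complex"
  assumes q: "L1_01 q" "(\<lambda>t. (norm (q t))\<^sup>2) integrable_on {0..1}"
  shows "\<exists>M. \<forall>K z e. finite K \<longrightarrow> (\<forall>k\<in>K. Im (z k) \<le> 0 \<and> \<bar>2 * norm (z k) - 2 * pi * of_int k\<bar> \<le> pi) \<longrightarrow>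
    (\<Sum>k\<in>K. (norm (e k :: complex))\<^sup>2) \<le> 2 \<longrightarrow> (\<Sum>k\<in>K. (total_error q C (z k) (e k))\<^sup>2) \<le> M"
proof -
  define N where "N = integral {0..1} (\<lambda>t. (norm (q t))\<^sup>2)"
  define T where "T = 30720 * exp 2 * N"
  define c where "c = 4 * C"
  define P where "P = 3 * (T + T + c\<^sup>2 * 2)"
  define p where "p t = norm (q t) + 2 * C" for t
  define m where "m = exp (integral {0..1} p)"
  define W where "W = integral {0..1} (\<lambda>t. (p t)\<^sup>2)"
  have sq: "(\<Sum>k\<in>K. (picard_error q c (z k) (e k) x)\<^sup>2) \<le> P"
    if K: "finite K" and z: "\<And>k. k \<in> K \<Longrightarrow> Im (z k) \<le> 0 \<and> \<bar>2 * norm (z k) - 2 * pi * of_int k\<bar> \<le> pi"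
      and e: "(\<Sum>k\<in>K. (norm (e k))\<^sup>2) \<le> 2" and x: "x \<in> {0..1}" for K x and z e :: "int \<Rightarrow> complex"
  proof -
    \<comment> \<open>Truncating \<open>q\<close> rather than the interval puts all x under one
      Carleson estimate on [0,1], with squared norm at most \<open>N\<close>.\<close>
    define g where "g t = (if t \<in> {0..x} then q t else 0)" for t
    have g: "L1_01 g" "(\<lambda>t. (norm (g t))\<^sup>2) integrable_on {0..1}"
      "integral {0..1} (\<lambda>t. (norm (g t))\<^sup>2) \<le> N"
    proof -
      have x01: "{0..x} \<inter> {0..1} = {0..x}" using x by auto
      have "q absolutely_integrable_on {0..x}"
        by (rule L1_01_on(1)[OF q(1)]) (use x in auto)
      moreover have "(\<lambda>t. indicat_real {0..1} t *\<^sub>R g t) = (\<lambda>t. indicat_real {0..x} t *\<^sub>R q t)"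
        using x by (auto simp: g_def indicator_def fun_eq_iff)
      ultimately show "L1_01 g" by (simp add: set_integrable_def)
      have sqg: "(\<lambda>t. (norm (g t))\<^sup>2) = (\<lambda>t. if t \<in> {0..x} then (norm (q t))\<^sup>2 else 0)"
        by (auto simp: g_def)
      have i: "(\<lambda>t. (norm (q t))\<^sup>2) integrable_on {0..x}"
        using q(2) x by (auto intro: integrable_on_subinterval)
      then show gi: "(\<lambda>t. (norm (g t))\<^sup>2) integrable_on {0..1}"
        unfolding sqg integrable_restrict_Int x01 .
      show "integral {0..1} (\<lambda>t. (norm (g t))\<^sup>2) \<le> N"
        unfolding N_def by (intro integral_le gi q(2)) (auto simp: g_def)
    qed
    have T: "30720 * exp 2 * integral {0..1} (\<lambda>t. (norm (g t))\<^sup>2) \<le> T"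
      unfolding T_def using g(3) by simp
    have restr: "integral {0..x} (\<lambda>t. h t * q t) = integral {0..1} (\<lambda>t. h' t * g t)"
      if "\<And>t. t \<in> {0..x} \<Longrightarrow> h t = h' t" for h h' :: "real \<Rightarrow> complex"
    proof -
      have "integral {0..1} (\<lambda>t. h' t * g t) = integral {0..1} (\<lambda>t. if t \<in> {0..x} then h t * q t else 0)"
        using that by (intro integral_cong) (auto simp: g_def)
      also have "\<dots> = integral ({0..x} \<inter> {0..1}) (\<lambda>t. h t * q t)" by (rule integral_restrict_Int)
      also have "{0..x} \<inter> {0..1} = {0..x}" using x by auto
      finally show ?thesis by simp
    qed
    define \<xi> where "\<xi> k = - 2 * Re (z k)" for k
    define \<eta> where "\<eta> k = - 2 * Im (z k)" for k
    have r: "\<bar>sqrt ((\<xi> k)\<^sup>2 + (\<eta> k)\<^sup>2) - 2 * pi * of_int k\<bar> \<le> pi" if "k \<in> K" for k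
    proof -
      have "(\<xi> k)\<^sup>2 + (\<eta> k)\<^sup>2 = (2 * norm (z k))\<^sup>2"
        by (simp add: \<xi>_def \<eta>_def power_mult_distrib cmod_power2)
      then have "sqrt ((\<xi> k)\<^sup>2 + (\<eta> k)\<^sup>2) = \<bar>2 * norm (z k)\<bar>" by (simp only: real_sqrt_abs)
      then show ?thesis using z[OF that] by simp
    qed
    have \<eta>: "0 \<le> \<eta> k" if "k \<in> K" for k using z[OF that] by (simp add: \<eta>_def)
    have R: "integral {0..x} (\<lambda>t. exp (- 2 * \<i> * z k * of_real t) * q t)
        = integral {0..1} (\<lambda>t. poisson_fun 0 (\<xi> k) (\<eta> k) t * g t)" for k
    proof (rule restr)
      fix t assume "t \<in> {0..x}"
      then have "\<bar>t - 0\<bar> = t" by simp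
      then have "- 2 * \<i> * z k * of_real t = \<i> * of_real (\<xi> k * (t - 0)) - of_real (\<eta> k * \<bar>t - 0\<bar>)"
        by (simp add: \<xi>_def \<eta>_def complex_eq_iff algebra_simps)
      then show "exp (- 2 * \<i> * z k * of_real t) = poisson_fun 0 (\<xi> k) (\<eta> k) t"
        unfolding poisson_fun_def by (rule arg_cong[of _ _ exp])
    qed
    \<comment> \<open>Based at the right end x of the support of \<open>g\<close>: reversing time
      changes the sign of the frequency and keeps the damping, so the condition on the radius is
      unaffected.\<close>
    have Q: "integral {0..x} (\<lambda>t. exp (- 2 * \<i> * z k * of_real (x - t)) * q t)
        = integral {0..1} (\<lambda>t. poisson_fun x (- \<xi> k) (\<eta> k) t * g t)" for k
    proof (rule restr)
      fix t assume "t \<in> {0..x}"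
      then have "\<bar>t - x\<bar> = x - t" by simp
      then have "- 2 * \<i> * z k * of_real (x - t) = \<i> * of_real (- \<xi> k * (t - x)) - of_real (\<eta> k * \<bar>t - x\<bar>)"
        by (simp add: \<xi>_def \<eta>_def complex_eq_iff algebra_simps)
      then show "exp (- 2 * \<i> * z k * of_real (x - t)) = poisson_fun x (- \<xi> k) (\<eta> k) t"
        unfolding poisson_fun_def by (rule arg_cong[of _ _ exp])
    qed
    define I1 where "I1 k = norm (integral {0..1} (\<lambda>t. poisson_fun 0 (\<xi> k) (\<eta> k) t * g t))" for k
    define I2 where "I2 k = norm (integral {0..1} (\<lambda>t. poisson_fun x (- \<xi> k) (\<eta> k) t * g t))" for k
    have 1: "(\<Sum>k\<in>K. (I1 k)\<^sup>2) \<le> T" unfolding I1_def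
      by (rule order_trans[OF poisson_family_le[OF K \<eta> _ r g(1,2)] T]) auto
    have 2: "(\<Sum>k\<in>K. (I2 k)\<^sup>2) \<le> T" unfolding I2_def
      by (rule order_trans[OF poisson_family_le[OF K \<eta> x _ g(1,2)] T]) (auto simp: r)
    have "(\<Sum>k\<in>K. (picard_error q c (z k) (e k) x)\<^sup>2) \<le> (\<Sum>k\<in>K. 3 * ((I1 k)\<^sup>2 + (I2 k)\<^sup>2 + c\<^sup>2 * (norm (e k))\<^sup>2))"
    proof (rule sum_mono)
      fix k
      have 3: "(a + b + d)\<^sup>2 \<le> 3 * (a\<^sup>2 + b\<^sup>2 + d\<^sup>2)" for a b d :: real
      proof -
        have "0 \<le> (a - b)\<^sup>2 + (b - d)\<^sup>2 + (a - d)\<^sup>2" by simp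
        then show ?thesis by (simp add: power2_eq_square algebra_simps)
      qed
      show "(picard_error q c (z k) (e k) x)\<^sup>2 \<le> 3 * ((I1 k)\<^sup>2 + (I2 k)\<^sup>2 + c\<^sup>2 * (norm (e k))\<^sup>2)"
        unfolding picard_error_def R Q I1_def[symmetric] I2_def[symmetric]
        using 3[of "I1 k" "I2 k" "c * norm (e k)"] by (simp add: power_mult_distrib)
    qed
    also have "\<dots> = 3 * ((\<Sum>k\<in>K. (I1 k)\<^sup>2) + (\<Sum>k\<in>K. (I2 k)\<^sup>2) + c\<^sup>2 * (\<Sum>k\<in>K. (norm (e k))\<^sup>2))"
      by (simp add: sum_distrib_left sum.distrib distrib_left)
    also have "\<dots> \<le> P"
      unfolding P_def using 1 2 e by (intro mult_left_mono add_mono) auto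
    finally show ?thesis .
  qed
  have nq: "L1_01 (\<lambda>t. norm (q t))" using q(1) by (auto simp: absolutely_integrable_on_def)
  have p1: "L1_01 p"
    unfolding p_def by (intro set_integral_add nq absolutely_integrable_continuous_real continuous_intros)
  have p2: "(\<lambda>t. (p t)\<^sup>2) integrable_on {0..1}"
  proof -
    have "(p t)\<^sup>2 = (norm (q t))\<^sup>2 + (4 * C * norm (q t) + 4 * C\<^sup>2)" for t
      by (simp add: p_def power2_eq_square algebra_simps)
    then show ?thesis
      using nq by (auto simp: absolutely_integrable_on_def
        intro!: integrable_add q(2) integrable_on_mult_right)
  qed
  have W0: "W \<ge> 0" unfolding W_def by (rule integral_nonneg[OF p2]) simp
  have "(\<Sum>k\<in>K. (total_error q C (z k) (e k))\<^sup>2) \<le> 2 * (P + m\<^sup>2 * (W * P))"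
    if K: "finite K" and z: "\<And>k. k \<in> K \<Longrightarrow> Im (z k) \<le> 0 \<and> \<bar>2 * norm (z k) - 2 * pi * of_int k\<bar> \<le> pi"
      and e: "(\<Sum>k\<in>K. (norm (e k))\<^sup>2) \<le> 2" for K and z e :: "int \<Rightarrow> complex"
  proof -
    let ?f = "\<lambda>k. picard_error q c (z k) (e k)"
    let ?J = "\<lambda>k. integral {0..1} (\<lambda>t. (?f k t)\<^sup>2)"
    have fi: "(\<lambda>t. (?f k t)\<^sup>2) integrable_on {0..1}" for k
      by (intro integrable_continuous_real continuous_intros picard_error_continuous q)
    have "(\<Sum>k\<in>K. (total_error q C (z k) (e k))\<^sup>2) \<le> (\<Sum>k\<in>K. 2 * ((?f k 1)\<^sup>2 + m\<^sup>2 * (W * ?J k)))"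
    proof (rule sum_mono)
      fix k
      let ?I = "integral {0..1} (\<lambda>t. p t * ?f k t)"
      \<comment> \<open>The square moves under the integral, so the sum over k can be taken at each
        fixed t, where \<open>sq\<close> applies. Finiteness of \<open>W\<close> is where square
        integrability of \<open>q\<close> enters a second time.\<close>
      have "?I\<^sup>2 \<le> W * ?J k"
        unfolding W_def using L1_01_mult_left[OF p1 picard_error_continuous[OF q(1)]]
        by (intro integral_Cauchy_Schwarz_01 fi p2) (auto simp: absolutely_integrable_on_def)
      then have "m\<^sup>2 * ?I\<^sup>2 \<le> m\<^sup>2 * (W * ?J k)" by (intro mult_left_mono) auto
      moreover have "(?f k 1 + m * ?I)\<^sup>2 \<le> 2 * ((?f k 1)\<^sup>2 + m\<^sup>2 * ?I\<^sup>2)"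
      proof -
        have "0 \<le> (?f k 1 - m * ?I)\<^sup>2" by simp
        then show ?thesis by (simp add: power2_eq_square algebra_simps)
      qed
      ultimately show "(total_error q C (z k) (e k))\<^sup>2 \<le> 2 * ((?f k 1)\<^sup>2 + m\<^sup>2 * (W * ?J k))"
        unfolding total_error_def p_def[symmetric] c_def[symmetric] m_def[symmetric]
        by (meson order_trans mult_left_mono add_left_mono zero_le_numeral)
    qed
    also have "\<dots> = 2 * ((\<Sum>k\<in>K. (?f k 1)\<^sup>2) + m\<^sup>2 * (W * (\<Sum>k\<in>K. ?J k)))"
      by (simp add: sum_distrib_left sum.distrib distrib_left)
    also have "(\<Sum>k\<in>K. ?J k) = integral {0..1} (\<lambda>t. \<Sum>k\<in>K. (?f k t)\<^sup>2)"
      using K fi by (intro integral_sum[symmetric]) auto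
    also have "2 * ((\<Sum>k\<in>K. (?f k 1)\<^sup>2) + m\<^sup>2 * (W * integral {0..1} (\<lambda>t. \<Sum>k\<in>K. (?f k t)\<^sup>2))) \<le> 2 * (P + m\<^sup>2 * (W * P))"
    proof -
      have "integral {0..1} (\<lambda>t. \<Sum>k\<in>K. (?f k t)\<^sup>2) \<le> integral {0..1} (\<lambda>t::real. P)"
        using K fi sq[OF K z e] by (intro integral_le integrable_sum) auto
      then have "integral {0..1} (\<lambda>t. \<Sum>k\<in>K. (?f k t)\<^sup>2) \<le> P" by simp
      then show ?thesis using sq[OF K z e, of 1] W0 by (intro mult_left_mono add_mono) auto
    qed
    finally show ?thesis .
  qed
  then show ?thesis by blast
qed

text \<open>The factors exp (- u/4) and exp (u/4) give both off-diagonal coefficients the same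
  leading part s/4, up to sign, and their derivatives supply the u' in \<open>q\<close>. What
  remains is exp (- u) / (4 s) in one coefficient and exp u / (4 s) in the other: replacing both
  exponentials by 1 completes \<open>z\<close>, and the differences form \<open>A\<close> and
  \<open>B\<close>. The factor \<open>w\<close> is free for normalising initial values.\<close>

lemma column_system:
  fixes u u' uy F1 F2 :: "real \<Rightarrow> complex" and l s w :: complex
  defines "q \<equiv> \<lambda>x. (\<i> * uy x - u' x) / 4" and "z \<equiv> (s + inverse s) / 4"
    and "A \<equiv> \<lambda>x. \<i> / 8 * (exp (u x) + exp (- u x) - 2)" and "B \<equiv> \<lambda>x. \<i> / 8 * (exp (u x) - exp (- u x))"
    and "Yp \<equiv> \<lambda>x. w * (s * exp (- u x / 4) * F1 x + \<i> * (exp (u x / 4) * F2 x))"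
    and "Ym \<equiv> \<lambda>x. w * (s * exp (- u x / 4) * F1 x - \<i> * (exp (u x / 4) * F2 x))"
  assumes u: "ac_deriv u u'" and s: "s * s = l" "s \<noteq> 0"
    and F1: "ac_deriv F1 (\<lambda>x. alpha u uy l x $ 1 $ 1 * F1 x + alpha u uy l x $ 1 $ 2 * F2 x)"
    and F2: "ac_deriv F2 (\<lambda>x. alpha u uy l x $ 2 $ 1 * F1 x + alpha u uy l x $ 2 $ 2 * F2 x)"
  shows "ac_deriv Yp (\<lambda>x. \<i> * z * Yp x + q x * Ym x + inverse s * (A x * Yp x + B x * Ym x))"
    "ac_deriv Ym (\<lambda>x. - (\<i> * z) * Ym x + q x * Yp x - inverse s * (A x * Ym x + B x * Yp x))"
proof -
  define g h where "g x = exp (- u x / 4)" and "h x = exp (u x / 4)" for x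
  have "bounded_linear (\<lambda>v::complex. - v / 4)" "bounded_linear (\<lambda>v::complex. v / 4)"
    using bounded_linear_mult_right[of "- 1 / 4 :: complex"] bounded_linear_mult_right[of "1 / 4 :: complex"]
    by simp_all
  from this[THEN ac_deriv_linear[OF u], THEN ac_deriv_exp]
  have dg: "ac_deriv g (\<lambda>x. - u' x / 4 * g x)" and dh: "ac_deriv h (\<lambda>x. u' x / 4 * h x)"
    by (simp_all add: g_def[abs_def] h_def[abs_def])
  have ex: "g x * exp (u x / 2) = h x" "g x * exp (- u x / 2) = exp (- u x) * h x"
    "h x * exp (u x / 2) = exp (u x) * g x" "h x * exp (- u x / 2) = g x" for x
    unfolding g_def h_def exp_add[symmetric] by (rule arg_cong[of _ _ exp], simp add: field_simps)+
  define P N where "P x = s * (g x * F1 x)" and "N x = h x * F2 x" for x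
  have il: "s * inverse l = inverse s" using s by (auto simp: field_simps)
  have dP: "ac_deriv P (\<lambda>x. q x * P x - (s + inverse s * exp (- u x)) / 4 * N x)"
    unfolding P_def
  proof (rule ac_deriv_cong[OF ac_deriv_linear[OF ac_deriv_mult[OF dg F1] bounded_linear_mult_right[of s]]])
    fix x
    have "s * (- u' x / 4 * g x * F1 x + g x * (alpha u uy l x $ 1 $ 1 * F1 x + alpha u uy l x $ 1 $ 2 * F2 x))
      = q x * P x - (s * (g x * exp (u x / 2)) + s * inverse l * (g x * exp (- u x / 2))) / 4 * F2 x"
      unfolding alpha_components q_def P_def by (simp add: field_simps)
    also have "\<dots> = q x * P x - (s + inverse s * exp (- u x)) / 4 * N x"
      unfolding ex il N_def by (simp add: algebra_simps)
    finally show "s * (- u' x / 4 * g x * F1 x + g x * (alpha u uy l x $ 1 $ 1 * F1 x + alpha u uy l x $ 1 $ 2 * F2 x)) =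
      q x * (s * (g x * F1 x)) - (s + inverse s * exp (- u x)) / 4 * N x" unfolding P_def .
  qed simp
  have dN: "ac_deriv N (\<lambda>x. - q x * N x + (s + inverse s * exp (u x)) / 4 * P x)"
    unfolding N_def
  proof (rule ac_deriv_cong[OF ac_deriv_mult[OF dh F2]])
    fix x
    have "u' x / 4 * h x * F2 x + h x * (alpha u uy l x $ 2 $ 1 * F1 x + alpha u uy l x $ 2 $ 2 * F2 x)
      = - q x * N x + (h x * exp (u x / 2) + s * s * (h x * exp (- u x / 2))) / 4 * F1 x"
      unfolding alpha_components q_def N_def s(1) by (simp add: field_simps)
    also have "\<dots> = - q x * N x + (s + inverse s * exp (u x)) / 4 * P x"
      unfolding ex P_def using s(2) by (simp add: field_simps)
    finally show "u' x / 4 * h x * F2 x + h x * (alpha u uy l x $ 2 $ 1 * F1 x + alpha u uy l x $ 2 $ 2 * F2 x) =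
      - q x * (h x * F2 x) + (s + inverse s * exp (u x)) / 4 * P x" unfolding N_def .
  qed simp
  have Y: "Yp x = w * (P x + \<i> * N x)" "Ym x = w * (P x - \<i> * N x)" for x
    by (simp_all add: Yp_def Ym_def P_def N_def g_def h_def)
  note diN = ac_deriv_linear[OF dN bounded_linear_mult_right[of "\<i>"]]
  note lw = ac_deriv_linear[OF _ bounded_linear_mult_right[of w]]
  have ii: "\<i> * (\<i> * c) = - c" for c by (simp flip: mult.assoc)
  show "ac_deriv Yp (\<lambda>x. \<i> * z * Yp x + q x * Ym x + inverse s * (A x * Yp x + B x * Ym x))"
    unfolding Y[abs_def]
    by (rule ac_deriv_cong[OF lw[OF ac_deriv_add[OF dP diN]]])
      (simp_all add: Y z_def A_def B_def ii algebra_simps add_divide_distrib diff_divide_distrib)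
  show "ac_deriv Ym (\<lambda>x. - (\<i> * z) * Ym x + q x * Yp x - inverse s * (A x * Ym x + B x * Yp x))"
    unfolding Y[abs_def]
    by (rule ac_deriv_cong[OF lw[OF ac_deriv_sub[OF dP diN]]])
      (simp_all add: Y z_def A_def B_def ii algebra_simps add_divide_distrib diff_divide_distrib)
qed

text \<open>Suitably scaled, the two columns start at (1, 1) and (1, -1) in eigenvector coordinates;
  half sums and half differences of the resulting errors isolate the four entries. As
  \<open>u 1 = u 0\<close>, the conjugating matrix is the same at both ends, and the quotient of its
  diagonal entries is s \<tau>, which scales the off-diagonal entries.\<close>

lemma monodromy_estimate:
  fixes u u' uy :: "real \<Rightarrow> complex" and l s :: complex and C :: real
  defines "q \<equiv> \<lambda>x. (\<i> * uy x - u' x) / 4" and "z \<equiv> (s + inverse s) / 4"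
    and "A \<equiv> \<lambda>x. \<i> / 8 * (exp (u x) + exp (- u x) - 2)" and "B \<equiv> \<lambda>x. \<i> / 8 * (exp (u x) - exp (- u x))"
    and "\<tau> \<equiv> exp (- u 0 / 2)" and "M \<equiv> monodromy u uy l"
  defines "T \<equiv> exp (- Im z) * total_error q C z (inverse s)"
  assumes u: "ac_deriv u u'" and per: "u 1 = u 0" and uy: "L1_01 uy"
    and s: "s * s = l" "norm (inverse s) \<le> 1" "s \<noteq> 0" and z: "Im z \<le> 0"
    and C: "\<And>x. x \<in> {0..1} \<Longrightarrow> norm (A x) \<le> C" "\<And>x. x \<in> {0..1} \<Longrightarrow> norm (B x) \<le> C"
  shows "norm (M $ 1 $ 1 - cos z) \<le> T" "norm (M $ 2 $ 2 - cos z) \<le> T"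
    "norm (s * \<tau> * M $ 1 $ 2 + sin z) \<le> T" "norm (M $ 2 $ 1 / (s * \<tau>) - sin z) \<le> T"
proof -
  note uc = ac_deriv_continuous[OF u]
  have qi: "L1_01 q"
    unfolding q_def by (intro set_integrable_divide set_integral_diff set_integrable_mult_right uy ac_deriv_integrable[OF u])
  have Ac: "continuous_on {0..1} A" "continuous_on {0..1} B"
    unfolding A_def B_def by (intro continuous_intros uc)+
  obtain F where F: "is_frame u uy l F" using is_frame_picard[OF uc uy] by blast
  have M: "M = F 1" unfolding M_def by (rule monodromy_eqI[OF uc uy F])
  have dF: "ac_deriv F (\<lambda>x. alpha u uy l x ** F x)" and F0: "F 0 = mat 1" using F by (auto simp: is_frame_iff)
  note dFc = ac_deriv_matrix_component[OF dF]
  define g where "g = exp (- u 0 / 4)"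
  define h where "h = exp (u 0 / 4)"
  have gh: "g * h = 1" "g \<noteq> 0" "h \<noteq> 0" "\<tau> = g * g"
    unfolding g_def h_def \<tau>_def exp_add[symmetric] by simp_all
  have hh: "h = inverse g" using gh by (simp add: field_simps)
  have zz: "exp (\<i> * z) = cos z + \<i> * sin z" "exp (- (\<i> * z)) = cos z - \<i> * sin z"
    by (simp_all add: exp_Euler exp_minus_Euler)
  have half: "norm a \<le> T" if "norm b + norm c \<le> T" "2 * a = b + c" for a b c :: complex
  proof -
    have "2 * norm a = norm (b + c)" unfolding that(2)[symmetric] by (simp add: norm_mult)
    then show ?thesis using norm_triangle_ineq[of b c] that(1) norm_ge_zero[of a] by linarith
  qed
  have est: "norm (w * (s * g * F 1 $ 1 $ j + \<i> * (h * F 1 $ 2 $ j)) - exp (\<i> * z)) +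
      norm (w * (s * g * F 1 $ 1 $ j - \<i> * (h * F 1 $ 2 $ j)) - \<sigma> * exp (- (\<i> * z))) \<le> T"
    if "w * (s * g * F 0 $ 1 $ j + \<i> * (h * F 0 $ 2 $ j)) = 1"
      "w * (s * g * F 0 $ 1 $ j - \<i> * (h * F 0 $ 2 $ j)) = \<sigma>" "norm \<sigma> = 1" for w \<sigma> j
  proof -
    define Yp where "Yp x = w * (s * exp (- u x / 4) * F x $ 1 $ j + \<i> * (exp (u x / 4) * F x $ 2 $ j))" for x
    define Ym where "Ym x = w * (s * exp (- u x / 4) * F x $ 1 $ j - \<i> * (exp (u x / 4) * F x $ 2 $ j))" for x
    have "ac_deriv Yp (\<lambda>x. \<i> * z * Yp x + q x * Ym x + inverse s * (A x * Yp x + B x * Ym x))"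
      "ac_deriv Ym (\<lambda>x. - (\<i> * z) * Ym x + q x * Yp x - inverse s * (A x * Ym x + B x * Yp x))"
      unfolding q_def z_def A_def B_def Yp_def Ym_def by (rule column_system[OF u s(1,3) dFc dFc])+
    from diagonal_system_estimate[OF qi Ac(1) C(1) Ac(2) C(2) s(2) z that(3) this] that per
    show ?thesis
      unfolding T_def[symmetric] by (simp add: Yp_def Ym_def g_def h_def)
  qed
  have F00: "F 0 $ 1 $ 1 = 1" "F 0 $ 1 $ 2 = 0" "F 0 $ 2 $ 1 = 0" "F 0 $ 2 $ 2 = 1"
    by (simp_all add: F0 mat_def)
  \<comment> \<open>The first column starts at (1, 0), so the scaling 1/(s g) gives both components
    the value 1.\<close>
  define p1 where "p1 = inverse (s * g) * (s * g * F 1 $ 1 $ 1 + \<i> * (h * F 1 $ 2 $ 1)) - exp (\<i> * z)"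
  define m1 where "m1 = inverse (s * g) * (s * g * F 1 $ 1 $ 1 - \<i> * (h * F 1 $ 2 $ 1)) - 1 * exp (- (\<i> * z))"
  have 1: "norm p1 + norm m1 \<le> T"
    unfolding p1_def m1_def by (rule est) (use F00 s gh in \<open>simp_all add: field_simps\<close>)
  have e1: "p1 = (F 1 $ 1 $ 1 - cos z) + \<i> * (F 1 $ 2 $ 1 / (s * \<tau>) - sin z)"
    "m1 = (F 1 $ 1 $ 1 - cos z) - \<i> * (F 1 $ 2 $ 1 / (s * \<tau>) - sin z)"
    using s(3) gh(2) unfolding p1_def m1_def zz hh gh(4) by (simp_all add: field_simps)
  \<comment> \<open>The second column starts at (0, 1), so the scaling 1/(i h) gives the components
    the values 1 and -1.\<close>
  define p2 where "p2 = inverse (\<i> * h) * (s * g * F 1 $ 1 $ 2 + \<i> * (h * F 1 $ 2 $ 2)) - exp (\<i> * z)"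
  define m2 where "m2 = inverse (\<i> * h) * (s * g * F 1 $ 1 $ 2 - \<i> * (h * F 1 $ 2 $ 2)) - (- 1) * exp (- (\<i> * z))"
  have 2: "norm p2 + norm m2 \<le> T"
    unfolding p2_def m2_def by (rule est) (use F00 s gh in \<open>simp_all add: field_simps\<close>)
  have e2: "p2 = (F 1 $ 2 $ 2 - cos z) - \<i> * (s * \<tau> * F 1 $ 1 $ 2 + sin z)"
    "m2 = - (F 1 $ 2 $ 2 - cos z) - \<i> * (s * \<tau> * F 1 $ 1 $ 2 + sin z)"
    using gh(2) unfolding p2_def m2_def zz hh gh(4) by (simp_all add: field_simps)
  show "norm (M $ 1 $ 1 - cos z) \<le> T"
    unfolding M by (rule half[of p1 m1]) (use 1 in simp, simp add: e1)
  show "norm (M $ 2 $ 2 - cos z) \<le> T"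
    unfolding M by (rule half[of p2 "- m2"]) (use 2 in simp, simp add: e2)
  have "norm (\<i> * (M $ 2 $ 1 / (s * \<tau>) - sin z)) \<le> T"
    unfolding M by (rule half[of p1 "- m1"]) (use 1 in simp, simp add: e1)
  then show "norm (M $ 2 $ 1 / (s * \<tau>) - sin z) \<le> T" by (simp add: norm_mult)
  have "norm (- \<i> * (s * \<tau> * M $ 1 $ 2 + sin z)) \<le> T"
    unfolding M by (rule half[of p2 m2]) (use 2 in simp, simp add: e2)
  then show "norm (s * \<tau> * M $ 1 $ 2 + sin z) \<le> T" by (simp add: norm_mult)
qed

text \<open>Singletons K show that \<open>E\<close> is bounded on each \<open>S k\<close>. Choosing
  in each nonempty \<open>S k\<close> a point where \<open>E\<close> reaches at least half its
  supremum, the uniform bound along this selection makes the squared suprema sum to at most 4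
  M.\<close>

lemma sup_family_square_summable:
  fixes E :: "'a \<Rightarrow> real" and S :: "int \<Rightarrow> 'a set"
  assumes E: "\<And>l. 0 \<le> E l"
    and M: "\<And>K l. finite K \<Longrightarrow> K \<subseteq> {k. 0 < k} \<Longrightarrow> (\<And>k. k \<in> K \<Longrightarrow> l k \<in> S k) \<Longrightarrow> (\<Sum>k\<in>K. (E (l k))\<^sup>2) \<le> M"
  shows "\<exists>\<epsilon>. (\<forall>k. 0 \<le> \<epsilon> k) \<and> (\<lambda>k. (\<epsilon> k)\<^sup>2) summable_on {k. 0 < k} \<and> (\<forall>k>0. \<forall>l\<in>S k. E l \<le> \<epsilon> k)"
proof -
  have bdd: "bdd_above (E ` S k)" if "k > 0" for k
  proof (rule bdd_aboveI2)
    fix l assume "l \<in> S k"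
    then have "(E l)\<^sup>2 \<le> M" using M[of "{k}" "\<lambda>_. l"] that by simp
    then show "E l \<le> sqrt M" by (rule real_le_rsqrt)
  qed
  define \<epsilon> where "\<epsilon> k = (if k > 0 \<and> S k \<noteq> {} then SUP l\<in>S k. E l else 0)" for k
  have upper: "E l \<le> \<epsilon> k" if "k > 0" "l \<in> S k" for k l
    using that bdd[OF that(1)] by (auto simp: \<epsilon>_def intro: cSUP_upper)
  have nonneg: "0 \<le> \<epsilon> k" for k
  proof (cases "k > 0 \<and> S k \<noteq> {}")
    case True
    then obtain l where "l \<in> S k" by blast
    then show ?thesis using upper[of k l] E[of l] True by linarith
  qed (auto simp: \<epsilon>_def)
  have "\<exists>l. l \<in> S k \<and> \<epsilon> k \<le> 2 * E l" if k: "k > 0" and ne: "S k \<noteq> {}" for k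
  proof (cases "\<epsilon> k = 0")
    case True
    then show ?thesis using ne E by fastforce
  next
    case False
    then have "\<epsilon> k / 2 < (SUP l\<in>S k. E l)" using nonneg[of k] k ne by (simp add: \<epsilon>_def)
    then obtain l where "l \<in> S k" "\<epsilon> k / 2 < E l"
      using less_cSUP_iff[OF ne bdd[OF k]] by blast
    then show ?thesis by (intro exI[of _ l]) auto
  qed
  then obtain l where l: "\<And>k. k > 0 \<Longrightarrow> S k \<noteq> {} \<Longrightarrow> l k \<in> S k \<and> \<epsilon> k \<le> 2 * E (l k)" by metis
  have "(\<Sum>k\<in>K. (\<epsilon> k)\<^sup>2) \<le> 4 * M" if K: "finite K" "K \<subseteq> {k. 0 < k}" for K
  proof -
    have "(\<Sum>k\<in>K. (\<epsilon> k)\<^sup>2) = (\<Sum>k\<in>{k\<in>K. S k \<noteq> {}}. (\<epsilon> k)\<^sup>2)"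
      using K by (intro sum.mono_neutral_right) (auto simp: \<epsilon>_def)
    also have "\<dots> \<le> (\<Sum>k\<in>{k\<in>K. S k \<noteq> {}}. 4 * (E (l k))\<^sup>2)"
    proof (rule sum_mono)
      fix k assume "k \<in> {k\<in>K. S k \<noteq> {}}"
      then have "\<epsilon> k \<le> 2 * E (l k)" using l K by auto
      from power_mono[OF this nonneg, of 2] show "(\<epsilon> k)\<^sup>2 \<le> 4 * (E (l k))\<^sup>2" by (simp add: power_mult_distrib)
    qed
    also have "\<dots> = 4 * (\<Sum>k\<in>{k\<in>K. S k \<noteq> {}}. (E (l k))\<^sup>2)" by (simp add: sum_distrib_left)
    also have "\<dots> \<le> 4 * M" using K l by (intro mult_left_mono M) auto
    finally show ?thesis .
  qed
  then have "(\<lambda>k. (\<epsilon> k)\<^sup>2) summable_on {k. 0 < k}"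
    by (intro nonneg_bdd_above_summable_on bdd_aboveI2[where M = "4 * M"]) auto
  then show ?thesis using nonneg upper by blast
qed

section \<open>The vacuum and the size of zeta on the annuli\<close>

lemma csqrt_square: "csqrt l * csqrt l = l"
  using power2_csqrt[of l] by (simp add: power2_eq_square)

lemma norm_csqrt_square: "norm (csqrt l) * norm (csqrt l) = norm l"
  by (metis csqrt_square norm_mult)

lemma zeta_norm_bounds:
  "4 * norm (zeta l) \<le> norm (csqrt l) + inverse (norm (csqrt l))"
  "norm (csqrt l) \<le> 4 * norm (zeta l) + inverse (norm (csqrt l))"
  "inverse (norm (csqrt l)) \<le> 4 * norm (zeta l) + norm (csqrt l)"
proof -
  have z: "4 * zeta l = csqrt l + inverse (csqrt l)" by (simp add: zeta_def)
  have n: "4 * norm (zeta l) = norm (csqrt l + inverse (csqrt l))" unfolding z[symmetric] by (simp add: norm_mult)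
  show "4 * norm (zeta l) \<le> norm (csqrt l) + inverse (norm (csqrt l))"
    unfolding n norm_inverse[symmetric] by (rule norm_triangle_ineq)
  show "norm (csqrt l) \<le> 4 * norm (zeta l) + inverse (norm (csqrt l))"
    unfolding n norm_inverse[symmetric] using norm_triangle_ineq4[of "csqrt l + inverse (csqrt l)" "inverse (csqrt l)"] by simp
  show "inverse (norm (csqrt l)) \<le> 4 * norm (zeta l) + norm (csqrt l)"
    unfolding n norm_inverse[symmetric] using norm_triangle_ineq4[of "csqrt l + inverse (csqrt l)" "csqrt l"] by simp
qed

text \<open>Since |csqrt l| > 1, the numbers 4 |zeta l| and |csqrt l| differ by at most 1; with 3 <
  \<pi> < 4 this gives 12 k - 7 \<le> |csqrt l| \<le> 16 k + 9, and k \<ge> 1.\<close>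

lemma annulus_pos:
  assumes "k > 0" "l \<in> annulus k"
  shows "l \<noteq> 0" "\<bar>2 * norm (zeta l) - 2 * pi * of_int k\<bar> \<le> pi"
    "1 < norm (csqrt l)" "of_int k \<le> norm (csqrt l)" "norm (csqrt l) \<le> 26 * of_int k"
proof -
  have l: "(of_int k - 1/2) * pi \<le> norm (zeta l)" "norm (zeta l) \<le> (of_int k + 1/2) * pi" "norm l > 1" "l \<noteq> 0"
    using assms by (auto simp: annulus_def)
  show "l \<noteq> 0" by fact
  show "\<bar>2 * norm (zeta l) - 2 * pi * of_int k\<bar> \<le> pi"
    using l(1,2) by (simp add: abs_le_iff algebra_simps)
  show s1: "1 < norm (csqrt l)"
  proof (rule ccontr)
    assume "\<not> 1 < norm (csqrt l)"
    then have "norm (csqrt l) * norm (csqrt l) \<le> 1 * 1" by (intro mult_mono) auto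
    then show False using l(3) norm_csqrt_square[of l] by simp
  qed
  then have i: "inverse (norm (csqrt l)) \<le> 1" by (simp add: inverse_le_1_iff)
  have k: "1 \<le> real_of_int k" using assms(1) by simp
  have "4 * ((of_int k - 1/2) * pi) \<le> norm (csqrt l) + 1" using zeta_norm_bounds(1)[of l] l(1) i by linarith
  moreover have "(of_int k - 1/2) * 3 \<le> (of_int k - 1/2) * pi"
    using k pi_gt3 by (intro mult_left_mono) auto
  moreover define X where "X = (of_int k - 1/2) * pi"
  ultimately show "of_int k \<le> norm (csqrt l)" using k unfolding X_def[symmetric] by (simp add: algebra_simps)
  have "norm (csqrt l) \<le> 4 * ((of_int k + 1/2) * pi) + 1" using zeta_norm_bounds(2)[of l] l(2) i by linarith
  moreover have "(of_int k + 1/2) * pi \<le> (of_int k + 1/2) * 4"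
    using k pi_less_4 by (intro mult_left_mono) auto
  moreover define Y where "Y = (of_int k + 1/2) * pi"
  ultimately show "norm (csqrt l) \<le> 26 * of_int k" using k unfolding Y_def[symmetric] by (simp add: algebra_simps)
qed

text \<open>Recognising the vacuum functions as monodromy entries for u = 0 yields their holomorphy
  across the branch cut of \<open>csqrt\<close> and their behaviour under inversion from the general
  statements.\<close>

lemma vacuum_monodromy:
  assumes l: "l \<noteq> 0"
  shows "monodromy (\<lambda>_. 0) (\<lambda>_. 0) l $ 1 $ 1 = a0 l" "monodromy (\<lambda>_. 0) (\<lambda>_. 0) l $ 1 $ 2 = b0 l"
    "monodromy (\<lambda>_. 0) (\<lambda>_. 0) l $ 2 $ 1 = c0 l" "monodromy (\<lambda>_. 0) (\<lambda>_. 0) l $ 2 $ 2 = d0 l"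
proof -
  define s where "s = csqrt l"
  define z where "z = zeta l"
  have s: "s \<noteq> 0" "s * s = l" using l by (simp_all add: s_def csqrt_square)
  have z: "z = (s + inverse s) / 4" by (simp add: z_def s_def zeta_def)
  define F :: "real \<Rightarrow> complex^2^2" where
    "F x = vector [vector [cos (z * of_real x), - inverse s * sin (z * of_real x)],
       vector [s * sin (z * of_real x), cos (z * of_real x)]]" for x
  have F: "F x $ 1 $ 1 = cos (z * of_real x)" "F x $ 1 $ 2 = - inverse s * sin (z * of_real x)"
    "F x $ 2 $ 1 = s * sin (z * of_real x)" "F x $ 2 $ 2 = cos (z * of_real x)" for x
    by (simp_all add: F_def)
  have dc: "ac_deriv (\<lambda>x. w * cos (z * of_real x)) (\<lambda>x. - w * z * sin (z * of_real x))" for w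
    by (rule ac_deriv_has_vector_derivative)
      (auto intro!: has_vector_derivative_real_field derivative_eq_intros continuous_intros)
  have ds: "ac_deriv (\<lambda>x. w * sin (z * of_real x)) (\<lambda>x. w * z * cos (z * of_real x))" for w
    by (rule ac_deriv_has_vector_derivative)
      (auto intro!: has_vector_derivative_real_field derivative_eq_intros continuous_intros)
  let ?A = "alpha (\<lambda>_. 0) (\<lambda>_. 0) l"
  have A: "?A x $ 1 $ 1 = 0" "?A x $ 1 $ 2 = - inverse s * z" "?A x $ 2 $ 1 = s * z" "?A x $ 2 $ 2 = 0" for x
    using s(1) unfolding alpha_components z s(2)[symmetric] by (simp_all add: field_simps)
  have "ac_deriv F (\<lambda>x. ?A x ** F x)"
  proof (rule ac_deriv_matrixI)
    have *: "(?A x ** F x) $ i $ j = ?A x $ i $ 1 * F x $ 1 $ j + ?A x $ i $ 2 * F x $ 2 $ j" for x i j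
      by (simp add: matrix_matrix_mult_def sum_2)
    have 11: "ac_deriv (\<lambda>x. F x $ 1 $ 1) (\<lambda>x. (?A x ** F x) $ 1 $ 1)"
      by (rule ac_deriv_cong[OF dc[of 1]]) (use s(1) in \<open>simp_all only: * F A, simp_all\<close>)
    have 12: "ac_deriv (\<lambda>x. F x $ 1 $ 2) (\<lambda>x. (?A x ** F x) $ 1 $ 2)"
      by (rule ac_deriv_cong[OF ds[of "- inverse s"]]) (simp_all only: * F A, simp_all)
    have 21: "ac_deriv (\<lambda>x. F x $ 2 $ 1) (\<lambda>x. (?A x ** F x) $ 2 $ 1)"
      by (rule ac_deriv_cong[OF ds[of s]]) (simp_all only: * F A, simp_all)
    have 22: "ac_deriv (\<lambda>x. F x $ 2 $ 2) (\<lambda>x. (?A x ** F x) $ 2 $ 2)"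
      by (rule ac_deriv_cong[OF dc[of 1]]) (use s(1) in \<open>simp_all only: * F A, simp_all\<close>)
    fix i j :: 2
    show "ac_deriv (\<lambda>x. F x $ i $ j) (\<lambda>x. (?A x ** F x) $ i $ j)"
      using 11 12 21 22 exhaust_2[of i] exhaust_2[of j] by auto
  qed
  moreover have "F 0 = mat 1" by (simp add: vec_eq_iff forall_2 F mat_def)
  ultimately have "is_frame (\<lambda>_. 0) (\<lambda>_. 0) l F" by (simp add: is_frame_iff)
  then have "monodromy (\<lambda>_. 0) (\<lambda>_. 0) l = F 1" by (intro monodromy_eqI) auto
  then show "monodromy (\<lambda>_. 0) (\<lambda>_. 0) l $ 1 $ 1 = a0 l" "monodromy (\<lambda>_. 0) (\<lambda>_. 0) l $ 1 $ 2 = b0 l"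
    "monodromy (\<lambda>_. 0) (\<lambda>_. 0) l $ 2 $ 1 = c0 l" "monodromy (\<lambda>_. 0) (\<lambda>_. 0) l $ 2 $ 2 = d0 l"
    by (simp_all add: F a0_def b0_def c0_def d0_def s_def z_def)
qed

lemma vacuum_holomorphic:
  "a0 holomorphic_on - {0}" "b0 holomorphic_on - {0}" "c0 holomorphic_on - {0}" "d0 holomorphic_on - {0}"
proof -
  have h: "(\<lambda>l. monodromy (\<lambda>_. 0) (\<lambda>_. 0) l $ i $ j) holomorphic_on - {0}" for i j
    by (rule monodromy_holomorphic) auto
  show "a0 holomorphic_on - {0}" by (rule holomorphic_transform[OF h[of 1 1]]) (simp add: vacuum_monodromy)
  show "b0 holomorphic_on - {0}" by (rule holomorphic_transform[OF h[of 1 2]]) (simp add: vacuum_monodromy)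
  show "c0 holomorphic_on - {0}" by (rule holomorphic_transform[OF h[of 2 1]]) (simp add: vacuum_monodromy)
  show "d0 holomorphic_on - {0}" by (rule holomorphic_transform[OF h[of 2 2]]) (simp add: vacuum_monodromy)
qed

lemma vacuum_inverse:
  assumes l: "l \<noteq> 0"
  shows "a0 (inverse l) = a0 l" "b0 (inverse l) = l * b0 l" "c0 (inverse l) = inverse l * c0 l" "d0 (inverse l) = d0 l"
  using monodromy_inverse[of "\<lambda>_. 0" "\<lambda>_. 0" l] l vacuum_monodromy[OF l] vacuum_monodromy[of "inverse l"]
  by auto

text \<open>The square of \<open>zeta m\<close> is (m + 2 + 1/m) / 16, which is free of branches and
  symmetric under inversion, so the two values agree up to sign.\<close>

lemma zeta_inverse:
  assumes l: "l \<noteq> 0"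
  shows "norm (zeta (inverse l)) = norm (zeta l)" "\<bar>Im (zeta (inverse l))\<bar> = \<bar>Im (zeta l)\<bar>"
proof -
  have sq: "(zeta m)\<^sup>2 = (m + 2 + inverse m) / 16" if "m \<noteq> 0" for m
  proof -
    have "(zeta m)\<^sup>2 = (csqrt m * csqrt m + 2 * (csqrt m * inverse (csqrt m)) + inverse (csqrt m * csqrt m)) / 16"
      by (simp add: zeta_def power2_eq_square field_simps)
    then show ?thesis using that by (simp add: csqrt_square)
  qed
  have "inverse l \<noteq> 0" using l by simp
  then have "(zeta (inverse l))\<^sup>2 = (zeta l)\<^sup>2"
    unfolding sq[OF l] sq[OF \<open>inverse l \<noteq> 0\<close>] by (simp add: add_ac)
  then have "zeta (inverse l) = zeta l \<or> zeta (inverse l) = - zeta l" by (simp add: power2_eq_iff)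
  then show "norm (zeta (inverse l)) = norm (zeta l)" "\<bar>Im (zeta (inverse l))\<bar> = \<bar>Im (zeta l)\<bar>" by auto
qed

lemma annulus_inverse:
  assumes "l \<in> annulus k"
  shows "inverse l \<in> annulus (- k)" "l \<noteq> 0"
proof -
  show l: "l \<noteq> 0" using assms by (auto simp: annulus_def split: if_splits)
  then have "norm l < 1 \<longleftrightarrow> 1 < norm (inverse l)" "1 < norm l \<longleftrightarrow> norm (inverse l) < 1"
    by (auto simp: norm_inverse one_less_inverse_iff inverse_less_1_iff)
  then show "inverse l \<in> annulus (- k)"
    using assms l zeta_inverse[OF l] by (auto simp: annulus_def split: if_splits)
qed

text \<open>As \<open>kern 1 n\<close> is 1 / (n + 1)^2, this is the telescoping kernel bound with
  the index shifted by one.\<close>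

lemma sum_inverse_square_le:
  assumes "finite K" "K \<subseteq> {k::int. 0 < k}"
  shows "(\<Sum>k\<in>K. (inverse (of_int k :: real))\<^sup>2) \<le> 2"
proof -
  have "(\<Sum>k\<in>K. (inverse (of_int k :: real))\<^sup>2) = (\<Sum>k\<in>K. kern 1 (real (nat (k - 1))))"
    using assms by (intro sum.cong) (auto simp: kern_def power_inverse divide_inverse)
  also have "\<dots> = (\<Sum>n\<in>(\<lambda>k. nat (k - 1)) ` K. kern 1 (real n))"
  proof (subst sum.reindex)
    show "inj_on (\<lambda>k. nat (k - 1)) K"
    proof (rule inj_onI)
      fix x y assume xy: "x \<in> K" "y \<in> K" "nat (x - 1) = nat (y - 1)"
      then have "0 < x" "0 < y" using assms(2) by auto
      then show "x = y" using xy(3) by simp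
    qed
  qed simp
  also have "\<dots> \<le> 2" using assms by (intro sum_kern_nat_le) auto
  finally show ?thesis .
qed

text \<open>The suprema are taken of the sum of all four normalised errors, so one sequence serves
  every entry. The powers of k appear when the factors s \<tau> of \<open>monodromy_estimate\<close>
  are undone, since |csqrt l| is comparable to k on \<open>annulus k\<close>.\<close>

lemma monodromy_l2_estimate:
  assumes pot: "(u, uy) \<in> Pot"
  defines "\<tau> \<equiv> exp (- u 0 / 2)" and "M \<equiv> monodromy u uy"
  shows "\<exists>\<epsilon> D. (\<forall>k. 0 \<le> \<epsilon> k) \<and> 0 \<le> D \<and> (\<lambda>k. (\<epsilon> k)\<^sup>2) summable_on {k. 0 < k} \<and>
    (\<forall>k>0. \<forall>l\<in>annulus k.
      norm (M l $ 1 $ 1 - a0 l) \<le> \<epsilon> k * exp \<bar>Im (zeta l)\<bar> \<and>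
      norm (M l $ 2 $ 2 - d0 l) \<le> \<epsilon> k * exp \<bar>Im (zeta l)\<bar> \<and>
      norm (M l $ 1 $ 2 - inverse \<tau> * b0 l) \<le> D / of_int k * \<epsilon> k * exp \<bar>Im (zeta l)\<bar> \<and>
      norm (M l $ 2 $ 1 - \<tau> * c0 l) \<le> D * of_int k * \<epsilon> k * exp \<bar>Im (zeta l)\<bar>)"
proof -
  obtain u' where u: "ac_deriv u u'" and u': "u' \<in> L2_01" and uy: "uy \<in> L2_01" and per: "u 1 = u 0"
    using PotE[OF pot] .
  note uc = ac_deriv_continuous[OF u] and uyi = L2_01_integrable(1)[OF uy]
  define q where "q x = (\<i> * uy x - u' x) / 4" for x
  define A B where "A x = \<i> / 8 * (exp (u x) + exp (- u x) - 2)" and "B x = \<i> / 8 * (exp (u x) - exp (- u x))" for x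
  have q1: "L1_01 q"
    unfolding q_def by (intro set_integrable_divide set_integral_diff set_integrable_mult_right uyi ac_deriv_integrable[OF u])
  have q2: "(\<lambda>x. (norm (q x))\<^sup>2) integrable_on {0..1}"
  proof -
    have "L1_01 (\<lambda>x. (norm (q x))\<^sup>2)"
    proof (rule measurable_bounded_by_integrable_imp_absolutely_integrable)
      show "(\<lambda>x. (norm (q x))\<^sup>2) \<in> borel_measurable (lebesgue_on {0..1})"
      proof -
        have "q \<in> borel_measurable (lebesgue_on {0..1})"
          using absolutely_integrable_imp_borel_measurable[OF q1] by simp
        then show ?thesis by measurable
      qed
      show "(\<lambda>x. (norm (uy x))\<^sup>2 + (norm (u' x))\<^sup>2) integrable_on {0..1}"
        by (intro integrable_add L2_01_integrable uy u')
      fix x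
      have "4 * norm (q x) \<le> norm (uy x) + norm (u' x)"
        using norm_triangle_ineq4[of "\<i> * uy x" "u' x"] by (simp add: q_def norm_divide norm_mult)
      from power_mono[OF this, of 2] have "16 * (norm (q x))\<^sup>2 \<le> (norm (uy x) + norm (u' x))\<^sup>2"
        by (simp add: power_mult_distrib)
      moreover have "0 \<le> (norm (uy x) - norm (u' x))\<^sup>2" by simp
      moreover have "0 \<le> (norm (uy x))\<^sup>2" "0 \<le> (norm (u' x))\<^sup>2" by simp_all
      ultimately have "(norm (q x))\<^sup>2 \<le> (norm (uy x))\<^sup>2 + (norm (u' x))\<^sup>2"
        unfolding power2_sum power2_diff by linarith
      then show "norm ((norm (q x))\<^sup>2) \<le> (norm (uy x))\<^sup>2 + (norm (u' x))\<^sup>2" by simp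
    qed auto
    then show ?thesis by (auto simp: absolutely_integrable_on_def)
  qed
  have "\<exists>C. \<forall>x\<in>{0..1}. norm (A x) \<le> C \<and> norm (B x) \<le> C"
  proof -
    have "bounded (A ` {0..1})" "bounded (B ` {0..1})"
      unfolding A_def B_def using uc
      by (auto intro!: compact_imp_bounded compact_continuous_image continuous_intros)
    then obtain C1 C2 where "\<And>x. x \<in> {0..1} \<Longrightarrow> norm (A x) \<le> C1" "\<And>x. x \<in> {0..1} \<Longrightarrow> norm (B x) \<le> C2"
      unfolding bounded_iff by blast
    then show ?thesis by (intro exI[of _ "max C1 C2"]) (auto simp: le_max_iff_disj)
  qed
  then obtain C where C: "\<And>x. x \<in> {0..1} \<Longrightarrow> norm (A x) \<le> C" "\<And>x. x \<in> {0..1} \<Longrightarrow> norm (B x) \<le> C" by blast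
  obtain N where "\<forall>K (z :: int \<Rightarrow> complex) (e :: int \<Rightarrow> complex). finite K \<longrightarrow>
      (\<forall>k\<in>K. Im (z k) \<le> 0 \<and> \<bar>2 * norm (z k) - 2 * pi * of_int k\<bar> \<le> pi) \<longrightarrow>
      (\<Sum>k\<in>K. (norm (e k))\<^sup>2) \<le> 2 \<longrightarrow> (\<Sum>k\<in>K. (total_error q C (z k) (e k))\<^sup>2) \<le> N"
    using sum_total_error_le[OF q1 q2, of C] by (elim exE) (rule that)
  note N = this[rule_format]
  \<comment> \<open>The root is chosen so that Im z \<le> 0, as \<open>monodromy_estimate\<close>
    demands. Changing the signs of \<open>s\<close> and \<open>z\<close> together alters the four
    estimated expressions at most by a sign.\<close>
  define s where "s l = (if Im (zeta l) \<le> 0 then csqrt l else - csqrt l)" for l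
  define z where "z l = (s l + inverse (s l)) / 4" for l
  have z: "Im (z l) = - \<bar>Im (zeta l)\<bar>" "norm (z l) = norm (zeta l)" for l
  proof -
    have "z l = (if Im (zeta l) \<le> 0 then zeta l else - zeta l)"
      by (auto simp: z_def s_def zeta_def add_divide_distrib)
    then show "Im (z l) = - \<bar>Im (zeta l)\<bar>" "norm (z l) = norm (zeta l)" by auto
  qed
  define E where "E l = exp (- \<bar>Im (zeta l)\<bar>) * (norm (M l $ 1 $ 1 - a0 l) + norm (M l $ 2 $ 2 - d0 l) +
     norm (csqrt l * \<tau> * M l $ 1 $ 2 + sin (zeta l)) + norm (M l $ 2 $ 1 / (csqrt l * \<tau>) - sin (zeta l)))" for l
  have E0: "0 \<le> E l" for l by (simp add: E_def)
  have E_le: "E l \<le> 4 * total_error q C (z l) (inverse (s l))" if k: "k > 0" and l: "l \<in> annulus k" for k l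
  proof -
    note an = annulus_pos[OF k l]
    have s: "s l * s l = l" "norm (inverse (s l)) \<le> 1" "s l \<noteq> 0" "Im (z l) \<le> 0"
      using an by (auto simp: s_def csqrt_square norm_inverse inverse_le_1_iff z)
    let ?T = "exp \<bar>Im (zeta l)\<bar> * total_error q C (z l) (inverse (s l))"
    have zl: "exp (- Im (z l)) = exp \<bar>Im (zeta l)\<bar>" by (simp add: z)
    note est = monodromy_estimate[OF u per uyi s[unfolded z_def] C[unfolded A_def B_def],
        folded q_def z_def \<tau>_def M_def, unfolded zl]
    have zs: "z l = zeta l \<and> s l = csqrt l \<or> z l = - zeta l \<and> s l = - csqrt l"
      by (auto simp: z_def s_def zeta_def add_divide_distrib)
    have "norm (M l $ 1 $ 1 - a0 l) \<le> ?T" using est(1) zs by (auto simp: a0_def)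
    moreover have "norm (M l $ 2 $ 2 - d0 l) \<le> ?T" using est(2) zs by (auto simp: d0_def)
    moreover have "norm (csqrt l * \<tau> * M l $ 1 $ 2 + sin (zeta l)) \<le> ?T"
      using est(3) zs norm_minus_cancel[of "csqrt l * \<tau> * M l $ 1 $ 2 + sin (zeta l)"] by auto
    moreover have "norm (M l $ 2 $ 1 / (csqrt l * \<tau>) - sin (zeta l)) \<le> ?T"
      using est(4) zs norm_minus_cancel[of "M l $ 2 $ 1 / (csqrt l * \<tau>) - sin (zeta l)"] by auto
    ultimately have "E l \<le> exp (- \<bar>Im (zeta l)\<bar>) * (?T + ?T + ?T + ?T)"
      unfolding E_def by (intro mult_left_mono add_mono) auto
    also have "\<dots> = 4 * total_error q C (z l) (inverse (s l))"
      by (simp add: exp_minus field_simps)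
    finally show ?thesis .
  qed
  have "(\<Sum>k\<in>K. (E (l k))\<^sup>2) \<le> 16 * N"
    if K: "finite K" "K \<subseteq> {k. 0 < k}" and l: "\<And>k. k \<in> K \<Longrightarrow> l k \<in> annulus k" for K and l :: "int \<Rightarrow> complex"
  proof -
    have kl: "0 < k" "l k \<in> annulus k" if "k \<in> K" for k using K l that by auto
    have "(\<Sum>k\<in>K. (E (l k))\<^sup>2) \<le> (\<Sum>k\<in>K. 16 * (total_error q C (z (l k)) (inverse (s (l k))))\<^sup>2)"
    proof (rule sum_mono)
      fix k assume k: "k \<in> K"
      from power_mono[OF E_le[OF kl[OF k]] E0, of 2]
      show "(E (l k))\<^sup>2 \<le> 16 * (total_error q C (z (l k)) (inverse (s (l k))))\<^sup>2"
        by (simp add: power_mult_distrib)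
    qed
    also have "\<dots> = 16 * (\<Sum>k\<in>K. (total_error q C (z (l k)) (inverse (s (l k))))\<^sup>2)"
      by (simp add: sum_distrib_left)
    also have "(\<Sum>k\<in>K. (total_error q C (z (l k)) (inverse (s (l k))))\<^sup>2) \<le> N"
    proof (rule N[OF K(1)])
      fix k assume "k \<in> K"
      from annulus_pos(2)[OF kl[OF this]]
      show "Im (z (l k)) \<le> 0 \<and> \<bar>2 * norm (z (l k)) - 2 * pi * of_int k\<bar> \<le> pi" by (simp add: z)
    next
      have "(\<Sum>k\<in>K. (norm (inverse (s (l k))))\<^sup>2) \<le> (\<Sum>k\<in>K. (inverse (of_int k :: real))\<^sup>2)"
      proof (intro sum_mono power_mono)
        fix k assume k: "k \<in> K"
        have "norm (inverse (s (l k))) = inverse (norm (csqrt (l k)))" by (simp add: s_def norm_inverse)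
        also have "\<dots> \<le> inverse (of_int k)"
          using annulus_pos(4)[OF kl[OF k]] kl(1)[OF k] by (intro le_imp_inverse_le) auto
        finally show "norm (inverse (s (l k))) \<le> inverse (of_int k)" .
      qed simp
      also have "\<dots> \<le> 2" by (rule sum_inverse_square_le[OF K])
      finally show "(\<Sum>k\<in>K. (norm (inverse (s (l k))))\<^sup>2) \<le> 2" .
    qed
    finally show ?thesis by simp
  qed
  from sup_family_square_summable[of E annulus, OF E0 this]
  obtain \<epsilon> where \<epsilon>: "\<And>k. 0 \<le> \<epsilon> k" "(\<lambda>k. (\<epsilon> k)\<^sup>2) summable_on {k. 0 < k}"
    "\<And>k l. k > 0 \<Longrightarrow> l \<in> annulus k \<Longrightarrow> E l \<le> \<epsilon> k" by blast
  \<comment> \<open>The first summand serves the upper right entry, where 1 / |csqrt l| \<le> 1 / k;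
    the second serves the lower left one, where |csqrt l| \<le> 26 k.\<close>
  define D where "D = norm (inverse \<tau>) + 26 * norm \<tau>"
  have D0: "0 \<le> D" by (simp add: D_def)
  have \<tau>: "\<tau> \<noteq> 0" by (simp add: \<tau>_def)
  have "norm (M l $ 1 $ 1 - a0 l) \<le> \<epsilon> k * exp \<bar>Im (zeta l)\<bar> \<and>
      norm (M l $ 2 $ 2 - d0 l) \<le> \<epsilon> k * exp \<bar>Im (zeta l)\<bar> \<and>
      norm (M l $ 1 $ 2 - inverse \<tau> * b0 l) \<le> D / of_int k * \<epsilon> k * exp \<bar>Im (zeta l)\<bar> \<and>
      norm (M l $ 2 $ 1 - \<tau> * c0 l) \<le> D * of_int k * \<epsilon> k * exp \<bar>Im (zeta l)\<bar>"
    if k: "k > 0" and l: "l \<in> annulus k" for k l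
  proof -
    note an = annulus_pos[OF k l]
    define n3 where "n3 = csqrt l * \<tau> * M l $ 1 $ 2 + sin (zeta l)"
    define n4 where "n4 = M l $ 2 $ 1 / (csqrt l * \<tau>) - sin (zeta l)"
    define X where "X = \<epsilon> k * exp \<bar>Im (zeta l)\<bar>"
    have "E l * exp \<bar>Im (zeta l)\<bar> \<le> X"
      unfolding X_def by (intro mult_right_mono \<epsilon>(3)[OF k l]) auto
    moreover have "E l * exp \<bar>Im (zeta l)\<bar> = norm (M l $ 1 $ 1 - a0 l) + norm (M l $ 2 $ 2 - d0 l) + norm n3 + norm n4"
      unfolding E_def n3_def n4_def by (simp add: exp_minus field_simps)
    ultimately have S: "norm (M l $ 1 $ 1 - a0 l) + norm (M l $ 2 $ 2 - d0 l) + norm n3 + norm n4 \<le> X" by simp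
    have le: "norm (M l $ 1 $ 1 - a0 l) \<le> X" "norm (M l $ 2 $ 2 - d0 l) \<le> X" "norm n3 \<le> X" "norm n4 \<le> X"
      using S norm_ge_zero[of "M l $ 1 $ 1 - a0 l"] norm_ge_zero[of "M l $ 2 $ 2 - d0 l"] norm_ge_zero[of n3] norm_ge_zero[of n4]
      by linarith+
    have c: "csqrt l \<noteq> 0" using an by auto
    have ik: "inverse (norm (csqrt l)) \<le> inverse (of_int k)"
      using an(4) k by (intro le_imp_inverse_le) auto
    have "M l $ 1 $ 2 - inverse \<tau> * b0 l = inverse \<tau> * inverse (csqrt l) * n3"
      using c \<tau> by (simp add: n3_def b0_def field_simps)
    then have "norm (M l $ 1 $ 2 - inverse \<tau> * b0 l) = norm (inverse \<tau>) * inverse (norm (csqrt l)) * norm n3"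
      by (simp add: norm_mult norm_inverse)
    also have "\<dots> \<le> D * inverse (of_int k) * X"
      using ik le(3) D0 k by (intro mult_mono) (auto simp: D_def)
    finally have b: "norm (M l $ 1 $ 2 - inverse \<tau> * b0 l) \<le> D / of_int k * X" by (simp add: divide_inverse)
    have "M l $ 2 $ 1 - \<tau> * c0 l = \<tau> * csqrt l * n4"
      using c \<tau> by (simp add: n4_def c0_def field_simps)
    then have "norm (M l $ 2 $ 1 - \<tau> * c0 l) = norm \<tau> * norm (csqrt l) * norm n4" by (simp add: norm_mult)
    also have "\<dots> \<le> norm \<tau> * (26 * of_int k) * X"
      using an(5) le(4) k by (intro mult_mono) auto
    also have "\<dots> \<le> D * of_int k * X"
      using k order_trans[OF norm_ge_zero le(4)] by (intro mult_right_mono) (auto simp: D_def algebra_simps)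
    finally show ?thesis using le(1,2) b by (simp add: X_def mult.assoc)
  qed
  then show ?thesis using \<epsilon>(1,2) D0 by (intro exI[of _ \<epsilon>] exI[of _ D]) blast
qed

section \<open>Membership in the asymptotic spaces\<close>

lemma Pot_uminus:
  assumes "(u, uy) \<in> Pot"
  shows "((\<lambda>x. - u x), uy) \<in> Pot"
proof -
  obtain u' where u: "ac_deriv u u'" and u': "u' \<in> L2_01" and uy: "uy \<in> L2_01" and per: "u 1 = u 0"
    using PotE[OF assms] .
  have neg: "(\<lambda>x. - f x) \<in> L2_01" if "f \<in> L2_01" for f using that by (simp add: L2_01_def)
  have "u \<in> L2_01" using assms by (simp add: Pot_def W12_01_def)
  moreover have "has_weak_derivative_01 (\<lambda>x. - u x) (\<lambda>x. - u' x)"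
    using ac_deriv_minus[OF u] by (simp add: weak_deriv_iff_ac_deriv ac_deriv_continuous)
  ultimately show ?thesis
    using neg u' uy per ac_deriv_continuous[OF ac_deriv_minus[OF u]] by (auto simp: Pot_def W12_01_def)
qed

text \<open>From 4 |zeta l| \<le> 2\<pi> < 7 it follows that |csqrt l| and its inverse are at most
  8, so \<open>annulus 0\<close> lies in a compact ring avoiding 0. The index 0 therefore imposes no
  asymptotic condition.\<close>

lemma holomorphic_bounded_annulus_0:
  assumes "f holomorphic_on - {0}"
  shows "\<exists>b\<ge>0. \<forall>l\<in>annulus 0. norm (f l) \<le> b"
proof -
  have sub: "annulus 0 \<subseteq> cball 0 64 - ball 0 (1/64)"
  proof
    fix l assume "l \<in> annulus 0"
    then have l: "norm (zeta l) \<le> pi / 2" "l \<noteq> 0" by (auto simp: annulus_def)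
    define r where "r = norm (csqrt l)"
    have r: "r > 0" using l by (simp add: r_def)
    have b: "r \<le> 7 + inverse r" "inverse r \<le> 7 + r"
      using zeta_norm_bounds(2,3)[of l] l(1) pi_less_4 pi_approx by (auto simp: r_def)
    have "r \<le> 8"
    proof (rule ccontr)
      assume "\<not> r \<le> 8"
      moreover from this have "inverse r \<le> 1" using r by (simp add: inverse_le_1_iff)
      ultimately show False using b(1) by linarith
    qed
    moreover have "inverse r \<le> 8"
    proof (cases "r \<le> 1")
      case False
      then have "inverse r \<le> 1" using r by (simp add: inverse_le_1_iff)
      then show ?thesis by simp
    qed (use b(2) in linarith)
    then have "1 / 8 \<le> r" using r by (simp add: field_simps)
    ultimately have "r * r \<le> 8 * 8" "1 / 8 * (1 / 8) \<le> r * r" using r by (intro mult_mono; simp)+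
    then show "l \<in> cball 0 64 - ball 0 (1/64)" using norm_csqrt_square[of l] by (simp add: r_def)
  qed
  have c: "compact (cball 0 64 - ball 0 (1/64) :: complex set)" by (intro compact_diff) auto
  have "continuous_on (cball 0 64 - ball 0 (1/64)) f"
    by (rule continuous_on_subset[OF holomorphic_on_imp_continuous_on[OF assms]]) auto
  from compact_imp_bounded[OF compact_continuous_image[OF this c]]
  obtain b where b: "\<forall>y\<in>f ` (cball 0 64 - ball 0 (1/64)). norm y \<le> b" unfolding bounded_iff by blast
  show ?thesis
  proof (intro exI[of _ "max b 0"] conjI ballI)
    fix l assume "l \<in> annulus 0"
    then have "norm (f l) \<le> b" using b sub by blast
    then show "norm (f l) \<le> max b 0" by simp
  qed simp
qed

lemma As_inftyI:
  assumes f: "f holomorphic_on - {0}" and \<epsilon>: "\<And>k. 0 \<le> \<epsilon> k" "(\<lambda>k. (\<epsilon> k)\<^sup>2) summable_on {k. 0 < k}" and D: "0 \<le> D"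
    and le: "\<And>k l. k > 0 \<Longrightarrow> l \<in> annulus k \<Longrightarrow>
      norm (f l) \<le> D * (of_int k powi - n) * \<epsilon> k * exp \<bar>Im (zeta l)\<bar>"
  shows "f \<in> As_infty n 1"
proof -
  obtain b where b: "0 \<le> b" "\<And>l. l \<in> annulus 0 \<Longrightarrow> norm (f l) \<le> b"
    using holomorphic_bounded_annulus_0[OF f] by blast
  \<comment> \<open>At k = 0 a finite bound is enough, because the exponential factor is at least
    1.\<close>
  define a where "a k = (if k > 0 then D * (of_int k powi - n) * \<epsilon> k else b)" for k :: int
  have "0 \<le> a k" for k unfolding a_def using \<epsilon>(1) D b(1) by auto
  moreover have "(\<lambda>k. complex_of_real (a k)) \<in> l2_pos n"
  proof -
    have "(\<lambda>k. D\<^sup>2 * (\<epsilon> k)\<^sup>2) summable_on {k. 0 < k}" by (rule summable_on_cmult_right[OF \<epsilon>(2)])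
    also have "?this \<longleftrightarrow> (\<lambda>k. (cmod (of_int k powi n * complex_of_real (a k)))\<^sup>2) summable_on {k. 0 < k}"
    proof (rule summable_on_cong)
      fix k :: int assume "k \<in> {k. 0 < k}"
      then have k: "0 < k" by simp
      have "cmod (of_int k powi n * complex_of_real (a k)) = (of_int k powi n * of_int k powi - n) * (D * \<epsilon> k)"
        using k \<epsilon>(1)[of k] D by (simp add: a_def norm_mult norm_power_int)
      also have "\<dots> = D * \<epsilon> k" using k by (simp add: power_int_minus)
      finally show "D\<^sup>2 * (\<epsilon> k)\<^sup>2 = (cmod (of_int k powi n * complex_of_real (a k)))\<^sup>2"
        by (simp add: power_mult_distrib)
    qed
    finally show ?thesis by (simp add: l2_pos_def)
  qed
  moreover have "cmod (f l) \<le> a k * exp (1 * \<bar>Im (zeta l)\<bar>)" if "k \<ge> 0" "l \<in> annulus k" for k l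
  proof (cases "k > 0")
    case True
    then show ?thesis using le[OF True that(2)] by (simp add: a_def)
  next
    case False
    then have "k = 0" using that by simp
    then have "norm (f l) \<le> b * 1" using b(2) that by simp
    also have "\<dots> \<le> b * exp \<bar>Im (zeta l)\<bar>" using b(1) by (intro mult_left_mono) auto
    finally show ?thesis using False by (simp add: a_def)
  qed
  ultimately show ?thesis using f unfolding As_infty_def by blast
qed

text \<open>Inversion carries \<open>annulus k\<close> to \<open>annulus (- k)\<close> and preserves
  |Im zeta|, so this is \<open>As_inftyI\<close> for \<open>f \<circ> inverse\<close> with the
  sequence reflected.\<close>

lemma As_zeroI:
  assumes f: "f holomorphic_on - {0}" and \<epsilon>: "\<And>k. 0 \<le> \<epsilon> k" "(\<lambda>k. (\<epsilon> k)\<^sup>2) summable_on {k. 0 < k}" and D: "0 \<le> D"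
    and le: "\<And>k l. k > 0 \<Longrightarrow> l \<in> annulus k \<Longrightarrow>
      norm (f (inverse l)) \<le> D * (of_int k powi - m) * \<epsilon> k * exp \<bar>Im (zeta l)\<bar>"
  shows "f \<in> As_zero m 1"
proof -
  have "(f \<circ> inverse) holomorphic_on - {0}"
    by (rule holomorphic_on_compose_gen[OF _ f]) (auto intro!: holomorphic_intros)
  from As_inftyI[OF this \<epsilon> D] le have "f \<circ> inverse \<in> As_infty m 1" by simp
  then obtain a where a: "\<And>k. k \<ge> 0 \<Longrightarrow> 0 \<le> a k" "(\<lambda>k. complex_of_real (a k)) \<in> l2_pos m"
    "\<And>k l. k \<ge> 0 \<Longrightarrow> l \<in> annulus k \<Longrightarrow> norm (f (inverse l)) \<le> a k * exp (1 * \<bar>Im (zeta l)\<bar>)"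
    unfolding As_infty_def by auto
  have "(\<lambda>k. complex_of_real (a (- k))) \<in> l2_neg m"
  proof -
    have "bij_betw uminus {k::int. k < 0} {k. 0 < k}"
      by (rule bij_betw_byWitness[where f' = uminus]) auto
    from summable_on_reindex_bij_betw[OF this, of "\<lambda>k. (cmod (of_int k powi m * complex_of_real (a k)))\<^sup>2"] a(2)
    show ?thesis by (simp add: l2_pos_def l2_neg_def norm_mult norm_power_int)
  qed
  moreover have "norm (f l) \<le> a (- k) * exp (1 * \<bar>Im (zeta l)\<bar>)" if "k \<le> 0" "l \<in> annulus k" for k l
    using a(3)[of "- k" "inverse l"] that annulus_inverse[OF that(2)] by (simp add: zeta_inverse)
  moreover have "0 \<le> a (- k)" if "k \<le> 0" for k using a(1)[of "- k"] that by simp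
  ultimately show ?thesis
    using f unfolding As_zero_def by (intro CollectI conjI exI[of _ "\<lambda>k. a (- k)"]) auto
qed

lemma As_infty_As_zero:
  assumes "f \<in> As_infty n s" "f \<in> As_zero m s"
  shows "f \<in> As n m s"
proof -
  obtain a where a: "\<And>k. k \<ge> 0 \<Longrightarrow> 0 \<le> a k" "(\<lambda>k. complex_of_real (a k)) \<in> l2_pos n"
    "\<And>k l. k \<ge> 0 \<Longrightarrow> l \<in> annulus k \<Longrightarrow> cmod (f l) \<le> a k * exp (s * \<bar>Im (zeta l)\<bar>)"
    using assms(1) unfolding As_infty_def by blast
  obtain b where b: "\<And>k. k \<le> 0 \<Longrightarrow> 0 \<le> b k" "(\<lambda>k. complex_of_real (b k)) \<in> l2_neg m"
    "\<And>k l. k \<le> 0 \<Longrightarrow> l \<in> annulus k \<Longrightarrow> cmod (f l) \<le> b k * exp (s * \<bar>Im (zeta l)\<bar>)"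
    using assms(2) unfolding As_zero_def by blast
  define c where "c k = (if k \<ge> 0 then a k else b k)" for k
  have "(\<lambda>k. complex_of_real (c k)) \<in> l2 n m"
  proof -
    have "(\<lambda>k. (cmod (of_int k powi n * complex_of_real (c k)))\<^sup>2) summable_on {k. 0 < k} \<longleftrightarrow>
        (\<lambda>k. (cmod (of_int k powi n * complex_of_real (a k)))\<^sup>2) summable_on {k. 0 < k}"
      by (rule summable_on_cong) (simp add: c_def)
    moreover have "(\<lambda>k. (cmod (of_int k powi m * complex_of_real (c k)))\<^sup>2) summable_on {k. k < 0} \<longleftrightarrow>
        (\<lambda>k. (cmod (of_int k powi m * complex_of_real (b k)))\<^sup>2) summable_on {k. k < 0}"
      by (rule summable_on_cong) (simp add: c_def)
    ultimately show ?thesis using a(2) b(2) by (simp add: l2_def l2_pos_def l2_neg_def)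
  qed
  moreover have "0 \<le> c k" for k using a(1) b(1) by (simp add: c_def)
  moreover have "cmod (f l) \<le> c k * exp (s * \<bar>Im (zeta l)\<bar>)" if "l \<in> annulus k" for k l
    using a(3)[of k l] b(3)[of k l] that by (simp add: c_def)
  moreover have "f holomorphic_on - {0}" using assms(1) by (simp add: As_infty_def)
  ultimately show ?thesis unfolding As_def by blast
qed

theorem theorem3p1:
  fixes u uy :: "real \<Rightarrow> complex"
    and a b c d :: "complex \<Rightarrow> complex"
    and \<tau> :: complex
  assumes "(u, uy) \<in> Pot"
  defines "a \<equiv> \<lambda>lam. monodromy u uy lam $ 1 $ 1"
    and "b \<equiv> \<lambda>lam. monodromy u uy lam $ 1 $ 2"
    and "c \<equiv> \<lambda>lam. monodromy u uy lam $ 2 $ 1"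
    and "d \<equiv> \<lambda>lam. monodromy u uy lam $ 2 $ 2"
    and "\<tau> \<equiv> exp (- u 0 / 2)"
  shows "(\<lambda>lam. a lam - a0 lam) \<in> As 0 0 1 \<and>
         (\<lambda>lam. b lam - inverse \<tau> * b0 lam) \<in> As_infty 1 1 \<and>
         (\<lambda>lam. b lam - \<tau> * b0 lam) \<in> As_zero (-1) 1 \<and>
         (\<lambda>lam. c lam - \<tau> * c0 lam) \<in> As_infty (-1) 1 \<and>
         (\<lambda>lam. c lam - inverse \<tau> * c0 lam) \<in> As_zero 1 1 \<and>
         (\<lambda>lam. d lam - d0 lam) \<in> As 0 0 1"
proof -
  obtain u' where u: "ac_deriv u u'" and uy: "uy \<in> L2_01"
    using PotE[OF assms(1)] by blast
  note uc = ac_deriv_continuous[OF u] and uyi = L2_01_integrable(1)[OF uy]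
  have hol: "a holomorphic_on - {0}" "b holomorphic_on - {0}" "c holomorphic_on - {0}" "d holomorphic_on - {0}"
    unfolding a_def b_def c_def d_def by (rule monodromy_holomorphic[OF uc uyi])+
  note hol = hol vacuum_holomorphic
  \<comment> \<open>The potential with -u has \<open>inverse \<tau>\<close> in the place of \<tau>,
    which is why the factors of \<open>b0\<close> and \<open>c0\<close> are interchanged between the
    two ends.\<close>
  have \<tau>': "exp (- (- u 0) / 2) = inverse \<tau>" "inverse (inverse \<tau>) = \<tau>"
    by (simp_all add: \<tau>_def exp_minus[symmetric])
  obtain \<epsilon> D where \<epsilon>: "\<And>k. 0 \<le> \<epsilon> k" "(\<lambda>k. (\<epsilon> k)\<^sup>2) summable_on {k. 0 < k}" and D: "0 \<le> D"
    and est: "\<And>k l. k > 0 \<Longrightarrow> l \<in> annulus k \<Longrightarrow>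
      norm (a l - a0 l) \<le> \<epsilon> k * exp \<bar>Im (zeta l)\<bar> \<and>
      norm (d l - d0 l) \<le> \<epsilon> k * exp \<bar>Im (zeta l)\<bar> \<and>
      norm (b l - inverse \<tau> * b0 l) \<le> D / of_int k * \<epsilon> k * exp \<bar>Im (zeta l)\<bar> \<and>
      norm (c l - \<tau> * c0 l) \<le> D * of_int k * \<epsilon> k * exp \<bar>Im (zeta l)\<bar>"
    using monodromy_l2_estimate[OF assms(1)] unfolding a_def b_def c_def d_def \<tau>_def by blast
  obtain \<delta> D' where \<delta>: "\<And>k. 0 \<le> \<delta> k" "(\<lambda>k. (\<delta> k)\<^sup>2) summable_on {k. 0 < k}" and D': "0 \<le> D'"
    and est': "\<And>k l. k > 0 \<Longrightarrow> l \<in> annulus k \<Longrightarrow>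
      norm (monodromy (\<lambda>x. - u x) uy l $ 1 $ 1 - a0 l) \<le> \<delta> k * exp \<bar>Im (zeta l)\<bar> \<and>
      norm (monodromy (\<lambda>x. - u x) uy l $ 2 $ 2 - d0 l) \<le> \<delta> k * exp \<bar>Im (zeta l)\<bar> \<and>
      norm (monodromy (\<lambda>x. - u x) uy l $ 1 $ 2 - \<tau> * b0 l) \<le> D' / of_int k * \<delta> k * exp \<bar>Im (zeta l)\<bar> \<and>
      norm (monodromy (\<lambda>x. - u x) uy l $ 2 $ 1 - inverse \<tau> * c0 l) \<le> D' * of_int k * \<delta> k * exp \<bar>Im (zeta l)\<bar>"
    using monodromy_l2_estimate[OF Pot_uminus[OF assms(1)]] unfolding \<tau>' by blast
  \<comment> \<open>Passing from l to its inverse multiplies the upper right entry by l and the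
    lower left one by 1/l. With k^2 \<le> |l| \<le> 676 k^2, where 676 = 26^2, the orders 1/k and k
    in \<open>est'\<close> become k and 1/k.\<close>
  have neg: "norm (a (inverse l) - a0 (inverse l)) \<le> \<delta> k * exp \<bar>Im (zeta l)\<bar>"
      "norm (d (inverse l) - d0 (inverse l)) \<le> \<delta> k * exp \<bar>Im (zeta l)\<bar>"
      "norm (b (inverse l) - \<tau> * b0 (inverse l)) \<le> 676 * D' * of_int k * \<delta> k * exp \<bar>Im (zeta l)\<bar>"
      "norm (c (inverse l) - inverse \<tau> * c0 (inverse l)) \<le> 676 * D' / of_int k * \<delta> k * exp \<bar>Im (zeta l)\<bar>"
    if k: "k > 0" and l: "l \<in> annulus k" for k l
  proof -
    note l0 = annulus_pos(1)[OF k l]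
    let ?M = "monodromy (\<lambda>x. - u x) uy l"
    have M: "?M $ 1 $ 1 = a (inverse l)" "l * ?M $ 1 $ 2 = b (inverse l)"
      "inverse l * ?M $ 2 $ 1 = c (inverse l)" "?M $ 2 $ 2 = d (inverse l)"
      using monodromy_inverse[OF uc uyi, of "inverse l"] l0 by (simp_all add: a_def b_def c_def d_def)
    note e = est'[OF k l]
    then show "norm (a (inverse l) - a0 (inverse l)) \<le> \<delta> k * exp \<bar>Im (zeta l)\<bar>"
      "norm (d (inverse l) - d0 (inverse l)) \<le> \<delta> k * exp \<bar>Im (zeta l)\<bar>"
      by (auto simp: M vacuum_inverse l0)
    define X where "X = \<delta> k * exp \<bar>Im (zeta l)\<bar>"
    have X: "0 \<le> X" using \<delta>(1) by (simp add: X_def)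
    have k0: "0 < real_of_int k" using k by simp
    have nl: "norm l \<le> (26 * of_int k) * (26 * of_int k)" "of_int k * of_int k \<le> norm l"
      using annulus_pos(4,5)[OF k l] k0 by (subst norm_csqrt_square[of l, symmetric], intro mult_mono; simp)+
    have "b (inverse l) - \<tau> * b0 (inverse l) = l * (?M $ 1 $ 2 - \<tau> * b0 l)"
      by (simp add: M(2)[symmetric] vacuum_inverse l0 algebra_simps)
    then have "norm (b (inverse l) - \<tau> * b0 (inverse l)) = norm l * norm (?M $ 1 $ 2 - \<tau> * b0 l)"
      by (simp add: norm_mult)
    also have "\<dots> \<le> ((26 * of_int k) * (26 * of_int k)) * (D' / of_int k * X)"
      using e k0 by (intro mult_mono[OF nl(1)]) (auto simp: X_def mult.assoc)
    also have "\<dots> = 676 * D' * of_int k * X" using k0 by (simp add: field_simps)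
    finally show "norm (b (inverse l) - \<tau> * b0 (inverse l)) \<le> 676 * D' * of_int k * \<delta> k * exp \<bar>Im (zeta l)\<bar>"
      by (simp add: X_def mult.assoc)
    have "c (inverse l) - inverse \<tau> * c0 (inverse l) = inverse l * (?M $ 2 $ 1 - inverse \<tau> * c0 l)"
      by (simp add: M(3)[symmetric] vacuum_inverse l0 algebra_simps)
    then have "norm (c (inverse l) - inverse \<tau> * c0 (inverse l)) = inverse (norm l) * norm (?M $ 2 $ 1 - inverse \<tau> * c0 l)"
      by (simp add: norm_mult norm_inverse)
    also have "\<dots> \<le> inverse (of_int k * of_int k) * (D' * of_int k * X)"
      using e k0 by (intro mult_mono[OF le_imp_inverse_le[OF nl(2)]]) (auto simp: X_def mult.assoc)
    also have "\<dots> = 1 * (D' / of_int k * X)" using k0 by (simp add: field_simps)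
    also have "\<dots> \<le> 676 * (D' / of_int k * X)" using k0 D' X by (intro mult_right_mono) auto
    finally show "norm (c (inverse l) - inverse \<tau> * c0 (inverse l)) \<le> 676 * D' / of_int k * \<delta> k * exp \<bar>Im (zeta l)\<bar>"
      by (simp add: X_def mult.assoc)
  qed
  have "(\<lambda>l. a l - a0 l) \<in> As_infty 0 1" "(\<lambda>l. d l - d0 l) \<in> As_infty 0 1"
    by (rule As_inftyI[OF _ \<epsilon>, where D = 1]; use est hol in \<open>auto intro!: holomorphic_intros\<close>)+
  moreover have "(\<lambda>l. a l - a0 l) \<in> As_zero 0 1" "(\<lambda>l. d l - d0 l) \<in> As_zero 0 1"
    by (rule As_zeroI[OF _ \<delta>, where D = 1]; use neg hol in \<open>auto intro!: holomorphic_intros\<close>)+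
  moreover have "(\<lambda>l. b l - inverse \<tau> * b0 l) \<in> As_infty 1 1"
    by (rule As_inftyI[OF _ \<epsilon> D]; use est hol in \<open>auto intro!: holomorphic_intros simp: power_int_minus divide_inverse\<close>)
  moreover have "(\<lambda>l. c l - \<tau> * c0 l) \<in> As_infty (-1) 1"
    by (rule As_inftyI[OF _ \<epsilon> D]; use est hol in \<open>auto intro!: holomorphic_intros\<close>)
  moreover have "(\<lambda>l. b l - \<tau> * b0 l) \<in> As_zero (-1) 1"
    by (rule As_zeroI[OF _ \<delta>, where D = "676 * D'"]; use neg hol D' in \<open>auto intro!: holomorphic_intros\<close>)
  moreover have "(\<lambda>l. c l - inverse \<tau> * c0 l) \<in> As_zero 1 1"
    by (rule As_zeroI[OF _ \<delta>, where D = "676 * D'"];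
        use neg hol D' in \<open>auto intro!: holomorphic_intros simp: power_int_minus divide_inverse\<close>)
  ultimately show ?thesis by (auto intro: As_infty_As_zero)
qed

end
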